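(* Let $N\ge2$, let $M$ be the unit sphere in $\mathbb C^N$ and let $p\in M$. Then there is a real-analytic real hypersurface $M'\subset\mathbb C^{N+1}$ such that, for every $\ell\ge2$, the mapping locus $E_\ell\subset M'$ is a singular subset of $M'$ (that is, $E_\ell$ is not a real-analytic submanifold of $M'$).
   Context: $E_\ell$ is the set of all points $p'\in M'$ for which there exists a germ of a holomorphic map $H\colon(\mathbb C^N,p)\to(\mathbb C^{N+1},p')$ with $H(M)\subset M'$ (as germs) which is $\ell$-finitely nondegenerate at $p$. (Since the automorphism group of the sphere acts transitively on it, $E_\ell$ does not depend on $p\in M$.) With $N'=N+1$: for $p'\in M'$, $\mathcal I_{p'}(M')\subset\mathbb C\{w-p',\overline{w-p'}\}$ denotes the ideal of germs at $p'$ of real-analytic functions vanishing on $M'$, $\Gamma_p(M)$ denotes the set of germs at $p$ of real-analytic CR vector fields (type $(0,1)$) tangent to $M$, and $\varrho'_w=(\partial\varrho'/\partial w_1,\dots,\partial\varrho'/\partial w_{N'})$. A germ of a holomorphic map $H$ at $p$ with $H(M)\subset M'$ is $\ell$-finitely nondegenerate at $p$ if $$\dim_{\mathbb C}\operatorname{span}_{\mathbb C}\left\{\bar L_1\cdots\bar L_k\,\varrho'_w(H(z),\overline{H(z)})\big|_{z=p} : \bar L_j\in\Gamma_p(M),\ 0\le k\le\ell,\ \varrho'\in\mathcal I_{H(p)}(M')\right\}=N'.$$ *)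

theory Defs
  imports "HOL-Analysis.Analysis"
begin

text \<open>
  Convergent power series in the real coordinates of \<open>y - x\<close>.  The multi-indices are the functions
  \<open>\<alpha>\<close> on the orthonormal basis, set to zero outside it.  For complex-valued functions on \<open>\<complex>\<^sup>m\<close>
  these are exactly the convergent power series in \<open>w - p\<close> and its conjugate.
\<close>

definition real_analytic_at :: "('a::euclidean_space \<Rightarrow> 'b::real_normed_vector) \<Rightarrow> 'a \<Rightarrow> bool" where
  "real_analytic_at f x \<longleftrightarrow>
     (\<exists>c :: ('a \<Rightarrow> nat) \<Rightarrow> 'b. \<forall>\<^sub>F y in nhds x.
        ((\<lambda>\<alpha>. (\<Prod>b\<in>Basis. ((y - x) \<bullet> b) ^ \<alpha> b) *\<^sub>R c \<alpha>) has_sum f y)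
          {\<alpha>. \<forall>b. b \<notin> Basis \<longrightarrow> \<alpha> b = 0})"

text \<open>
  Near \<open>q\<close>, the set \<open>S\<close> is given by \<open>k\<close> real-analytic equations with linearly independent
  differentials.  Since analyticity and independence at \<open>q\<close> persist near \<open>q\<close>, it is enough to
  require them at \<open>q\<close>.
\<close>

definition real_analytic_codim_at :: "nat \<Rightarrow> 'a::euclidean_space set \<Rightarrow> 'a \<Rightarrow> bool" where
  "real_analytic_codim_at k S q \<longleftrightarrow>
     (\<exists>f :: nat \<Rightarrow> 'a \<Rightarrow> real.
        (\<forall>i<k. real_analytic_at (f i) q) \<and>
        (\<forall>\<^sub>F w in nhds q. w \<in> S \<longleftrightarrow> (\<forall>i<k. f i w = 0)) \<and>
        (\<forall>c :: nat \<Rightarrow> real.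
           (\<forall>v. (\<Sum>i<k. c i * frechet_derivative (f i) (at q) v) = 0) \<longrightarrow> (\<forall>i<k. c i = 0)))"

definition real_analytic_hypersurface :: "'a::euclidean_space set \<Rightarrow> bool" where
  "real_analytic_hypersurface M \<longleftrightarrow> (\<forall>q\<in>M. real_analytic_codim_at 1 M q)"

text \<open>
  For an embedded real-analytic submanifold \<open>M\<close> of the ambient space, the embedded real-analytic
  submanifolds of \<open>M\<close> are those of the ambient space that lie in \<open>M\<close>.  The codimension may depend
  on the point, so failure to be a submanifold means that some point is singular.
\<close>

definition real_analytic_submanifold_of :: "'a::euclidean_space set \<Rightarrow> 'a set \<Rightarrow> bool" where
  "real_analytic_submanifold_of S M \<longleftrightarrow>
     S \<subseteq> M \<and> (\<forall>q\<in>S. \<exists>k. real_analytic_codim_at k S q)"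

definition holomorphic_map_at :: "(complex^'n \<Rightarrow> complex^'m) \<Rightarrow> complex^'n \<Rightarrow> bool" where
  "holomorphic_map_at H p \<longleftrightarrow>
     (\<forall>\<^sub>F z in nhds p. \<exists>D. (H has_derivative D) (at z) \<and> (\<forall>c v. D (c *s v) = c *s D v))"

definition wirtinger :: "'n \<Rightarrow> (complex^'n \<Rightarrow> complex) \<Rightarrow> complex^'n \<Rightarrow> complex" where
  "wirtinger j f z =
     (frechet_derivative f (at z) (axis j 1) - \<i> * frechet_derivative f (at z) (axis j \<i>)) / 2"

definition wirtinger_bar :: "'n \<Rightarrow> (complex^'n \<Rightarrow> complex) \<Rightarrow> complex^'n \<Rightarrow> complex" where
  "wirtinger_bar j f z =
     (frechet_derivative f (at z) (axis j 1) + \<i> * frechet_derivative f (at z) (axis j \<i>)) / 2"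

text \<open>The ideal \<open>\<I>\<^sub>p(M)\<close>; germs at \<open>p\<close> are represented by globally defined functions.\<close>

definition vanishing_ideal :: "(complex^'n) set \<Rightarrow> complex^'n \<Rightarrow> (complex^'n \<Rightarrow> complex) set" where
  "vanishing_ideal M p = {f. real_analytic_at f p \<and> (\<forall>\<^sub>F z in nhds p. z \<in> M \<longrightarrow> f z = 0)}"

text \<open>The coefficient vector \<open>a\<close> stands for the field \<open>\<Sum>j. a\<^sub>j \<partial>/\<partial>z\<^sub>j\<close> with conjugated \<open>z\<^sub>j\<close>, of type (0,1).\<close>

definition apply_field ::
    "(complex^'n \<Rightarrow> complex^'n) \<Rightarrow> (complex^'n \<Rightarrow> complex) \<Rightarrow> complex^'n \<Rightarrow> complex" where
  "apply_field a f z = (\<Sum>j\<in>UNIV. a z $ j * wirtinger_bar j f z)"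

text \<open>
  The germs \<open>\<Gamma>\<^sub>p(M)\<close>.  The coefficients are extended from \<open>M\<close> to a neighbourhood of \<open>p\<close>; by
  tangency, the restriction to \<open>M\<close> of iterated derivatives does not depend on the extension.
\<close>

definition CR_fields :: "(complex^'n) set \<Rightarrow> complex^'n \<Rightarrow> (complex^'n \<Rightarrow> complex^'n) set" where
  "CR_fields M p =
     {a. real_analytic_at a p \<and>
         (\<forall>f \<in> vanishing_ideal M p. \<forall>\<^sub>F z in nhds p. z \<in> M \<longrightarrow> apply_field a f z = 0)}"

text \<open>
  \<open>foldr apply_field [L\<^sub>1, \<dots>, L\<^sub>k] g\<close> is \<open>L\<^sub>1 (\<cdots> (L\<^sub>k g))\<close>.  The operations \<open>vec.span\<close> and
  \<open>vec.dim\<close> are those of the complex vector space \<open>\<complex>\<^sup>m\<close>, not of the underlying real one.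
\<close>

definition finitely_nondegenerate_at ::
    "nat \<Rightarrow> (complex^'n) set \<Rightarrow> (complex^'m) set \<Rightarrow> (complex^'n \<Rightarrow> complex^'m) \<Rightarrow> complex^'n \<Rightarrow> bool"
  where
  "finitely_nondegenerate_at l M M' H p \<longleftrightarrow>
     vec.dim (vec.span
       {(\<chi> i. foldr apply_field Ls (\<lambda>z. wirtinger i \<rho> (H z)) p) | Ls \<rho>.
          set Ls \<subseteq> CR_fields M p \<and> length Ls \<le> l \<and> \<rho> \<in> vanishing_ideal M' (H p)})
     = CARD('m)"

definition mapping_locus ::
    "nat \<Rightarrow> (complex^'n) set \<Rightarrow> complex^'n \<Rightarrow> (complex^'m) set \<Rightarrow> (complex^'m) set" where
  "mapping_locus l M p M' =
     {p' \<in> M'. \<exists>H. holomorphic_map_at H p \<and> H p = p' \<and>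
        (\<forall>\<^sub>F z in nhds p. z \<in> M \<longrightarrow> H z \<in> M') \<and> finitely_nondegenerate_at l M M' H p}"

end

theory Submission imports Defs "HOL-Complex_Analysis.Conformal_Mappings"
begin

text \<open>Write points of \<open>\<complex>\<^sup>m\<close>, where \<open>m = n + 1\<close>, as \<open>(x, \<xi>)\<close> with \<open>x \<in> \<complex>\<^sup>n\<close>, and choose a linear form \<open>\<lambda> \<noteq> 0\<close> on
  \<open>\<complex>\<^sup>n\<close> with \<open>\<lambda>(p) = 0\<close>.  The hypersurface \<open>M'\<close> is a perturbation of the cylinder over the sphere, with the
  defining function \<open>\<bar>x\<bar>\<^sup>2 - 1 + \<delta> q\<close>, where \<open>\<delta> = Im (\<xi> cnj \<lambda>)\<close> and \<open>q = \<lambda> + cnj \<lambda> + \<bar>\<lambda>\<bar>\<^sup>2 R\<close> for a real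
  polynomial \<open>R\<close>.

  For real \<open>t\<close> the factor \<open>\<delta>\<close> vanishes on the graph \<open>\<xi> = t \<lambda>(x)\<close>.  So the linear map \<open>z \<mapsto> (z, t \<lambda>(z))\<close> sends
  the sphere into \<open>M'\<close>, and the term \<open>cnj \<lambda>\<close> of \<open>q\<close> makes this map 2-nondegenerate near \<open>p\<close>.  Composing with
  unitary maps that move \<open>p\<close>, one sees that the mapping locus contains near \<open>(p, 0)\<close> the graphs over the
  sphere for all real \<open>t\<close> (\<open>nearby_points_in_mapping_locus\<close>).  The tangent spaces of these graphs at
  their common point \<open>(p, 0)\<close> span the whole tangent space of \<open>M'\<close>.  If the locus were a submanifold, it
  would therefore be a neighbourhood of \<open>(p, 0)\<close> in \<open>M'\<close>
  (\<open>submanifold_with_full_tangent_space_is_open\<close>).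

  But for a generic \<open>R\<close> the locus contains no point with \<open>\<delta> \<noteq> 0\<close> (\<open>not_in_mapping_locus\<close>), and there are such
  points of \<open>M'\<close> arbitrarily close to \<open>(p, 0)\<close>.  A constant map is never finitely nondegenerate.  Let \<open>H\<close> be a
  nonconstant map with \<open>\<delta> \<noteq> 0\<close> at \<open>H(p)\<close>.  The equation that expresses \<open>H(M) \<subseteq> M'\<close> polarizes: it holds for
  \<open>H(z)\<close> and the conjugate of \<open>H(z')\<close> as soon as \<open>z\<close> and \<open>z'\<close> satisfy the polarized equation of the sphere, which
  for points with the coordinates \<open>(A, w)\<close> and \<open>(A', w')\<close> of a Heisenberg chart reads
  \<open>w - cnj w' = 2 \<i> A cnj A'\<close>.  The grid points \<open>A = \<sigma> i\<close>, \<open>w = 2 \<i> \<sigma>\<^sup>2 y\<close> with integers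
  \<open>i\<close> and \<open>y\<close> satisfy it whenever \<open>y + y' = i i'\<close>.  These are incidences between points and lines, so \<open>N\<close>
  grid points can have more than \<open>N m\<close> incidences (\<open>many_incidences\<close>).  Each incidence determines a value
  of the polarized \<open>R\<close> at a pair of images \<open>H(z)\<close>, because \<open>\<delta> \<noteq> 0\<close> there.  If \<open>R\<close> is taken from a family of
  polynomials that can interpolate arbitrary values at \<open>N\<close> nodes, then more than \<open>N m\<close> parameters of \<open>R\<close> are
  functions of the remaining ones and of the \<open>N m\<close> coordinates of the images.  That happens only for a null
  set of polynomials \<open>R\<close> (\<open>negligible_interpolating_coefficients\<close>).\<close>

section \<open>Real-analytic functions\<close>

lemma real_analytic_at_const: "real_analytic_at (\<lambda>_. v) x"
  unfolding real_analytic_at_def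
proof (intro exI always_eventually allI)
  fix y :: 'a
  let ?I = "{\<alpha>::'a \<Rightarrow> nat. \<forall>b. b \<notin> Basis \<longrightarrow> \<alpha> b = 0}"
  let ?c = "\<lambda>\<alpha>::'a \<Rightarrow> nat. if \<alpha> = (\<lambda>_. 0) then v else 0"
  have "((\<lambda>\<alpha>. (\<Prod>b\<in>Basis. ((y - x) \<bullet> b) ^ \<alpha> b) *\<^sub>R ?c \<alpha>) has_sum v) {\<lambda>_. 0}"
    by (rule has_sum_finiteI) auto
  then show "((\<lambda>\<alpha>. (\<Prod>b\<in>Basis. ((y - x) \<bullet> b) ^ \<alpha> b) *\<^sub>R ?c \<alpha>) has_sum v) ?I"
    by (subst has_sum_cong_neutral[where T = "{\<lambda>_. 0}"]) auto
qed

lemma real_analytic_at_add: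
  fixes f g :: "'a::euclidean_space \<Rightarrow> 'b::real_normed_vector"
  assumes "real_analytic_at f x" "real_analytic_at g x"
  shows "real_analytic_at (\<lambda>y. f y + g y) x"
proof -
  let ?I = "{\<alpha>::'a \<Rightarrow> nat. \<forall>b. b \<notin> Basis \<longrightarrow> \<alpha> b = 0}"
  obtain c d where
    "\<forall>\<^sub>F y in nhds x. ((\<lambda>\<alpha>. (\<Prod>b\<in>Basis. ((y - x) \<bullet> b) ^ \<alpha> b) *\<^sub>R c \<alpha>) has_sum f y) ?I"
    "\<forall>\<^sub>F y in nhds x. ((\<lambda>\<alpha>. (\<Prod>b\<in>Basis. ((y - x) \<bullet> b) ^ \<alpha> b) *\<^sub>R d \<alpha>) has_sum g y) ?I"
    using assms unfolding real_analytic_at_def by blast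
  then have "\<forall>\<^sub>F y in nhds x.
      ((\<lambda>\<alpha>. (\<Prod>b\<in>Basis. ((y - x) \<bullet> b) ^ \<alpha> b) *\<^sub>R (c \<alpha> + d \<alpha>)) has_sum (f y + g y)) ?I"
    by eventually_elim (simp add: scaleR_add_right has_sum_add)
  then show ?thesis unfolding real_analytic_at_def
    by (intro exI[where x = "\<lambda>\<alpha>. c \<alpha> + d \<alpha>"])
qed

lemma real_analytic_at_sum:
  assumes "\<And>i. i \<in> A \<Longrightarrow> real_analytic_at (f i) x"
  shows "real_analytic_at (\<lambda>y. \<Sum>i\<in>A. f i y) x"
  using assms by (induction A rule: infinite_finite_induct)
    (auto intro: real_analytic_at_const real_analytic_at_add)

lemma real_analytic_at_bounded_linear_comp:
  fixes f :: "'a::euclidean_space \<Rightarrow> 'b::real_normed_vector"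
  assumes "bounded_linear h" "real_analytic_at f x"
  shows "real_analytic_at (\<lambda>y. h (f y)) x"
proof -
  interpret bounded_linear h by fact
  let ?I = "{\<alpha>::'a \<Rightarrow> nat. \<forall>b. b \<notin> Basis \<longrightarrow> \<alpha> b = 0}"
  obtain c where
    "\<forall>\<^sub>F y in nhds x. ((\<lambda>\<alpha>. (\<Prod>b\<in>Basis. ((y - x) \<bullet> b) ^ \<alpha> b) *\<^sub>R c \<alpha>) has_sum f y) ?I"
    using assms unfolding real_analytic_at_def by blast
  then have "\<forall>\<^sub>F y in nhds x.
      ((\<lambda>\<alpha>. (\<Prod>b\<in>Basis. ((y - x) \<bullet> b) ^ \<alpha> b) *\<^sub>R h (c \<alpha>)) has_sum h (f y)) ?I"
    by eventually_elim (drule has_sum_bounded_linear[OF assms(1)], simp add: scaleR)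
  then show ?thesis unfolding real_analytic_at_def
    by (intro exI[where x = "\<lambda>\<alpha>. h (c \<alpha>)"])
qed

text \<open>The power series of \<open>f\<close> is shifted by one in the exponent that belongs to \<open>a\<close>.\<close>

lemma real_analytic_at_coordinate_mult:
  fixes f :: "'a::euclidean_space \<Rightarrow> 'b::real_normed_vector"
  assumes f: "real_analytic_at f x" and a: "a \<in> Basis"
  shows "real_analytic_at (\<lambda>y. ((y - x) \<bullet> a) *\<^sub>R f y) x"
proof -
  let ?I = "{\<alpha>::'a \<Rightarrow> nat. \<forall>b. b \<notin> Basis \<longrightarrow> \<alpha> b = 0}"
  let ?J = "{\<alpha> \<in> ?I. \<alpha> a \<noteq> 0}"
  let ?up = "\<lambda>\<alpha>::'a \<Rightarrow> nat. \<alpha>(a := Suc (\<alpha> a))"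
  obtain c where c:
    "\<forall>\<^sub>F y in nhds x. ((\<lambda>\<alpha>. (\<Prod>b\<in>Basis. ((y - x) \<bullet> b) ^ \<alpha> b) *\<^sub>R c \<alpha>) has_sum f y) ?I"
    using f unfolding real_analytic_at_def by blast
  let ?d = "\<lambda>\<alpha>. if \<alpha> a = 0 then 0 else c (\<alpha>(a := \<alpha> a - 1))"
  have inj: "inj_on ?up ?I"
    by (rule inj_onI) (metis diff_Suc_1 fun_upd_idem_iff fun_upd_same fun_upd_upd)
  have img: "?up ` ?I = ?J"
  proof
    show "?up ` ?I \<subseteq> ?J" using a by auto
    show "?J \<subseteq> ?up ` ?I"
    proof
      fix \<beta> assume "\<beta> \<in> ?J"
      then have "\<beta> = ?up (\<beta>(a := \<beta> a - 1))" "\<beta>(a := \<beta> a - 1) \<in> ?I"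
        using a by (auto simp: fun_eq_iff)
      then show "\<beta> \<in> ?up ` ?I" by blast
    qed
  qed
  have "\<forall>\<^sub>F y in nhds x.
      ((\<lambda>\<alpha>. (\<Prod>b\<in>Basis. ((y - x) \<bullet> b) ^ \<alpha> b) *\<^sub>R ?d \<alpha>) has_sum ((y - x) \<bullet> a) *\<^sub>R f y) ?I"
    using c
  proof eventually_elim
    case (elim y)
    let ?g = "\<lambda>\<alpha>. (\<Prod>b\<in>Basis. ((y - x) \<bullet> b) ^ \<alpha> b) *\<^sub>R ?d \<alpha>"
    have prod: "(\<Prod>b\<in>Basis. ((y - x) \<bullet> b) ^ ?up \<alpha> b)
        = ((y - x) \<bullet> a) * (\<Prod>b\<in>Basis. ((y - x) \<bullet> b) ^ \<alpha> b)" for \<alpha>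
      by (subst (1 2) prod.remove[OF finite_Basis a]) (auto simp: mult.assoc intro!: prod.cong)
    have "((\<lambda>\<alpha>. ((y - x) \<bullet> a) *\<^sub>R ((\<Prod>b\<in>Basis. ((y - x) \<bullet> b) ^ \<alpha> b) *\<^sub>R c \<alpha>))
        has_sum ((y - x) \<bullet> a) *\<^sub>R f y) ?I"
      using elim by (rule has_sum_bounded_linear[OF bounded_linear_scaleR_right])
    then have "((?g \<circ> ?up) has_sum ((y - x) \<bullet> a) *\<^sub>R f y) ?I"
      by (rule iffD1[OF has_sum_cong, rotated]) (simp add: prod del: fun_upd_apply, simp)
    then have "(?g has_sum ((y - x) \<bullet> a) *\<^sub>R f y) ?J"
      by (subst img[symmetric], subst has_sum_reindex[OF inj])
    then show ?case
      by (subst has_sum_cong_neutral[where T = ?J]) auto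
  qed
  then show ?thesis unfolding real_analytic_at_def by (intro exI[where x = ?d])
qed

text \<open>Summability at one corner point dominates the differentiated series on the cube of half the
  size, because \<open>n \<le> 2\<^sup>n\<close>; so the series may be differentiated term by term.\<close>

lemma real_analytic_at_imp_eventually_differentiable_real:
  fixes f :: "'a::euclidean_space \<Rightarrow> real"
  assumes "real_analytic_at f x"
  shows "\<forall>\<^sub>F y in nhds x. f differentiable (at y)"
proof -
  let ?I = "{\<alpha>::'a \<Rightarrow> nat. \<forall>b. b \<notin> Basis \<longrightarrow> \<alpha> b = 0}"
  obtain c where
    "\<forall>\<^sub>F y in nhds x. ((\<lambda>\<alpha>. (\<Prod>b\<in>Basis. ((y - x) \<bullet> b) ^ \<alpha> b) *\<^sub>R c \<alpha>) has_sum f y) ?I"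
    using assms unfolding real_analytic_at_def by blast
  then obtain e where e: "e > 0" and
    sum_f: "\<And>y. dist y x < e \<Longrightarrow>
      ((\<lambda>\<alpha>. (\<Prod>b\<in>Basis. ((y - x) \<bullet> b) ^ \<alpha> b) * c \<alpha>) has_sum f y) ?I"
    unfolding eventually_nhds_metric by auto
  define r where "r = e / (2 * (1 + real DIM('a)))"
  have pos: "0 < e * real DIM('a) + e * 2" using e by (intro add_nonneg_pos) auto
  have r: "r > 0" "r * real DIM('a) < e"
    using e pos by (auto simp: r_def field_simps)
  define z where "z = x + r *\<^sub>R (\<Sum>b\<in>Basis. b :: 'a)"
  have zb: "(z - x) \<bullet> b = r" if "b \<in> Basis" for b
    using that by (simp add: z_def inner_sum_left inner_Basis if_distrib sum.delta cong: if_cong)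
  have "norm (\<Sum>b\<in>Basis. b :: 'a) \<le> (\<Sum>b\<in>(Basis::'a set). norm b)" by (rule norm_sum)
  then have "dist z x < e"
    using r by (simp add: z_def dist_norm) (smt (verit) mult_left_mono)
  from sum_f[OF this] have "(\<lambda>\<alpha>. (\<Prod>b\<in>Basis. r ^ \<alpha> b) * c \<alpha>) summable_on ?I"
    by (simp add: summable_on_def zb cong: prod.cong) blast
  then have M: "(\<lambda>\<alpha>. \<bar>(\<Prod>b\<in>Basis. r ^ \<alpha> b) * c \<alpha>\<bar>) summable_on ?I"
    by (subst (asm) summable_on_iff_abs_summable_on_real) simp
  have prodpos: "(\<Prod>b\<in>(Basis::'a set). r ^ \<alpha> b) > 0" for \<alpha> using r by (auto intro: prod_pos)
  have I: "countable ?I"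
  proof -
    have "?I \<subseteq> (\<lambda>F b. if b \<in> Basis then F b else 0) ` (Basis \<rightarrow>\<^sub>E UNIV)"
    proof
      fix \<alpha> assume "\<alpha> \<in> ?I"
      then have "\<alpha> = (\<lambda>b. if b \<in> Basis then restrict \<alpha> Basis b else 0)"
        "restrict \<alpha> Basis \<in> Basis \<rightarrow>\<^sub>E UNIV" by auto
      then show "\<alpha> \<in> (\<lambda>F b. if b \<in> Basis then F b else 0) ` (Basis \<rightarrow>\<^sub>E UNIV)" by blast
    qed
    moreover have "countable (Basis \<rightarrow>\<^sub>E (UNIV :: nat set) :: ('a \<Rightarrow> nat) set)"
      by (rule countable_PiE) auto
    ultimately show ?thesis by (meson countable_image countable_subset)
  qed
  obtain a :: 'a where a: "a \<in> Basis" using nonempty_Basis by blast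
  have "infinite ?I"
  proof -
    have "inj (\<lambda>n b. if b = a then n else (0::nat))" by (rule injI) (metis (full_types))
    moreover have "range (\<lambda>n b. if b = a then n else (0::nat)) \<subseteq> ?I" using a by auto
    ultimately show ?thesis by (meson finite_imageD finite_subset infinite_UNIV_nat)
  qed
  then obtain enum :: "nat \<Rightarrow> 'a \<Rightarrow> nat" where enum: "bij_betw enum UNIV ?I"
    using bij_betw_from_nat_into[OF I] by blast
  define T where "T n y = (\<Prod>b\<in>Basis. ((y - x) \<bullet> b) ^ enum n b) * c (enum n)" for n y
  define T' where "T' n y h = (\<Sum>b\<in>Basis. (real (enum n b) * (h \<bullet> b) * ((y - x) \<bullet> b) ^ (enum n b - 1)) *
      (\<Prod>j\<in>Basis - {b}. ((y - x) \<bullet> j) ^ enum n j)) * c (enum n)" for n y h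
  define S where "S = {y. \<forall>b\<in>Basis. \<bar>(y - x) \<bullet> b\<bar> < r / 2}"
  define B where "B n = real DIM('a) * (2 / r) * \<bar>(\<Prod>b\<in>Basis. r ^ enum n b) * c (enum n)\<bar>" for n
  have B0: "B n \<ge> 0" for n unfolding B_def using r by simp
  have Bsum: "summable B"
  proof -
    have "(\<lambda>n. \<bar>(\<Prod>b\<in>Basis. r ^ enum n b) * c (enum n)\<bar>) summable_on UNIV"
      using M summable_on_reindex_bij_betw[OF enum, of "\<lambda>\<alpha>. \<bar>(\<Prod>b\<in>Basis. r ^ \<alpha> b) * c \<alpha>\<bar>"] by simp
    then show ?thesis unfolding B_def
      by (intro summable_mult summable_on_imp_summable)
  qed
  have bound: "\<bar>T' n y h\<bar> \<le> B n * norm h" if y: "y \<in> S" for n y h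
  proof -
    have tm: "\<bar>(real (enum n b) * (h \<bullet> b) * ((y - x) \<bullet> b) ^ (enum n b - 1)) *
        (\<Prod>j\<in>Basis - {b}. ((y - x) \<bullet> j) ^ enum n j)\<bar> \<le> (2 / r) * (\<Prod>b\<in>Basis. r ^ enum n b) * norm h"
      if b: "b \<in> Basis" for b
    proof -
      have 1: "real (enum n b) * \<bar>(y - x) \<bullet> b\<bar> ^ (enum n b - 1) \<le> (2 / r) * r ^ enum n b"
      proof (cases "enum n b")
        case (Suc k)
        have "\<bar>(y - x) \<bullet> b\<bar> ^ k \<le> (r / 2) ^ k"
          using y b by (intro power_mono) (auto simp: S_def intro: less_imp_le)
        moreover have "real (Suc k) \<le> 2 ^ Suc k"
          using less_exp[of "Suc k"] by (metis less_imp_le of_nat_le_iff of_nat_numeral of_nat_power)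
        ultimately have "real (Suc k) * \<bar>(y - x) \<bullet> b\<bar> ^ k \<le> 2 ^ Suc k * (r / 2) ^ k"
          by (intro mult_mono) auto
        also have "\<dots> = (2 / r) * r ^ Suc k" using r by (simp add: power_divide)
        finally show ?thesis using Suc by simp
      qed (use r in auto)
      have 2: "\<bar>\<Prod>j\<in>Basis - {b}. ((y - x) \<bullet> j) ^ enum n j\<bar> \<le> (\<Prod>j\<in>Basis - {b}. r ^ enum n j)"
        unfolding abs_prod power_abs
        using y r by (intro prod_mono conjI power_mono) (force simp: S_def)+
      have 3: "\<bar>h \<bullet> b\<bar> \<le> norm h" using b by (rule Basis_le_norm)
      have "\<bar>(real (enum n b) * (h \<bullet> b) * ((y - x) \<bullet> b) ^ (enum n b - 1)) *
        (\<Prod>j\<in>Basis - {b}. ((y - x) \<bullet> j) ^ enum n j)\<bar>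
        = (real (enum n b) * \<bar>(y - x) \<bullet> b\<bar> ^ (enum n b - 1)) * \<bar>h \<bullet> b\<bar> *
          \<bar>\<Prod>j\<in>Basis - {b}. ((y - x) \<bullet> j) ^ enum n j\<bar>"
        by (simp add: abs_mult power_abs)
      also have "\<dots> \<le> ((2 / r) * r ^ enum n b) * norm h * (\<Prod>j\<in>Basis - {b}. r ^ enum n j)"
        by (rule mult_mono[OF mult_mono[OF 1 3] 2]) (use r in auto)
      also have "\<dots> = (2 / r) * (\<Prod>b\<in>Basis. r ^ enum n b) * norm h"
        by (simp add: prod.remove[OF finite_Basis b])
      finally show ?thesis .
    qed
    have "\<bar>T' n y h\<bar> \<le> (\<Sum>b\<in>(Basis::'a set). (2 / r) * (\<Prod>b\<in>Basis. r ^ enum n b) * norm h) * \<bar>c (enum n)\<bar>"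
      unfolding T'_def abs_mult
      by (intro mult_right_mono order_trans[OF sum_abs] sum_mono tm) auto
    also have "\<dots> = B n * norm h"
      unfolding B_def abs_mult using prodpos[of "enum n"] by simp
    finally show ?thesis .
  qed
  have open_S: "open S"
  proof -
    have "S = (\<Inter>b\<in>Basis. {y. \<bar>(y - x) \<bullet> b\<bar> < r / 2})" unfolding S_def by auto
    then show ?thesis
      by (auto intro!: open_INT open_Collect_less continuous_intros)
  qed
  have xS: "x \<in> S" using r by (auto simp: S_def)
  have convex_S: "convex S"
  proof -
    have "\<bar>(y - x) \<bullet> b\<bar> < r / 2 \<longleftrightarrow> b \<bullet> y < b \<bullet> x + r / 2 \<and> b \<bullet> y > b \<bullet> x - r / 2" for y b
      using inner_diff_left[of y x b] inner_commute[of b y] inner_commute[of b x] by linarith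
    then have "S = (\<Inter>b\<in>Basis. {y. b \<bullet> y < b \<bullet> x + r / 2} \<inter> {y. b \<bullet> y > b \<bullet> x - r / 2})"
      unfolding S_def by auto
    then show ?thesis
      by (auto intro!: convex_INT convex_Int convex_halfspace_lt convex_halfspace_gt)
  qed
  have S_dist: "dist y x < e" if "y \<in> S" for y
  proof -
    have "norm (y - x) \<le> (\<Sum>b\<in>Basis. \<bar>(y - x) \<bullet> b\<bar>)" by (rule norm_le_l1)
    also have "\<dots> \<le> (\<Sum>b\<in>(Basis::'a set). r)"
      using that r by (intro sum_mono) (force simp: S_def)
    finally show ?thesis using r by (simp add: dist_norm mult.commute)
  qed
  have T_sums: "(\<lambda>n. T n y) sums f y" if "y \<in> S" for y
  proof -
    have "((\<lambda>n. T n y) has_sum f y) UNIV"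
      unfolding T_def using sum_f[OF S_dist[OF that]]
        has_sum_reindex_bij_betw[OF enum, of "\<lambda>\<alpha>. (\<Prod>b\<in>Basis. ((y - x) \<bullet> b) ^ \<alpha> b) * c \<alpha>"] by simp
    then show ?thesis by (rule has_sum_imp_sums)
  qed
  have T'_summable: "summable (\<lambda>n. T' n y h)" if "y \<in> S" for y h
    by (rule summable_comparison_test'[where g = "\<lambda>n. B n * norm h" and N = 0])
       (use bound[OF that] Bsum in \<open>auto intro: summable_mult2\<close>)
  have "\<exists>g. \<forall>y\<in>S. (\<lambda>n. T n y) sums g y \<and> (g has_derivative (\<lambda>h. \<Sum>n. T' n y h)) (at y within S)"
  proof (rule has_derivative_series[where f = T and f' = T', OF convex_S _ _ xS T_sums[OF xS]])
    show "(T n has_derivative T' n y) (at y within S)" for n y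
      unfolding T_def T'_def
      by (rule derivative_eq_intros refl | simp add: ac_simps)+
    fix \<epsilon> :: real assume \<epsilon>: "\<epsilon> > 0"
    have "(\<lambda>n. suminf B - sum B {..<n}) \<longlonglongrightarrow> suminf B - suminf B"
      by (intro tendsto_intros summable_LIMSEQ Bsum)
    then have "\<forall>\<^sub>F n in sequentially. suminf B - sum B {..<n} < \<epsilon>"
      using \<epsilon> by (intro order_tendstoD(2)) auto
    then show "\<forall>\<^sub>F n in sequentially. \<forall>y\<in>S. \<forall>h.
        norm ((\<Sum>i<n. T' i y h) - (\<Sum>n. T' n y h)) \<le> \<epsilon> * norm h"
    proof eventually_elim
      case (elim n)
      show ?case
      proof (intro ballI allI)
        fix y h assume y: "y \<in> S"
        have "(\<Sum>n. T' n y h) - (\<Sum>i<n. T' i y h) = (\<Sum>i. T' (i + n) y h)"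
          using suminf_minus_initial_segment[OF T'_summable[OF y], of n h] by simp
        moreover have "\<bar>\<Sum>i. T' (i + n) y h\<bar> \<le> (\<Sum>i. B (i + n) * norm h)"
          using bound[OF y] Bsum T'_summable[OF y]
          by (intro norm_suminf_le[where 'a = real, simplified] summable_mult2)
             (auto simp: summable_iff_shift)
        moreover have "(\<Sum>i. B (i + n) * norm h) = (suminf B - sum B {..<n}) * norm h"
          using suminf_minus_initial_segment[OF Bsum, of n] Bsum
          by (simp add: suminf_mult2[symmetric] summable_iff_shift)
        moreover have "(suminf B - sum B {..<n}) * norm h \<le> \<epsilon> * norm h"
          using elim by (intro mult_right_mono) auto
        ultimately show "norm ((\<Sum>i<n. T' i y h) - (\<Sum>n. T' n y h)) \<le> \<epsilon> * norm h"
          by (simp add: abs_minus_commute)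
      qed
    qed
  qed
  then obtain g where g: "\<And>y. y \<in> S \<Longrightarrow> (\<lambda>n. T n y) sums g y"
    "\<And>y. y \<in> S \<Longrightarrow> (g has_derivative (\<lambda>h. \<Sum>n. T' n y h)) (at y within S)" by blast
  have fg: "f y = g y" if "y \<in> S" for y
    using T_sums[OF that] g(1)[OF that] by (rule sums_unique2)
  have "f differentiable (at y)" if "y \<in> S" for y
  proof -
    have "(g has_derivative (\<lambda>h. \<Sum>n. T' n y h)) (at y)"
      using g(2)[OF that] at_within_open[OF that open_S] by simp
    then have "(f has_derivative (\<lambda>h. \<Sum>n. T' n y h)) (at y)"
      by (rule has_derivative_transform_within_open[OF _ open_S that]) (simp add: fg)
    then show ?thesis unfolding differentiable_def by blast
  qed
  then show ?thesis
    using eventually_nhds open_S xS by blast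
qed

lemma real_analytic_at_imp_eventually_differentiable:
  fixes f :: "'a::euclidean_space \<Rightarrow> complex"
  assumes "real_analytic_at f x"
  shows "\<forall>\<^sub>F y in nhds x. f differentiable (at y)"
proof -
  have "real_analytic_at (\<lambda>y. Re (f y)) x" "real_analytic_at (\<lambda>y. Im (f y)) x"
    using assms by (auto intro: real_analytic_at_bounded_linear_comp bounded_linear_Re bounded_linear_Im)
  from this[THEN real_analytic_at_imp_eventually_differentiable_real] show ?thesis
  proof eventually_elim
    case (elim y)
    then have "(\<lambda>y. complex_of_real (Re (f y)) + \<i> * complex_of_real (Im (f y))) differentiable (at y)"
      by (intro differentiable_add differentiable_mult differentiable_const)
         (auto intro: differentiable_compose[OF linear_imp_differentiable]
           simp: bounded_linear_of_real bounded_linear.linear)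
    then show ?case by (simp add: complex_eq[symmetric])
  qed
qed

lemma real_analytic_at_bounded_linear:
  fixes L :: "'a::euclidean_space \<Rightarrow> 'b::real_normed_vector"
  assumes "bounded_linear L"
  shows "real_analytic_at L x"
proof -
  interpret bounded_linear L by fact
  have "L x + (\<Sum>b\<in>Basis. ((y - x) \<bullet> b) *\<^sub>R L b) = L y" for y
  proof -
    have "L (y - x) = (\<Sum>b\<in>Basis. ((y - x) \<bullet> b) *\<^sub>R L b)"
      by (subst euclidean_representation[of "y - x", symmetric]) (simp only: sum scaleR)
    then show ?thesis by (simp only: diff) (simp add: algebra_simps)
  qed
  then have "(\<lambda>y. L x + (\<Sum>b\<in>Basis. ((y - x) \<bullet> b) *\<^sub>R L b)) = L" by (rule ext)
  moreover have "real_analytic_at (\<lambda>y. L x + (\<Sum>b\<in>Basis. ((y - x) \<bullet> b) *\<^sub>R L b)) x"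
    by (intro real_analytic_at_add real_analytic_at_sum real_analytic_at_coordinate_mult
        real_analytic_at_const)
  ultimately show ?thesis by (rule subst[where P = "\<lambda>f. real_analytic_at f x"])
qed

section \<open>Polynomials in the coordinates and their conjugates\<close>

text \<open>All functions that enter the target hypersurface are of this form.  Real analyticity and
  differentiability follow by induction, and the class is closed under CR fields with such coefficients.\<close>

inductive cpoly :: "(complex^'n \<Rightarrow> complex) \<Rightarrow> bool" where
  cpoly_const: "cpoly (\<lambda>_. c)"
| cpoly_nth: "cpoly (\<lambda>x. x $ j)"
| cpoly_cnj_nth: "cpoly (\<lambda>x. cnj (x $ j))"
| cpoly_add: "cpoly f \<Longrightarrow> cpoly g \<Longrightarrow> cpoly (\<lambda>x. f x + g x)"
| cpoly_mult: "cpoly f \<Longrightarrow> cpoly g \<Longrightarrow> cpoly (\<lambda>x. f x * g x)"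

lemma cpoly_sum: "(\<And>i. i \<in> A \<Longrightarrow> cpoly (f i)) \<Longrightarrow> cpoly (\<lambda>x. \<Sum>i\<in>A. f i x)"
proof (induction A rule: infinite_finite_induct)
  case (insert a A)
  then have "cpoly (\<lambda>x. f a x + (\<Sum>i\<in>A. f i x))" by (intro cpoly_add) simp_all
  then show ?case using insert by simp
qed (simp_all add: cpoly_const)

lemma cpoly_uminus: assumes "cpoly f" shows "cpoly (\<lambda>x. - f x)"
  using cpoly_mult[OF cpoly_const[of "-1"] assms] by simp

lemma cpoly_diff: assumes "cpoly f" "cpoly g" shows "cpoly (\<lambda>x. f x - g x)"
  using cpoly_add[OF assms(1) cpoly_uminus[OF assms(2)]] by simp

lemma cpoly_divide_const: assumes "cpoly f" shows "cpoly (\<lambda>x. f x / c)"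
  using cpoly_mult[OF assms cpoly_const[of "inverse c"]] by (simp only: divide_inverse)

lemma cpoly_power: assumes "cpoly f" shows "cpoly (\<lambda>x. f x ^ k)"
  by (induction k) (simp_all add: cpoly_const cpoly_mult assms)

lemma cpoly_cnj: "cpoly f \<Longrightarrow> cpoly (\<lambda>x. cnj (f x))"
  by (induction rule: cpoly.induct)
     (simp_all add: cpoly_const cpoly_nth cpoly_cnj_nth cpoly_add cpoly_mult)

lemmas cpoly_intros = cpoly.intros cpoly_sum cpoly_uminus cpoly_diff cpoly_divide_const cpoly_power
  cpoly_cnj

lemma cpoly_compose:
  assumes "cpoly f" "\<And>i. cpoly (\<lambda>x. H x $ i)"
  shows "cpoly (\<lambda>x. f (H x))"
  using assms(1)
  by induction (simp_all add: cpoly_const cpoly_add cpoly_mult cpoly_cnj assms(2))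

lemma cpoly_differentiable: "cpoly f \<Longrightarrow> f differentiable (at x)"
proof (induction rule: cpoly.induct)
  case (cpoly_nth j)
  show ?case by (intro linear_imp_differentiable bounded_linear.linear bounded_linear_vec_nth)
next
  case (cpoly_cnj_nth j)
  show ?case
    by (intro linear_imp_differentiable bounded_linear.linear
        bounded_linear_compose[OF bounded_linear_cnj bounded_linear_vec_nth])
qed (simp_all add: differentiable_add differentiable_mult)

lemma cpoly_continuous: "cpoly f \<Longrightarrow> continuous (at x within S) f"
  by (rule differentiable_imp_continuous_within[OF differentiable_at_withinI[OF cpoly_differentiable]])

lemma cpoly_tendsto: "cpoly f \<Longrightarrow> (f \<longlongrightarrow> f x) (nhds x)"
  using cpoly_continuous[of f x UNIV] by (simp only: continuous_at tendsto_at_iff_tendsto_nhds)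

lemma frechet_derivative_plus:
  assumes "f differentiable (at z)" "g differentiable (at z)"
  shows "frechet_derivative (\<lambda>x. f x + g x) (at z)
    = (\<lambda>v. frechet_derivative f (at z) v + frechet_derivative g (at z) v)"
  using assms unfolding frechet_derivative_works
  by (intro frechet_derivative_at[symmetric] has_derivative_add)

lemma frechet_derivative_minus:
  assumes "f differentiable (at z)" "g differentiable (at z)"
  shows "frechet_derivative (\<lambda>x. f x - g x) (at z)
    = (\<lambda>v. frechet_derivative f (at z) v - frechet_derivative g (at z) v)"
  using assms unfolding frechet_derivative_works
  by (intro frechet_derivative_at[symmetric] has_derivative_diff)

lemma frechet_derivative_mult:
  fixes f g :: "'a::real_normed_vector \<Rightarrow> 'b::real_normed_algebra"
  assumes "f differentiable (at z)" "g differentiable (at z)"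
  shows "frechet_derivative (\<lambda>x. f x * g x) (at z)
    = (\<lambda>v. f z * frechet_derivative g (at z) v + frechet_derivative f (at z) v * g z)"
  using assms unfolding frechet_derivative_works
  by (intro frechet_derivative_at[symmetric] has_derivative_mult)

lemma cpoly_derivative:
  assumes "cpoly f"
  shows "cpoly (\<lambda>x. frechet_derivative f (at x) v)"
  using assms
proof (induction rule: cpoly.induct)
  case (cpoly_const c)
  then show ?case by (simp add: cpoly.cpoly_const)
next
  case (cpoly_nth j)
  have "frechet_derivative (\<lambda>x. x $ j) (at x) = (\<lambda>x. x $ j)" for x :: "complex^'a"
    by (intro frechet_derivative_at[symmetric] bounded_linear_imp_has_derivative
        bounded_linear_vec_nth)
  then show ?case by (simp add: cpoly.cpoly_const)
next
  case (cpoly_cnj_nth j)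
  have "frechet_derivative (\<lambda>x. cnj (x $ j)) (at x) = (\<lambda>x. cnj (x $ j))" for x :: "complex^'a"
    by (intro frechet_derivative_at[symmetric] bounded_linear_imp_has_derivative
        bounded_linear_compose[OF bounded_linear_cnj bounded_linear_vec_nth])
  then show ?case by (simp add: cpoly.cpoly_const)
next
  case (cpoly_add f g)
  then show ?case
    by (simp add: frechet_derivative_plus cpoly_differentiable cpoly.cpoly_add)
next
  case (cpoly_mult f g)
  have "frechet_derivative (\<lambda>x. f x * g x) (at x) v
      = f x * frechet_derivative g (at x) v + frechet_derivative f (at x) v * g x" for x
    using cpoly_mult by (simp add: frechet_derivative_mult cpoly_differentiable)
  then show ?case using cpoly_mult by (simp add: cpoly.cpoly_add cpoly.cpoly_mult)
qed

lemma cpoly_real_analytic_at: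
  assumes "cpoly f" shows "real_analytic_at f x"
proof -
  have lin: "real_analytic_at (\<lambda>y. L y * g y) x"
    if "bounded_linear L" "real_analytic_at g x" for L g :: "complex^'a \<Rightarrow> complex"
  proof -
    interpret bounded_linear L by fact
    have "L x * g y + (\<Sum>b\<in>Basis. ((y - x) \<bullet> b) *\<^sub>R (L b * g y)) = L y * g y" for y
    proof -
      have "L (y - x) = (\<Sum>b\<in>Basis. ((y - x) \<bullet> b) *\<^sub>R L b)"
        by (subst euclidean_representation[of "y - x", symmetric]) (simp only: sum scaleR)
      then have "L y = L x + (\<Sum>b\<in>Basis. ((y - x) \<bullet> b) *\<^sub>R L b)"
        by (simp only: diff) (simp add: algebra_simps)
      then show ?thesis by (simp only: distrib_right sum_distrib_right) simp
    qed
    then have "(\<lambda>y. L x * g y + (\<Sum>b\<in>Basis. ((y - x) \<bullet> b) *\<^sub>R (L b * g y))) = (\<lambda>y. L y * g y)"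
      by (rule ext)
    moreover have "real_analytic_at
        (\<lambda>y. L x * g y + (\<Sum>b\<in>Basis. ((y - x) \<bullet> b) *\<^sub>R (L b * g y))) x"
      by (intro real_analytic_at_add real_analytic_at_sum real_analytic_at_coordinate_mult
          real_analytic_at_bounded_linear_comp[OF bounded_linear_mult_right] that)
    ultimately show ?thesis by (rule subst[where P = "\<lambda>f. real_analytic_at f x"])
  qed
  have "real_analytic_at g x \<Longrightarrow> real_analytic_at (\<lambda>y. f y * g y) x" for g
    using assms
  proof (induction arbitrary: g rule: cpoly.induct)
    case (cpoly_const c)
    then show ?case by (intro real_analytic_at_bounded_linear_comp[OF bounded_linear_mult_right])
  next
    case (cpoly_nth j)
    then show ?case by (intro lin bounded_linear_vec_nth)
  next
    case (cpoly_cnj_nth j)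
    then show ?case
      by (intro lin bounded_linear_compose[OF bounded_linear_cnj bounded_linear_vec_nth])
  next
    case (cpoly_add f1 f2)
    then show ?case by (simp add: distrib_right real_analytic_at_add)
  next
    case (cpoly_mult f1 f2)
    then show ?case by (simp add: mult.assoc)
  qed
  from this[of "\<lambda>_. 1"] show ?thesis by (simp add: real_analytic_at_const)
qed

section \<open>Wirtinger derivatives\<close>

lemma wirtinger_eq:
  assumes "(f has_derivative f') (at z)"
  shows "wirtinger j f z = (f' (axis j 1) - \<i> * f' (axis j \<i>)) / 2"
  using frechet_derivative_at[OF assms] by (simp add: wirtinger_def)

lemma wirtinger_bar_eq:
  assumes "(f has_derivative f') (at z)"
  shows "wirtinger_bar j f z = (f' (axis j 1) + \<i> * f' (axis j \<i>)) / 2"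
  using frechet_derivative_at[OF assms] by (simp add: wirtinger_bar_def)

lemma wirtinger_const [simp]: "wirtinger j (\<lambda>_. c) z = 0"
  by (simp add: wirtinger_def)

lemma wirtinger_nth [simp]: "wirtinger j (\<lambda>x. x $ k) z = (if j = k then 1 else 0)"
  by (subst wirtinger_eq[OF bounded_linear_imp_has_derivative[OF bounded_linear_vec_nth]])
     (simp add: axis_def)

lemma wirtinger_cnj_nth [simp]: "wirtinger j (\<lambda>x. cnj (x $ k)) z = 0"
  by (subst wirtinger_eq[OF bounded_linear_imp_has_derivative[OF
          bounded_linear_compose[OF bounded_linear_cnj bounded_linear_vec_nth]]])
     (simp add: axis_def)

lemma wirtinger_add:
  assumes "f differentiable (at z)" "g differentiable (at z)"
  shows "wirtinger j (\<lambda>x. f x + g x) z = wirtinger j f z + wirtinger j g z"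
  using assms by (simp add: wirtinger_def frechet_derivative_plus field_simps)

lemma wirtinger_diff:
  assumes "f differentiable (at z)" "g differentiable (at z)"
  shows "wirtinger j (\<lambda>x. f x - g x) z = wirtinger j f z - wirtinger j g z"
  using assms by (simp add: wirtinger_def frechet_derivative_minus field_simps)

lemma wirtinger_mult:
  assumes "f differentiable (at z)" "g differentiable (at z)"
  shows "wirtinger j (\<lambda>x. f x * g x) z = wirtinger j f z * g z + f z * wirtinger j g z"
  using assms by (simp add: wirtinger_def frechet_derivative_mult field_simps)

lemma wirtinger_sum:
  assumes "\<And>i. i \<in> A \<Longrightarrow> f i differentiable (at z)"
  shows "wirtinger j (\<lambda>x. \<Sum>i\<in>A. f i x) z = (\<Sum>i\<in>A. wirtinger j (f i) z)"
  using assms by (induction A rule: infinite_finite_induct)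
    (auto simp: wirtinger_add differentiable_sum)

text \<open>The field of type (0,1) with coefficients \<open>a\<close> is half the sum of the real derivative along \<open>v\<close> and of
  \<open>\<i>\<close> times the real derivative along \<open>\<i> v\<close>, where \<open>v\<close> is the conjugate of \<open>a\<close>.\<close>

lemma apply_field_eq:
  assumes f: "(f has_derivative f') (at z)"
  shows "apply_field a f z =
    (f' (\<chi> j. cnj (a z $ j)) + \<i> * f' (\<chi> j. \<i> * cnj (a z $ j))) / 2"
proof -
  interpret bounded_linear f' using f by (rule has_derivative_bounded_linear)
  let ?\<alpha> = "\<lambda>j. f' (axis j 1)" and ?\<beta> = "\<lambda>j. f' (axis j \<i>)"
  have rep: "(\<Sum>j\<in>UNIV. Re (v $ j) *\<^sub>R axis j 1 + Im (v $ j) *\<^sub>R axis j \<i>) = v" for v :: "complex^'a"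
  proof (rule vec_eq_iff[THEN iffD2, rule_format])
    fix i
    have "(\<Sum>j\<in>UNIV. Re (v $ j) *\<^sub>R axis j 1 + Im (v $ j) *\<^sub>R axis j \<i>) $ i
        = (\<Sum>j\<in>UNIV. if j = i then v $ i else 0)"
      unfolding sum_component by (intro sum.cong) (auto simp: axis_def complex_eq_iff)
    then show "(\<Sum>j\<in>UNIV. Re (v $ j) *\<^sub>R axis j 1 + Im (v $ j) *\<^sub>R axis j \<i>) $ i = v $ i" by simp
  qed
  have f': "f' v = (\<Sum>j\<in>UNIV. Re (v $ j) *\<^sub>R ?\<alpha> j + Im (v $ j) *\<^sub>R ?\<beta> j)" for v
    using arg_cong[OF rep[of v], of f'] by (simp only: sum add scaleR)
  have "f' (\<chi> j. cnj (a z $ j)) + \<i> * f' (\<chi> j. \<i> * cnj (a z $ j))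
      = (\<Sum>j\<in>UNIV. a z $ j * (?\<alpha> j + \<i> * ?\<beta> j))"
    unfolding f'[of "\<chi> j. cnj (a z $ j)"] f'[of "\<chi> j. \<i> * cnj (a z $ j)"]
      sum_distrib_left sum.distrib[symmetric]
    by (intro sum.cong refl) (simp add: complex_eq_iff algebra_simps)
  then show ?thesis
    unfolding apply_field_def wirtinger_bar_eq[OF f]
    by (simp add: sum_divide_distrib)
qed

lemma apply_field_const [simp]: "apply_field a (\<lambda>_. c) z = 0"
  by (simp add: apply_field_def wirtinger_bar_def)

lemma apply_field_nth [simp]: "apply_field a (\<lambda>x. x $ k) z = 0"
  by (subst apply_field_eq[OF bounded_linear_imp_has_derivative[OF bounded_linear_vec_nth]]) simp

lemma apply_field_cnj_nth [simp]: "apply_field a (\<lambda>x. cnj (x $ k)) z = a z $ k"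
  by (subst apply_field_eq[OF bounded_linear_imp_has_derivative[OF
          bounded_linear_compose[OF bounded_linear_cnj bounded_linear_vec_nth]]]) simp

lemma apply_field_add:
  assumes "f differentiable (at z)" "g differentiable (at z)"
  shows "apply_field a (\<lambda>x. f x + g x) z = apply_field a f z + apply_field a g z"
  using assms by (simp add: apply_field_def wirtinger_bar_def frechet_derivative_plus
      sum.distrib[symmetric] algebra_simps add_divide_distrib)

lemma apply_field_mult:
  assumes "f differentiable (at z)" "g differentiable (at z)"
  shows "apply_field a (\<lambda>x. f x * g x) z = apply_field a f z * g z + f z * apply_field a g z"
  using assms by (simp add: apply_field_def wirtinger_bar_def frechet_derivative_mult
      sum.distrib[symmetric] sum_distrib_left sum_distrib_right algebra_simps add_divide_distrib)

lemma apply_field_cmult: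
  assumes "f differentiable (at z)"
  shows "apply_field a (\<lambda>x. c * f x) z = c * apply_field a f z"
  by (subst apply_field_mult) (auto simp: assms)

lemma apply_field_sum:
  assumes "\<And>i. i \<in> A \<Longrightarrow> f i differentiable (at z)"
  shows "apply_field a (\<lambda>x. \<Sum>i\<in>A. f i x) z = (\<Sum>i\<in>A. apply_field a (f i) z)"
  using assms by (induction A rule: infinite_finite_induct)
    (auto simp: apply_field_add differentiable_sum)

lemma cpoly_apply_field:
  assumes "cpoly f" "\<And>j. cpoly (\<lambda>x. a x $ j)"
  shows "cpoly (apply_field a f)"
proof -
  have "cpoly (\<lambda>z. \<Sum>j\<in>UNIV. a z $ j * ((frechet_derivative f (at z) (axis j 1)
      + \<i> * frechet_derivative f (at z) (axis j \<i>)) / 2))"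
    by (intro cpoly_intros assms cpoly_derivative)
  then show ?thesis
    by (simp add: apply_field_def[abs_def] wirtinger_bar_def)
qed

section \<open>Tangential fields on the sphere\<close>

text \<open>The function is constant along the great circle through \<open>z\<close> in the direction \<open>v\<close>.\<close>

lemma sphere_tangential_derivative_zero:
  fixes f :: "'a::euclidean_space \<Rightarrow> 'b::real_normed_vector"
  assumes f: "(f has_derivative f') (at z)" and z: "norm z = 1"
    and zero: "\<forall>\<^sub>F w in nhds z. norm w = 1 \<longrightarrow> f w = k" and v: "z \<bullet> v = 0"
  shows "f' v = 0"
proof (cases "v = 0")
  case True
  then show ?thesis using f by (simp add: has_derivative_bounded_linear linear_simps)
next
  case False
  define u where "u = v /\<^sub>R norm v"
  have u: "norm u = 1" "z \<bullet> u = 0" "v = norm v *\<^sub>R u" using False v by (auto simp: u_def)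
  define \<gamma> where "\<gamma> s = cos s *\<^sub>R z + sin s *\<^sub>R u" for s :: real
  have \<gamma>1: "norm (\<gamma> s) = 1" for s
  proof -
    have "\<gamma> s \<bullet> \<gamma> s = (cos s)\<^sup>2 * (z \<bullet> z) + (sin s)\<^sup>2 * (u \<bullet> u)"
      using u(2) by (simp add: \<gamma>_def inner_add_left inner_add_right inner_commute power2_eq_square)
    then show ?thesis using z u(1) by (simp add: norm_eq_1)
  qed
  have \<gamma>: "(\<gamma> has_derivative (\<lambda>h. h *\<^sub>R u)) (at 0)"
    unfolding \<gamma>_def by (rule derivative_eq_intros refl | simp)+
  have \<gamma>0: "\<gamma> 0 = z" by (simp add: \<gamma>_def)
  have "((f \<circ> \<gamma>) has_derivative (f' \<circ> (\<lambda>h. h *\<^sub>R u))) (at 0)"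
    using f \<gamma>0 by (intro diff_chain_at \<gamma>) simp
  moreover have "((f \<circ> \<gamma>) has_derivative (\<lambda>_. 0)) (at 0)"
  proof (rule has_derivative_transform_eventually[OF has_derivative_const])
    have "(\<gamma> \<longlongrightarrow> z) (at 0)"
      using has_derivative_continuous[OF \<gamma>] \<gamma>0 by (simp add: continuous_at)
    then have "\<forall>\<^sub>F s in at 0. norm (\<gamma> s) = 1 \<longrightarrow> f (\<gamma> s) = k"
      by (rule eventually_compose_filterlim[OF zero])
    then show "\<forall>\<^sub>F s in at 0. k = (f \<circ> \<gamma>) s" by eventually_elim (simp add: \<gamma>1)
    show "k = (f \<circ> \<gamma>) 0" using eventually_nhds_x_imp_x[OF zero] z \<gamma>0 by simp
  qed simp
  ultimately have "f' \<circ> (\<lambda>h. h *\<^sub>R u) = (\<lambda>_. 0)" by (rule has_derivative_unique)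
  then have "f' (norm v *\<^sub>R u) = 0" by (simp add: fun_eq_iff)
  then show ?thesis using u(3) by simp
qed

text \<open>The condition says that \<open>v\<close> and \<open>\<i> v\<close> are tangent to the sphere, where \<open>v\<close> is the conjugate of \<open>a z\<close>; so
  derivatives along both kill every function that vanishes on the sphere.\<close>

lemma linear_field_in_CR_fields:
  fixes a :: "complex^'n \<Rightarrow> complex^'n"
  assumes a: "bounded_linear a" and tangent: "\<And>z. (\<Sum>j\<in>UNIV. a z $ j * z $ j) = 0"
  shows "a \<in> CR_fields (sphere 0 1) p"
  unfolding CR_fields_def
proof (intro CollectI conjI ballI)
  show "real_analytic_at a p" using a by (rule real_analytic_at_bounded_linear)
  fix f assume "f \<in> vanishing_ideal (sphere 0 1) p"
  then have "\<forall>\<^sub>F z in nhds p. f differentiable (at z)"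
    and "\<forall>\<^sub>F z in nhds p. z \<in> sphere 0 1 \<longrightarrow> f z = 0"
    unfolding vanishing_ideal_def by (auto intro: real_analytic_at_imp_eventually_differentiable)
  then have "\<forall>\<^sub>F z in nhds p. f differentiable (at z) \<and> (z \<in> sphere 0 1 \<longrightarrow> f z = 0)"
    by eventually_elim simp
  then have "\<forall>\<^sub>F z in nhds p. \<forall>\<^sub>F w in nhds z. f differentiable (at w) \<and> (w \<in> sphere 0 1 \<longrightarrow> f w = 0)"
    by (simp add: eventually_eventually)
  then show "\<forall>\<^sub>F z in nhds p. z \<in> sphere 0 1 \<longrightarrow> apply_field a f z = 0"
  proof (eventually_elim, intro impI)
    fix z assume ev: "\<forall>\<^sub>F w in nhds z. f differentiable (at w) \<and> (w \<in> sphere 0 1 \<longrightarrow> f w = 0)"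
      and z: "z \<in> sphere 0 1"
    have f: "(f has_derivative frechet_derivative f (at z)) (at z)"
      using eventually_nhds_x_imp_x[OF ev] frechet_derivative_works by blast
    have zero: "frechet_derivative f (at z) v = 0" if "z \<bullet> v = 0" for v
      using z ev that by (intro sphere_tangential_derivative_zero[OF f, where k = 0])
        (auto elim: eventually_mono)
    have eq: "(\<Sum>j\<in>UNIV. z $ j * a z $ j) = 0" using tangent[of z] by (simp add: mult.commute)
    have "z \<bullet> (\<chi> j. cnj (a z $ j)) = Re (\<Sum>j\<in>UNIV. z $ j * a z $ j)"
      by (simp add: inner_vec_def inner_complex_def)
    moreover have "z \<bullet> (\<chi> j. \<i> * cnj (a z $ j)) = Im (\<Sum>j\<in>UNIV. z $ j * a z $ j)"
      by (simp add: inner_vec_def inner_complex_def Im_sum algebra_simps)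
    ultimately show "apply_field a f z = 0"
      unfolding apply_field_eq[OF f] eq by (simp add: zero)
  qed
qed

section \<open>Level sets and analytic submanifolds inside them\<close>

lemma isCont_tendsto_nhds: "isCont f q \<Longrightarrow> (f \<longlongrightarrow> f q) (nhds q)"
  by (simp only: continuous_at tendsto_at_iff_tendsto_nhds)

lemma has_derivative_bound:
  assumes "(f has_derivative F) (at q)" "\<epsilon> > 0"
  shows "\<forall>\<^sub>F x in nhds q. norm (f x - f q - F (x - q)) \<le> \<epsilon> * norm (x - q)"
proof -
  obtain d where "d > 0"
    "\<And>y. norm (y - q) < d \<Longrightarrow> norm (f y - f q - F (y - q)) \<le> \<epsilon> * norm (y - q)"
    using assms unfolding has_derivative_at_alt by blast
  then show ?thesis unfolding eventually_nhds_metric dist_norm by blast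
qed

lemma eventually_along_ray:
  assumes "eventually A (nhds q)" "B > 0"
  shows "\<forall>\<^sub>F s in at_right (0::real). \<forall>w. norm w \<le> B \<longrightarrow> A (q + s *\<^sub>R w)"
proof -
  obtain d where d: "d > 0" "\<And>y. dist y q < d \<Longrightarrow> A y"
    using assms(1) unfolding eventually_nhds_metric by blast
  have "\<forall>\<^sub>F s in at_right (0::real). s < d / B"
    using d assms(2) by (intro eventually_at_rightI[of 0 "d / B"]) auto
  moreover have "\<forall>\<^sub>F s in at_right (0::real). s > 0" by (rule eventually_at_right_less)
  ultimately show ?thesis
  proof eventually_elim
    case (elim s)
    show ?case
    proof (intro allI impI d(2))
      fix w :: 'a assume "norm w \<le> B"
      then have "s * norm w \<le> s * B" using elim by (intro mult_left_mono) auto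
      also have "\<dots> < d" using elim assms(2) by (simp add: field_simps)
      finally show "dist (q + s *\<^sub>R w) q < d" using elim by (simp add: dist_norm)
    qed
  qed
qed

text \<open>Every tangent direction of a regular level set is a limit of secants: by the intermediate value theorem
  the segment through \<open>q + s v\<close> in the transverse direction \<open>P\<close> meets the level set at a distance \<open>o(s)\<close>.\<close>

lemma level_set_crossing:
  fixes \<rho> :: "'a::real_normed_vector \<Rightarrow> real"
  assumes D: "(\<rho> has_derivative D) (at q)" and cont: "continuous_on UNIV \<rho>"
    and q: "\<rho> q = 0" and P: "D P > 0" and v: "D v = 0" and \<epsilon>: "\<epsilon> > 0"
  shows "\<forall>\<^sub>F s in at_right 0. \<exists>\<tau>. \<bar>\<tau>\<bar> \<le> \<epsilon> \<and> \<rho> (q + s *\<^sub>R (v + \<tau> *\<^sub>R P)) = 0"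
proof -
  interpret bounded_linear D using D by (rule has_derivative_bounded_linear)
  define B where "B = norm v + \<epsilon> * norm P + 1"
  have B: "B > 0" using \<epsilon> by (auto simp: B_def intro: add_nonneg_pos)
  define \<eta> where "\<eta> = \<epsilon> * D P / (2 * B)"
  have \<eta>: "\<eta> > 0" using \<epsilon> P B by (simp add: \<eta>_def)
  have "\<forall>\<^sub>F s in at_right (0::real). s > 0" by (rule eventually_at_right_less)
  then show ?thesis
    using eventually_along_ray[OF has_derivative_bound[OF D \<eta>] B]
  proof eventually_elim
    case (elim s)
    have nb: "norm (v + \<tau> *\<^sub>R P) \<le> B" if "\<bar>\<tau>\<bar> \<le> \<epsilon>" for \<tau>
    proof -
      have "norm (v + \<tau> *\<^sub>R P) \<le> norm v + \<bar>\<tau>\<bar> * norm P" by (metis norm_scaleR norm_triangle_ineq)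
      also have "\<dots> \<le> norm v + \<epsilon> * norm P" using that by (intro add_left_mono mult_right_mono) auto
      finally show ?thesis by (simp add: B_def)
    qed
    have est: "\<bar>\<rho> (q + s *\<^sub>R (v + \<tau> *\<^sub>R P)) - s * (\<tau> * D P)\<bar> \<le> s * (\<epsilon> * D P / 2)" if "\<bar>\<tau>\<bar> \<le> \<epsilon>" for \<tau>
    proof -
      have "\<bar>\<rho> (q + s *\<^sub>R (v + \<tau> *\<^sub>R P)) - D (s *\<^sub>R (v + \<tau> *\<^sub>R P))\<bar> \<le> \<eta> * norm (s *\<^sub>R (v + \<tau> *\<^sub>R P))"
        using elim(2) nb[OF that] q by fastforce
      also have "\<dots> \<le> \<eta> * (s * B)"
        using nb[OF that] \<eta> elim(1) by (simp add: mult_left_mono)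
      also have "\<dots> = s * (\<epsilon> * D P / 2)" using B by (simp add: \<eta>_def)
      finally show ?thesis by (simp add: add scaleR v)
    qed
    have pos: "s * (\<epsilon> * D P / 2) > 0" using elim(1) \<epsilon> P by simp
    have "\<exists>\<tau>\<ge>-\<epsilon>. \<tau> \<le> \<epsilon> \<and> \<rho> (q + s *\<^sub>R (v + \<tau> *\<^sub>R P)) = 0"
    proof (rule IVT')
      show "\<rho> (q + s *\<^sub>R (v + (- \<epsilon>) *\<^sub>R P)) \<le> 0"
      proof -
        have "s * (- \<epsilon> * D P) = - 2 * (s * (\<epsilon> * D P / 2))" by simp
        then show ?thesis using est[of "-\<epsilon>"] \<epsilon> pos by linarith
      qed
      show "0 \<le> \<rho> (q + s *\<^sub>R (v + \<epsilon> *\<^sub>R P))"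
      proof -
        have "s * (\<epsilon> * D P) = 2 * (s * (\<epsilon> * D P / 2))" by simp
        then show ?thesis using est[of "\<epsilon>"] \<epsilon> pos by linarith
      qed
      show "continuous_on {- \<epsilon>..\<epsilon>} (\<lambda>\<tau>. \<rho> (q + s *\<^sub>R (v + \<tau> *\<^sub>R P)))"
        by (intro continuous_on_compose2[OF cont] continuous_intros) auto
    qed (use \<epsilon> in auto)
    then obtain \<tau> where "\<tau> \<ge> -\<epsilon>" "\<tau> \<le> \<epsilon>" "\<rho> (q + s *\<^sub>R (v + \<tau> *\<^sub>R P)) = 0" by blast
    then show ?case by (intro exI[of _ \<tau>]) auto
  qed
qed

text \<open>Differentiating along the secants from \<open>q\<close> avoids parametrizing the level set.\<close>

lemma derivative_zero_on_level_set:
  fixes \<rho> :: "'a::real_normed_vector \<Rightarrow> real" and f :: "'a \<Rightarrow> 'b::real_normed_vector"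
  assumes D: "(\<rho> has_derivative D) (at q)" and cont: "continuous_on UNIV \<rho>"
    and q: "\<rho> q = 0" and P: "D P > 0"
    and F: "(f has_derivative F) (at q)" and zero: "\<forall>\<^sub>F x in nhds q. \<rho> x = 0 \<longrightarrow> f x = 0"
    and v: "D v = 0"
  shows "F v = 0"
proof -
  interpret F: bounded_linear F using F by (rule has_derivative_bounded_linear)
  have fq: "f q = 0" using eventually_nhds_x_imp_x[OF zero] q by simp
  define K where "K = norm (F P) + norm v + norm P + 1"
  have K: "K > 0" by (auto simp: K_def intro!: add_nonneg_pos)
  have "norm (F v) \<le> \<epsilon> * K" if \<epsilon>: "0 < \<epsilon>" "\<epsilon> \<le> 1" for \<epsilon>
  proof -
    have "norm v + norm P + 1 > 0" by (auto intro!: add_nonneg_pos)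
    then have "\<forall>\<^sub>F s in at_right 0. \<forall>w. norm w \<le> norm v + norm P + 1 \<longrightarrow>
        norm (f (q + s *\<^sub>R w) - f q - F (q + s *\<^sub>R w - q)) \<le> \<epsilon> * norm (q + s *\<^sub>R w - q)
        \<and> (\<rho> (q + s *\<^sub>R w) = 0 \<longrightarrow> f (q + s *\<^sub>R w) = 0)"
      by (intro eventually_along_ray eventually_conj has_derivative_bound[OF F \<epsilon>(1)] zero)
    moreover have "\<forall>\<^sub>F s in at_right (0::real). s > 0" by (rule eventually_at_right_less)
    moreover note level_set_crossing[OF D cont q P v \<epsilon>(1)]
    ultimately have "\<forall>\<^sub>F s in at_right (0::real). norm (F v) \<le> \<epsilon> * K"
    proof eventually_elim
      case (elim s)
      from elim(3) obtain \<tau> where \<tau>: "\<bar>\<tau>\<bar> \<le> \<epsilon>" "\<rho> (q + s *\<^sub>R (v + \<tau> *\<^sub>R P)) = 0" by blast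
      have "norm (v + \<tau> *\<^sub>R P) \<le> norm v + \<bar>\<tau>\<bar> * norm P" by (metis norm_scaleR norm_triangle_ineq)
      also have "\<dots> \<le> norm v + 1 * norm P"
        using \<tau>(1) \<epsilon> by (intro add_left_mono mult_right_mono) auto
      finally have nb: "norm (v + \<tau> *\<^sub>R P) \<le> norm v + norm P" by simp
      then have "norm (v + \<tau> *\<^sub>R P) \<le> norm v + norm P + 1" by simp
      note est = elim(1)[THEN spec, THEN mp, OF this]
      have "f (q + s *\<^sub>R (v + \<tau> *\<^sub>R P)) = 0" by (rule mp[OF conjunct2[OF est] \<tau>(2)])
      with conjunct1[OF est]
      have "norm (F (s *\<^sub>R (v + \<tau> *\<^sub>R P))) \<le> \<epsilon> * norm (s *\<^sub>R (v + \<tau> *\<^sub>R P))"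
        using fq by simp
      then have "s * norm (F v + \<tau> *\<^sub>R F P) \<le> s * (\<epsilon> * norm (v + \<tau> *\<^sub>R P))"
        using elim(2) by (simp add: F.add F.scaleR mult_ac)
      then have "norm (F v + \<tau> *\<^sub>R F P) \<le> \<epsilon> * norm (v + \<tau> *\<^sub>R P)" using elim(2) by simp
      also have "\<dots> \<le> \<epsilon> * (norm v + norm P)" using nb \<epsilon> by (intro mult_left_mono) auto
      finally have 1: "norm (F v + \<tau> *\<^sub>R F P) \<le> \<epsilon> * (norm v + norm P)" .
      have "norm (F v) \<le> norm (F v + \<tau> *\<^sub>R F P) + norm (\<tau> *\<^sub>R F P)"
        by (metis add_diff_cancel_right' norm_triangle_ineq4)
      also have "norm (\<tau> *\<^sub>R F P) \<le> \<epsilon> * norm (F P)" using \<tau>(1) by (simp add: mult_right_mono)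
      finally have "norm (F v) \<le> \<epsilon> * (norm v + norm P) + \<epsilon> * norm (F P)" using 1 by linarith
      also have "\<dots> \<le> \<epsilon> * K" using \<epsilon> by (simp add: K_def algebra_simps)
      finally show ?case .
    qed
    then show ?thesis by (simp add: eventually_const trivial_limit_at_right_real)
  qed
  note bound = this
  have "norm (F v) \<le> e" if "e > 0" for e
  proof -
    define \<epsilon> where "\<epsilon> = min 1 (e / K)"
    have "0 < \<epsilon>" "\<epsilon> \<le> 1" using that K by (auto simp: \<epsilon>_def)
    then have "norm (F v) \<le> \<epsilon> * K" by (rule bound)
    also have "\<dots> \<le> (e / K) * K" using K by (intro mult_right_mono) (auto simp: \<epsilon>_def)
    finally show ?thesis using K by simp
  qed
  then have "norm (F v) \<le> 0 + e" if "e > 0" for e using that by simp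
  then have "norm (F v) \<le> 0" by (rule field_le_epsilon)
  then show ?thesis by simp
qed

lemma derivative_proportional_on_level_set:
  fixes \<rho> :: "'a::real_normed_vector \<Rightarrow> real" and f :: "'a \<Rightarrow> 'b::real_normed_vector"
  assumes "(\<rho> has_derivative D) (at q)" "continuous_on UNIV \<rho>" "\<rho> q = 0" "D P > 0"
    "(f has_derivative F) (at q)" "\<forall>\<^sub>F x in nhds q. \<rho> x = 0 \<longrightarrow> f x = 0"
  shows "F w = D w *\<^sub>R (F P /\<^sub>R D P)"
proof -
  interpret D: bounded_linear D using assms(1) by (rule has_derivative_bounded_linear)
  interpret F: bounded_linear F using assms(5) by (rule has_derivative_bounded_linear)
  have "D (w - (D w / D P) *\<^sub>R P) = 0" using assms(4) by (simp add: D.diff D.scaleR)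
  then have "F (w - (D w / D P) *\<^sub>R P) = 0"
    using derivative_zero_on_level_set[OF assms] by blast
  then show ?thesis by (simp add: F.diff F.scaleR divide_inverse)
qed

text \<open>A function with a proportional nonzero differential changes sign across the level set: to first order
  it grows along \<open>P\<close> faster than it varies near the level set.\<close>

lemma zero_near_tangent_level_set:
  fixes \<rho> f :: "'a::euclidean_space \<Rightarrow> real"
  assumes D: "(\<rho> has_derivative D) (at q)" and q: "\<rho> q = 0" and P: "D P > 0"
    and F: "(f has_derivative (\<lambda>v. \<kappa> * D v)) (at q)" and \<kappa>: "\<kappa> \<noteq> 0" and fq: "f q = 0"
    and cont: "\<forall>\<^sub>F x in nhds q. isCont f x"
  shows "\<forall>\<^sub>F x in nhds q. \<rho> x = 0 \<longrightarrow> (\<exists>\<tau>. \<bar>\<tau>\<bar> \<le> norm (x - q) \<and> f (x + \<tau> *\<^sub>R P) = 0)"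
proof -
  have wlog: "\<forall>\<^sub>F x in nhds q. \<rho> x = 0 \<longrightarrow> (\<exists>\<tau>. \<bar>\<tau>\<bar> \<le> norm (x - q) \<and> f (x + \<tau> *\<^sub>R P) = 0)"
    if \<kappa>: "\<kappa> > 0" and F: "(f has_derivative (\<lambda>v. \<kappa> * D v)) (at q)"
    and fq: "f q = 0" and cont: "\<forall>\<^sub>F x in nhds q. isCont f x" for f :: "'a \<Rightarrow> real" and \<kappa>
  proof -
    interpret D: bounded_linear D using D by (rule has_derivative_bounded_linear)
    define K where "K = \<kappa> + 1 + norm P"
    define \<eta> where "\<eta> = D P * \<kappa> / (2 * K)"
    have pos: "K > 0" using \<kappa> by (auto simp: K_def intro!: add_pos_nonneg)
    then have \<eta>: "\<eta> > 0" "\<eta> * K = D P * \<kappa> / 2" using P \<kappa> by (auto simp: \<eta>_def)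
    have "\<forall>\<^sub>F y in nhds q. \<bar>\<rho> y - \<rho> q - D (y - q)\<bar> \<le> \<eta> * norm (y - q) \<and>
        \<bar>f y - f q - \<kappa> * D (y - q)\<bar> \<le> \<eta> * norm (y - q) \<and> isCont f y"
      using has_derivative_bound[OF D \<eta>(1)] has_derivative_bound[OF F \<eta>(1)] cont
      by eventually_elim simp
    then obtain d where d: "d > 0"
      "\<And>y. dist y q < d \<Longrightarrow> \<bar>\<rho> y - \<rho> q - D (y - q)\<bar> \<le> \<eta> * norm (y - q) \<and>
        \<bar>f y - f q - \<kappa> * D (y - q)\<bar> \<le> \<eta> * norm (y - q) \<and> isCont f y"
      unfolding eventually_nhds_metric by (elim exE conjE) (rule that, assumption, blast)
    show ?thesis
      unfolding eventually_nhds_metric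
    proof (rule exI[of _ "d / (1 + norm P)"], intro conjI allI impI)
      have nP: "1 + norm P > 0" by (auto intro!: add_pos_nonneg)
      show "0 < d / (1 + norm P)" using d(1) nP by simp
      fix x assume x: "dist x q < d / (1 + norm P)" and \<rho>x: "\<rho> x = 0"
      define h where "h = norm (x - q)"
      have hd: "h * (1 + norm P) < d"
        using x nP by (simp add: h_def dist_norm field_simps)
      have h0: "h \<ge> 0" by (simp add: h_def)
      have near: "norm (x + \<tau> *\<^sub>R P - q) \<le> h * (1 + norm P)" if "\<bar>\<tau>\<bar> \<le> h" for \<tau>
      proof -
        have "norm (x + \<tau> *\<^sub>R P - q) \<le> norm (x - q) + \<bar>\<tau>\<bar> * norm P"
          using norm_triangle_ineq[of "x - q" "\<tau> *\<^sub>R P"] by (simp add: diff_add_eq)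
        also have "\<dots> \<le> h + h * norm P" using that by (auto simp: h_def intro: mult_right_mono)
        finally show ?thesis by (simp add: algebra_simps)
      qed
      have nearD: "dist (x + \<tau> *\<^sub>R P) q < d" if "\<bar>\<tau>\<bar> \<le> h" for \<tau>
        using near[OF that] hd by (simp add: dist_norm)
      have Dx: "\<bar>D (x - q)\<bar> \<le> \<eta> * h"
        using d(2)[OF nearD[of 0]] h0 \<rho>x q by (simp add: h_def)
      have est: "\<bar>f (x + \<tau> *\<^sub>R P) - \<kappa> * \<tau> * D P\<bar> \<le> h * (D P * \<kappa> / 2)" if "\<bar>\<tau>\<bar> \<le> h" for \<tau>
      proof -
        have Deq: "D (x + \<tau> *\<^sub>R P - q) = D (x - q) + \<tau> * D P"
          by (simp add: D.add D.diff D.scaleR)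
        have 1: "\<bar>f (x + \<tau> *\<^sub>R P) - \<kappa> * (D (x - q) + \<tau> * D P)\<bar> \<le> \<eta> * norm (x + \<tau> *\<^sub>R P - q)"
          using d(2)[OF nearD[OF that]] fq by (simp add: Deq)
        have 2: "\<eta> * norm (x + \<tau> *\<^sub>R P - q) \<le> \<eta> * (h * (1 + norm P))"
          using near[OF that] \<eta>(1) by (intro mult_left_mono) auto
        have 3: "\<bar>\<kappa> * D (x - q)\<bar> \<le> \<kappa> * (\<eta> * h)"
          unfolding abs_mult using Dx \<kappa> by (simp add: mult_left_mono)
        have "\<bar>f (x + \<tau> *\<^sub>R P) - \<kappa> * \<tau> * D P\<bar> \<le> \<eta> * (h * (1 + norm P)) + \<kappa> * (\<eta> * h)"
        proof -
          have "\<kappa> * (D (x - q) + \<tau> * D P) = \<kappa> * D (x - q) + \<kappa> * \<tau> * D P" by (simp add: distrib_left)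
          then show ?thesis using 1 2 3 by linarith
        qed
        also have "\<dots> = h * (\<eta> * K)" by (simp add: K_def algebra_simps)
        finally show ?thesis unfolding \<eta>(2) .
      qed
      have pos: "h * (D P * \<kappa> / 2) \<ge> 0" using h0 P \<kappa> by simp
      have "\<exists>\<tau>\<ge>-h. \<tau> \<le> h \<and> f (x + \<tau> *\<^sub>R P) = 0"
      proof (rule IVT')
        show "f (x + (- h) *\<^sub>R P) \<le> 0"
        proof -
          have "\<kappa> * (- h) * D P = - 2 * (h * (D P * \<kappa> / 2))" by simp
          then show ?thesis using est[of "-h"] h0 pos by linarith
        qed
        show "0 \<le> f (x + h *\<^sub>R P)"
        proof -
          have "\<kappa> * h * D P = 2 * (h * (D P * \<kappa> / 2))" by simp
          then show ?thesis using est[of "h"] h0 pos by linarith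
        qed
        show "continuous_on {- h..h} (\<lambda>\<tau>. f (x + \<tau> *\<^sub>R P))"
        proof (intro continuous_at_imp_continuous_on ballI)
          fix \<tau> assume "\<tau> \<in> {-h..h}"
          then have "isCont f (x + \<tau> *\<^sub>R P)" using d(2)[OF nearD[of \<tau>]] by (auto simp: abs_le_iff)
          then show "isCont (\<lambda>\<tau>. f (x + \<tau> *\<^sub>R P)) \<tau>"
            by (rule isCont_o2[where f = "\<lambda>\<tau>. x + \<tau> *\<^sub>R P" and g = f, rotated])
               (intro continuous_intros)
        qed
      qed (use h0 in auto)
      then obtain \<tau> where "\<tau> \<ge> -h" "\<tau> \<le> h" "f (x + \<tau> *\<^sub>R P) = 0" by blast
      then show "\<exists>\<tau>. \<bar>\<tau>\<bar> \<le> norm (x - q) \<and> f (x + \<tau> *\<^sub>R P) = 0"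
        by (intro exI[of _ \<tau>]) (auto simp: h_def)
    qed
  qed
  show ?thesis
  proof (cases "\<kappa> > 0")
    case True
    show ?thesis by (rule wlog[OF True F fq cont])
  next
    case False
    have "((\<lambda>x. - f x) has_derivative (\<lambda>v. (-\<kappa>) * D v)) (at q)"
      using has_derivative_minus[OF F] by simp
    moreover have "\<forall>\<^sub>F x in nhds q. isCont (\<lambda>x. - f x) x"
      using cont by eventually_elim (rule continuous_minus)
    ultimately have "\<forall>\<^sub>F x in nhds q. \<rho> x = 0 \<longrightarrow>
        (\<exists>\<tau>. \<bar>\<tau>\<bar> \<le> norm (x - q) \<and> - f (x + \<tau> *\<^sub>R P) = 0)"
      using False \<kappa> fq by (intro wlog[where \<kappa> = "-\<kappa>"]) simp_all
    then show ?thesis by simp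
  qed
qed

text \<open>By the last hypothesis all equations of \<open>S\<close> have proportional differentials at \<open>q\<close>; as they are independent,
  there is at most one of them.  Its zeros lie on the level set, and near every point \<open>x\<close> of the level set it
  has a zero on the line \<open>x + \<tau> P\<close>.  That line meets the level set only once, so \<open>x\<close> itself is the zero.\<close>

lemma submanifold_with_full_tangent_space_is_open:
  fixes \<rho> :: "'a::euclidean_space \<Rightarrow> real"
  assumes D: "\<And>x. (\<rho> has_derivative D x) (at x)" and P: "D q P > 0"
    and contD: "isCont (\<lambda>x. D x P) q"
    and S: "\<And>x. x \<in> S \<Longrightarrow> \<rho> x = 0" and q: "q \<in> S"
    and codim: "real_analytic_codim_at k S q"
    and tangent: "\<And>f F. (f has_derivative F) (at q) \<Longrightarrow> \<forall>\<^sub>F x in nhds q. x \<in> S \<longrightarrow> f x = 0 \<Longrightarrow>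
       \<exists>\<kappa>::real. F = (\<lambda>v. \<kappa> * D q v)"
  shows "\<forall>\<^sub>F x in nhds q. \<rho> x = 0 \<longrightarrow> x \<in> S"
proof -
  obtain f where an: "\<And>i. i < k \<Longrightarrow> real_analytic_at (f i) q"
    and eq: "\<forall>\<^sub>F w in nhds q. w \<in> S \<longleftrightarrow> (\<forall>i<k. f i w = 0)"
    and indep: "\<And>c :: nat \<Rightarrow> real. (\<forall>v. (\<Sum>i<k. c i * frechet_derivative (f i) (at q) v) = 0) \<Longrightarrow> (\<forall>i<k. c i = 0)"
    using codim unfolding real_analytic_codim_at_def by blast
  have diff: "\<forall>\<^sub>F x in nhds q. f i differentiable (at x)" if "i < k" for i
    using an[OF that] by (rule real_analytic_at_imp_eventually_differentiable_real)
  have der: "(f i has_derivative frechet_derivative (f i) (at q)) (at q)" if "i < k" for i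
    using eventually_nhds_x_imp_x[OF diff[OF that]] frechet_derivative_works by blast
  have "\<exists>\<kappa>. frechet_derivative (f i) (at q) = (\<lambda>v. \<kappa> * D q v)" if "i < k" for i
    using der[OF that] eq by (intro tangent) (auto elim!: eventually_mono simp: that)
  then obtain \<kappa> where \<kappa>: "\<And>i. i < k \<Longrightarrow> frechet_derivative (f i) (at q) = (\<lambda>v. \<kappa> i * D q v)" by metis
  have \<kappa>nz: "\<kappa> i \<noteq> 0" if "i < k" for i
  proof
    assume "\<kappa> i = 0"
    then have "\<forall>v. (\<Sum>j<k. (if j = i then 1 else 0) * frechet_derivative (f j) (at q) v) = 0"
      using \<kappa> that by (auto intro!: sum.neutral)
    from indep[OF this] that show False by auto
  qed
  have "k \<le> 1"
  proof (rule ccontr)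
    assume "\<not> k \<le> 1"
    then have k: "0 < k" "1 < k" by auto
    let ?c = "\<lambda>j. if j = 0 then \<kappa> 1 else if j = 1 then - \<kappa> 0 else 0"
    have "(\<Sum>j<k. ?c j * frechet_derivative (f j) (at q) v) = 0" for v
    proof -
      have "(\<Sum>j<k. ?c j * frechet_derivative (f j) (at q) v) =
          (\<Sum>j\<in>{0, 1}. ?c j * frechet_derivative (f j) (at q) v)"
        using k by (intro sum.mono_neutral_right) auto
      then show ?thesis using \<kappa> k by simp
    qed
    then have "\<forall>i<k. ?c i = 0" by (intro indep) blast
    then have "\<kappa> 1 = 0" using k(1) by (metis (full_types))
    then show False using \<kappa>nz k by blast
  qed
  then consider "k = 0" | "k = 1" by linarith
  then show ?thesis
  proof cases
    case 1
    then show ?thesis using eq by (auto elim: eventually_mono)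
  next
    case 2
    have fq: "f 0 q = 0" using eventually_nhds_x_imp_x[OF eq] q 2 by auto
    have cont: "\<forall>\<^sub>F x in nhds q. isCont (f 0) x"
      using diff[of 0] 2 by (auto elim!: eventually_mono intro: differentiable_imp_continuous_within)
    have der0: "(f 0 has_derivative (\<lambda>v. \<kappa> 0 * D q v)) (at q)" using der[of 0] \<kappa>[of 0] 2 by simp
    have near: "\<forall>\<^sub>F x in nhds q. \<rho> x = 0 \<longrightarrow> (\<exists>\<tau>. \<bar>\<tau>\<bar> \<le> norm (x - q) \<and> f 0 (x + \<tau> *\<^sub>R P) = 0)"
      using 2 by (intro zero_near_tangent_level_set[OF D S[OF q] P der0 _ fq cont] \<kappa>nz) auto
    have "\<forall>\<^sub>F x in nhds q. D x P > 0"
      using isCont_tendsto_nhds[OF contD] P by (rule order_tendstoD(1))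
    with eq have "\<forall>\<^sub>F x in nhds q. (x \<in> S \<longleftrightarrow> f 0 x = 0) \<and> D x P > 0"
      by eventually_elim (use 2 in auto)
    then obtain d where d: "d > 0" "\<And>x. dist x q < d \<Longrightarrow> (x \<in> S \<longleftrightarrow> f 0 x = 0) \<and> D x P > 0"
      unfolding eventually_nhds_metric by blast
    have nP: "1 + norm P > 0" by (auto intro!: add_pos_nonneg)
    have "\<forall>\<^sub>F x in nhds q. dist x q < d / (1 + norm P)"
      unfolding eventually_nhds_metric using d(1) nP by (intro exI[of _ "d / (1 + norm P)"]) auto
    then show ?thesis using near
    proof eventually_elim
      case (elim x)
      show ?case
      proof
        assume \<rho>x: "\<rho> x = 0"
        then obtain \<tau> where \<tau>: "\<bar>\<tau>\<bar> \<le> norm (x - q)" "f 0 (x + \<tau> *\<^sub>R P) = 0" using elim(2) by blast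
        have near: "dist (x + t *\<^sub>R P) q < d" if "\<bar>t\<bar> \<le> \<bar>\<tau>\<bar>" for t
        proof -
          have "norm (x + t *\<^sub>R P - q) \<le> norm (x - q) + \<bar>t\<bar> * norm P"
            using norm_triangle_ineq[of "x - q" "t *\<^sub>R P"] by (simp add: diff_add_eq)
          also have "\<dots> \<le> norm (x - q) + norm (x - q) * norm P"
            using that \<tau>(1) by (auto intro: mult_right_mono)
          also have "\<dots> < d" using elim(1) nP by (simp add: dist_norm field_simps)
          finally show ?thesis by (simp add: dist_norm)
        qed
        have \<rho>\<tau>: "\<rho> (x + \<tau> *\<^sub>R P) = 0" using S d(2)[OF near[of \<tau>]] \<tau>(2) by auto
        have "\<tau> = 0"
        proof (rule ccontr)
          assume \<tau>0: "\<tau> \<noteq> 0"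
          have "\<exists>z\<in>{0<..<1}. \<rho> (x + (1 * \<tau>) *\<^sub>R P) - \<rho> (x + (0 * \<tau>) *\<^sub>R P) = D (x + (z * \<tau>) *\<^sub>R P) ((1 - 0) *\<^sub>R (\<tau> *\<^sub>R P))"
          proof (rule mvt_simple[of 0 1 "\<lambda>t. \<rho> (x + (t * \<tau>) *\<^sub>R P)" "\<lambda>t h. D (x + (t * \<tau>) *\<^sub>R P) (h *\<^sub>R (\<tau> *\<^sub>R P))"])
            show "((\<lambda>t. \<rho> (x + (t * \<tau>) *\<^sub>R P)) has_derivative
                (\<lambda>h. D (x + (t * \<tau>) *\<^sub>R P) (h *\<^sub>R (\<tau> *\<^sub>R P)))) (at t within {0..1})" for t
              by (rule has_derivative_compose[OF _ D]) (auto intro!: derivative_eq_intros)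
          qed auto
          then obtain z where z: "0 < z" "z < 1" "D (x + (z * \<tau>) *\<^sub>R P) (\<tau> *\<^sub>R P) = 0"
            using \<rho>x \<rho>\<tau> by auto
          interpret Dz: bounded_linear "D (x + (z * \<tau>) *\<^sub>R P)" using D by (rule has_derivative_bounded_linear)
          have "D (x + (z * \<tau>) *\<^sub>R P) P = 0" using z(3) \<tau>0 by (simp add: Dz.scaleR)
          moreover have "\<bar>z * \<tau>\<bar> \<le> \<bar>\<tau>\<bar>" using z by (simp add: abs_mult mult_left_le_one_le)
          ultimately show False using d(2)[OF near[of "z * \<tau>"]] by simp
        qed
        then show "x \<in> S" using d(2)[OF near[of \<tau>]] \<tau>(2) by auto
      qed
    qed
  qed
qed

lemma regular_level_set_hypersurface:
  fixes \<rho> :: "'a::euclidean_space \<Rightarrow> real"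
  assumes an: "\<And>x. real_analytic_at \<rho> x" and D: "\<And>x. (\<rho> has_derivative D x) (at x)"
    and contD: "\<And>x. isCont (\<lambda>x. D x P) x"
  shows "real_analytic_hypersurface {x. \<rho> x = 0 \<and> D x P > 0}"
  unfolding real_analytic_hypersurface_def real_analytic_codim_at_def
proof (intro ballI exI[of _ "\<lambda>_. \<rho>"] conjI allI impI an)
  fix q assume q: "q \<in> {x. \<rho> x = 0 \<and> D x P > 0}"
  have "\<forall>\<^sub>F x in nhds q. D x P > 0"
    using isCont_tendsto_nhds[OF contD] q by (intro order_tendstoD(1)) auto
  then show "\<forall>\<^sub>F w in nhds q. (w \<in> {x. \<rho> x = 0 \<and> D x P > 0}) = (\<forall>i<(1::nat). \<rho> w = 0)"
    by eventually_elim auto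
  fix c :: "nat \<Rightarrow> real" and i :: nat
  assume i: "i < 1" and "\<forall>v. (\<Sum>i<1. c i * frechet_derivative \<rho> (at q) v) = 0"
  then have "(\<Sum>i<(1::nat). c i * frechet_derivative \<rho> (at q) P) = 0" by blast
  then have "c 0 * D q P = 0"
    using frechet_derivative_at[OF D[of q]] by simp
  then show "c i = 0" using q i by simp
qed

section \<open>Hermitian polynomials that cannot be interpolated by few parameters\<close>

lemma differentiable_vecI:
  fixes f :: "'a::real_normed_vector \<Rightarrow> 'b::euclidean_space^'n"
  assumes "\<And>i. (\<lambda>x. f x $ i) differentiable F"
  shows "f differentiable F"
proof -
  have "f = (\<lambda>x. \<Sum>i\<in>UNIV. axis i (f x $ i))"
    by (auto simp: fun_eq_iff vec_eq_iff axis_def if_distrib cong: if_cong)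
  moreover have "(\<lambda>x. \<Sum>i\<in>UNIV. axis i (f x $ i)) differentiable F"
  proof (intro differentiable_sum ballI)
    fix i
    have "linear (axis i :: 'b \<Rightarrow> 'b^'n)"
      by (auto intro!: linearI simp: axis_def vec_eq_iff)
    then have "bounded_linear (axis i :: 'b \<Rightarrow> 'b^'n)" by (simp add: linear_conv_bounded_linear)
    with assms[of i] show "(\<lambda>x. axis i (f x $ i)) differentiable F"
      unfolding differentiable_def by (metis bounded_linear.has_derivative)
  qed simp
  ultimately show ?thesis by simp
qed

lemma differentiable_cnj: "f differentiable F \<Longrightarrow> (\<lambda>x. cnj (f x)) differentiable F"
  unfolding differentiable_def using bounded_linear.has_derivative[OF bounded_linear_cnj] by blast

lemma differentiable_prod:
  fixes f :: "'i \<Rightarrow> 'a::real_normed_vector \<Rightarrow> complex"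
  shows "(\<And>i. i \<in> A \<Longrightarrow> f i differentiable (at x)) \<Longrightarrow> (\<lambda>x. \<Prod>i\<in>A. f i x) differentiable (at x)"
  by (induction A rule: infinite_finite_induct) auto

lemma differentiable_det:
  fixes A :: "'a::real_normed_vector \<Rightarrow> complex^'n^'n"
  assumes "\<And>i j. (\<lambda>x. A x $ i $ j) differentiable (at x)"
  shows "(\<lambda>x. det (A x)) differentiable (at x)"
  unfolding det_def
  by (intro differentiable_sum ballI differentiable_mult differentiable_const differentiable_prod assms)
     (simp add: finite_permutations)

lemma vandermonde_det_nonzero:
  fixes x :: "'p::finite \<Rightarrow> complex"
  assumes k: "bij_betw k UNIV {..<CARD('p)}" and inj: "inj x"
  shows "det (\<chi> s d. x s ^ k d) \<noteq> 0"
proof -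
  let ?V = "\<chi> s d. x s ^ k d"
  have "c = 0" if c: "?V *v c = 0" for c
  proof -
    define f where "f i = c $ inv k i" for i
    have fk: "f (k d) = c $ d" for d using k by (simp add: f_def bij_betw_def)
    have root: "(\<Sum>i<CARD('p). f i * x s ^ i) = 0" for s
    proof -
      have "(\<Sum>i<CARD('p). f i * x s ^ i) = (\<Sum>d\<in>UNIV. f (k d) * x s ^ k d)"
        by (rule sum.reindex_bij_betw[OF k, symmetric])
      also have "\<dots> = (?V *v c) $ s" by (simp add: matrix_vector_mult_def fk mult.commute)
      finally show ?thesis using c by simp
    qed
    have "f i = 0" if i: "i < CARD('p)" for i
    proof (rule ccontr)
      assume "f i \<noteq> 0"
      have n: "{..<CARD('p)} = {..CARD('p) - 1}" using i by auto
      have "\<exists>j\<le>CARD('p) - 1. f j \<noteq> 0" using \<open>f i \<noteq> 0\<close> i by (intro exI[of _ i]) auto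
      from polyfun_rootbound[OF this]
      have "card {z. (\<Sum>i\<le>CARD('p) - 1. f i * z ^ i) = 0} \<le> CARD('p) - 1"
        and "finite {z. (\<Sum>i\<le>CARD('p) - 1. f i * z ^ i) = 0}" by blast+
      moreover have "range x \<subseteq> {z. (\<Sum>i\<le>CARD('p) - 1. f i * z ^ i) = 0}"
        using root n by auto
      ultimately have "card (range x) \<le> CARD('p) - 1" by (meson card_mono le_trans)
      then show False using card_image[OF inj] i by simp
    qed
    moreover have "k d < CARD('p)" for d using k by (auto simp: bij_betw_def)
    ultimately show ?thesis using fk by (metis vec_eq_iff zero_index)
  qed
  then have "\<exists>B. B ** ?V = mat 1" using matrix_left_invertible_ker by blast
  then show ?thesis by (metis det_I det_mul mult_zero_right zero_neq_one)
qed

text \<open>The exponents are enumerated by \<open>k\<close> so that the nodes and the exponents can share the index type \<open>'p\<close>;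
  interpolation is then the inversion of a square Vandermonde matrix.\<close>

definition sesqui :: "('p \<Rightarrow> nat) \<Rightarrow> complex^'p^'p \<Rightarrow> complex \<Rightarrow> complex \<Rightarrow> complex" where
  "sesqui k C a b = (\<Sum>d\<in>UNIV. \<Sum>e\<in>UNIV. C $ d $ e * a ^ k d * cnj b ^ k e)"

text \<open>The Hermitian symmetrization makes \<open>hermitian_poly k c x x\<close> real.  Only monomials in one coordinate and its
  conjugate occur; they suffice to interpolate at nodes that are separated by one of the coordinates.\<close>

definition hermitian_poly ::
    "('p \<Rightarrow> nat) \<Rightarrow> complex^'p^'p^'m \<Rightarrow> complex^'m \<Rightarrow> complex^'m \<Rightarrow> complex" where
  "hermitian_poly k c x y =
     (\<Sum>r\<in>UNIV. sesqui k (c $ r) (x $ r) (y $ r) + cnj (sesqui k (c $ r) (y $ r) (x $ r)))"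

lemma differentiable_sesqui:
  assumes "\<And>d e. (\<lambda>x. C x $ d $ e) differentiable (at x)" "a differentiable (at x)"
    "b differentiable (at x)"
  shows "(\<lambda>x. sesqui k (C x) (a x) (b x)) differentiable (at x)"
  unfolding sesqui_def
  by (intro differentiable_sum ballI differentiable_mult differentiable_power differentiable_cnj assms)
     simp_all

text \<open>Along an injective family of nodes the values at the index pairs in \<open>E\<close> can be prescribed arbitrarily;
  \<open>E\<close> contains at most one of \<open>(s, t)\<close> and \<open>(t, s)\<close>, since the values at these pairs are conjugate.  If the
  values are instead functions of the nodes, then the coefficients depend smoothly on the nodes and on the
  values outside \<open>E\<close>.  As \<open>E\<close> has more elements than the nodes have coordinates, the coefficients lie in the
  image of a null set, part of a proper subspace, under a differentiable map.\<close>

lemma negligible_interpolating_coefficients: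
  fixes E :: "('p::finite \<times> 'p) set" and num den :: "complex^'m \<Rightarrow> complex^'m \<Rightarrow> complex"
  assumes k: "bij_betw k UNIV {..<CARD('p)}"
    and asym: "\<And>s t. (s, t) \<in> E \<Longrightarrow> (t, s) \<notin> E"
    and card_E: "card E > CARD('p) * CARD('m)"
    and num: "\<And>z. (\<lambda>z. num (fst z) (snd z)) differentiable (at z)"
    and den: "\<And>z. (\<lambda>z. den (fst z) (snd z)) differentiable (at z)"
  shows "negligible {c :: complex^'p^'p^'m. \<exists>W :: 'p \<Rightarrow> complex^'m. inj (\<lambda>s. W s $ r) \<and>
    (\<forall>(s, t)\<in>E. den (W s) (W t) \<noteq> 0 \<and>
       num (W s) (W t) + den (W s) (W t) * hermitian_poly k c (W s) (W t) = 0)}"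
    (is "negligible ?Bad")
proof -
  have "card (UNIV :: ('p \<times> 'm) set) < card E" using card_E by simp
  then obtain \<tau> :: "'p \<times> 'm \<Rightarrow> 'p \<times> 'p" where \<tau>: "inj \<tau>" "range \<tau> \<subseteq> E"
    using card_le_inj[of UNIV E] by (metis finite less_imp_le)
  have "range \<tau> \<noteq> E"
    using \<open>card UNIV < card E\<close> card_image[OF \<tau>(1)] by auto
  then obtain e1 e2 where e: "(e1, e2) \<in> E" "(e1, e2) \<notin> range \<tau>" using \<tau>(2) by auto
  (* A parameter Z has the same shape as the coefficients.  Its r-th matrix holds the coordinates of the
     nodes in the entries given by \<tau>, which lie in E, and the free interpolation values outside E; the entry
     (e1, e2) is always 0.  Its other matrices are coefficients.  From Z one recovers the nodes w, their Vandermonde matrix V, its inverse U by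
     Cramer's rule, the interpolation values Y and finally the coefficients G. *)
  define w :: "complex^'p^'p^'m \<Rightarrow> 'p \<Rightarrow> complex^'m" where
    "w Z s = (\<chi> \<mu>. Z $ r $ fst (\<tau> (s, \<mu>)) $ snd (\<tau> (s, \<mu>)))" for Z s
  define V :: "complex^'p^'p^'m \<Rightarrow> complex^'p^'p" where
    "V Z = (\<chi> s d. (w Z s $ r) ^ k d)" for Z
  define U :: "complex^'p^'p^'m \<Rightarrow> complex^'p^'p" where
    "U Z = (\<chi> d s. det (\<chi> i j. if j = d then (if i = s then 1 else 0) else V Z $ i $ j) / det (V Z))" for Z
  define other :: "complex^'p^'p^'m \<Rightarrow> 'p \<Rightarrow> 'p \<Rightarrow> complex" where
    "other Z s t = (\<Sum>\<mu>\<in>UNIV - {r}. sesqui k (Z $ \<mu>) (w Z s $ \<mu>) (w Z t $ \<mu>)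
        + cnj (sesqui k (Z $ \<mu>) (w Z t $ \<mu>) (w Z s $ \<mu>)))" for Z s t
  define Y :: "complex^'p^'p^'m \<Rightarrow> 'p \<Rightarrow> 'p \<Rightarrow> complex" where
    "Y Z s t = (if (s, t) \<in> E
       then - num (w Z s) (w Z t) / den (w Z s) (w Z t) - other Z s t - cnj (Z $ r $ t $ s)
       else Z $ r $ s $ t)" for Z s t
  define G :: "complex^'p^'p^'m \<Rightarrow> complex^'p^'p^'m" where
    "G Z = (\<chi> \<mu>. if \<mu> = r then (\<chi> d e. \<Sum>s\<in>UNIV. \<Sum>t\<in>UNIV. U Z $ d $ s * Y Z s t * cnj (U Z $ e $ t))
       else Z $ \<mu>)" for Z
  define S where "S = {Z. Z $ r $ e1 $ e2 = 0 \<and> det (V Z) \<noteq> 0 \<and>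
       (\<forall>(s, t)\<in>E. den (w Z s) (w Z t) \<noteq> 0)}"

  have "negligible S"
  proof (rule negligible_subset)
    let ?a = "axis r (axis e1 (axis e2 1)) :: complex^'p^'p^'m"
    have "?a \<noteq> 0" by (simp add: axis_eq_0_iff)
    then show "negligible {Z. ?a \<bullet> Z = 0}" by (intro negligible_hyperplane) simp
    show "S \<subseteq> {Z. ?a \<bullet> Z = 0}" by (auto simp: S_def inner_axis' )
  qed
  moreover have "G differentiable_on S"
    unfolding differentiable_on_def
  proof
    fix Z assume Z: "Z \<in> S"
    have nth: "(\<lambda>Z. Z $ \<mu> $ s $ t) differentiable (at Z)" for \<mu> :: 'm and s t :: 'p
      by (intro linear_imp_differentiable bounded_linear.linear
          bounded_linear_compose[OF bounded_linear_vec_nth]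
          bounded_linear_compose[OF bounded_linear_vec_nth bounded_linear_vec_nth])
    have w_nth: "(\<lambda>Z. w Z s $ \<mu>) differentiable (at Z)" for s \<mu>
      using nth by (simp add: w_def)
    then have w: "(\<lambda>Z. w Z s) differentiable (at Z)" for s by (rule differentiable_vecI)
    have V: "(\<lambda>Z. V Z $ s $ d) differentiable (at Z)" for s d
      unfolding V_def using w_nth by simp
    have U: "(\<lambda>Z. U Z $ d $ s) differentiable (at Z)" for s d
    proof -
      have "(\<lambda>Z. (\<chi> i j. if j = d then (if i = s then 1 else 0) else V Z $ i $ j) $ i $ j)
          differentiable (at Z)" for i j
        using V[of i j] by (cases "j = d") simp_all
      moreover have "det (V Z) \<noteq> 0" using Z by (simp add: S_def)
      ultimately show ?thesis
        unfolding U_def using differentiable_det[OF V] by (simp add: differentiable_det)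
    qed
    have other: "(\<lambda>Z. other Z s t) differentiable (at Z)" for s t
      unfolding other_def
      by (intro differentiable_sum ballI differentiable_add differentiable_cnj differentiable_sesqui
          nth w_nth) simp
    have pair: "(\<lambda>Z. (w Z s, w Z t)) differentiable (at Z)" for s t
    proof -
      obtain A B where "((\<lambda>Z. w Z s) has_derivative A) (at Z)" "((\<lambda>Z. w Z t) has_derivative B) (at Z)"
        using w unfolding differentiable_def by blast
      from has_derivative_Pair[OF this] show ?thesis unfolding differentiable_def by blast
    qed
    have Y: "(\<lambda>Z. Y Z s t) differentiable (at Z)" for s t
    proof (cases "(s, t) \<in> E")
      case True
      have "(\<lambda>Z. num (w Z s) (w Z t)) differentiable (at Z)"
        using differentiable_compose[OF num pair] by simp
      moreover have "(\<lambda>Z. den (w Z s) (w Z t)) differentiable (at Z)"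
        using differentiable_compose[OF den pair] by simp
      moreover have "den (w Z s) (w Z t) \<noteq> 0" using Z True by (auto simp: S_def)
      ultimately show ?thesis
        using True by (simp add: Y_def differentiable_cnj nth other)
    qed (simp add: Y_def nth)
    have "G differentiable (at Z)"
    proof (intro differentiable_vecI)
      fix \<mu> d e
      show "(\<lambda>Z. G Z $ \<mu> $ d $ e) differentiable (at Z)"
      proof (cases "\<mu> = r")
        case True
        have "(\<lambda>Z. \<Sum>s\<in>UNIV. \<Sum>t\<in>UNIV. U Z $ d $ s * Y Z s t * cnj (U Z $ e $ t)) differentiable (at Z)"
          by (intro differentiable_sum ballI differentiable_mult differentiable_cnj U Y) simp_all
        then show ?thesis using True by (simp add: G_def)
      qed (simp add: G_def nth)
    qed
    then show "G differentiable (at Z within S)" by (rule differentiable_at_withinI)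
  qed
  ultimately have "negligible (G ` S)"
    by (intro negligible_differentiable_image_negligible) auto
  moreover have "?Bad \<subseteq> G ` S"
  proof
    fix c assume "c \<in> ?Bad"
    then obtain W :: "'p \<Rightarrow> complex^'m" where inj: "inj (\<lambda>s. W s $ r)"
      and dW: "\<And>s t. (s, t) \<in> E \<Longrightarrow> den (W s) (W t) \<noteq> 0"
      and eq: "\<And>s t. (s, t) \<in> E \<Longrightarrow>
        num (W s) (W t) + den (W s) (W t) * hermitian_poly k c (W s) (W t) = 0" by blast
    define slot where "slot z = (if z \<in> range \<tau> then case inv \<tau> z of (s, \<mu>) \<Rightarrow> W s $ \<mu> else 0)" for z
    define Z where "Z = (\<chi> \<mu>. if \<mu> = r
       then (\<chi> s t. if (s, t) \<in> E then slot (s, t) else sesqui k (c $ r) (W s $ r) (W t $ r))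
       else c $ \<mu>)"
    have wZ: "w Z s = W s" for s
    proof -
      have "(fst (\<tau> (s, \<mu>)), snd (\<tau> (s, \<mu>))) \<in> E" for \<mu> using \<tau>(2) by auto
      then show ?thesis by (simp add: vec_eq_iff w_def Z_def slot_def inv_f_f[OF \<tau>(1)])
    qed
    have VZ: "V Z = (\<chi> s d. (W s $ r) ^ k d)" by (simp add: V_def wZ)
    have detV: "det (V Z) \<noteq> 0" unfolding VZ using vandermonde_det_nonzero[OF k inj] .
    have ZS: "Z \<in> S"
      using e detV dW by (auto simp: S_def wZ) (simp add: Z_def slot_def)
    have Yq: "Y Z s t = sesqui k (c $ r) (W s $ r) (W t $ r)" for s t
    proof (cases "(s, t) \<in> E")
      case True
      have "other Z s t = (\<Sum>\<mu>\<in>UNIV - {r}. sesqui k (c $ \<mu>) (W s $ \<mu>) (W t $ \<mu>)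
        + cnj (sesqui k (c $ \<mu>) (W t $ \<mu>) (W s $ \<mu>)))"
        unfolding other_def wZ by (intro sum.cong) (auto simp: Z_def)
      then have "hermitian_poly k c (W s) (W t) = sesqui k (c $ r) (W s $ r) (W t $ r)
        + cnj (sesqui k (c $ r) (W t $ r) (W s $ r)) + other Z s t"
        unfolding hermitian_poly_def by (simp add: sum.remove[of UNIV r])
      moreover have "hermitian_poly k c (W s) (W t) = - num (W s) (W t) / den (W s) (W t)"
        using eq[OF True] dW[OF True] by (simp add: field_simps eq_neg_iff_add_eq_0)
      moreover have "Z $ r $ t $ s = sesqui k (c $ r) (W t $ r) (W s $ r)"
        using asym[OF True] by (simp add: Z_def)
      ultimately show ?thesis using True by (simp add: Y_def wZ algebra_simps)
    qed (simp add: Y_def Z_def)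
    have "V Z ** U Z = mat 1"
    proof -
      have "V Z *v (\<chi> d. U Z $ d $ s) = (\<chi> i. if i = s then 1 else 0)" for s
        by (subst cramer[OF detV]) (simp add: U_def cong: if_cong)
      then have "(\<Sum>d\<in>UNIV. V Z $ i $ d * U Z $ d $ s) = (if i = s then 1 else 0)" for i s
        by (auto simp: vec_eq_iff matrix_vector_mult_def)
      then show ?thesis by (simp add: vec_eq_iff matrix_matrix_mult_def mat_def)
    qed
    then have "U Z ** V Z = mat 1" by (simp add: matrix_left_right_inverse)
    then have UV: "(\<Sum>s\<in>UNIV. U Z $ d $ s * V Z $ s $ d') = (if d = d' then 1 else 0)" for d d'
      by (simp add: vec_eq_iff matrix_matrix_mult_def mat_def)
    have "(\<Sum>s\<in>UNIV. \<Sum>t\<in>UNIV. U Z $ d $ s * Y Z s t * cnj (U Z $ e $ t)) = c $ r $ d $ e" for d e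
    proof -
      let ?V' = "\<chi> e t. cnj (V Z $ t $ e)" and ?U' = "\<chi> t e. cnj (U Z $ e $ t)"
      let ?Y = "\<chi> s t. Y Z s t"
      have V'U': "?V' ** ?U' = mat 1"
      proof -
        have "(\<Sum>t\<in>UNIV. cnj (V Z $ t $ i) * cnj (U Z $ j $ t)) = (if i = j then 1 else 0)" for i j
          using arg_cong[OF UV[of j i], of cnj] by (auto simp: mult.commute)
        then show ?thesis by (simp add: vec_eq_iff matrix_matrix_mult_def mat_def)
      qed
      have "Y Z s t = (V Z ** (c $ r) ** ?V') $ s $ t" for s t
      proof -
        have "(V Z ** (c $ r) ** ?V') $ s $ t
            = (\<Sum>e\<in>UNIV. \<Sum>d\<in>UNIV. c $ r $ d $ e * (W s $ r) ^ k d * cnj (W t $ r) ^ k e)"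
          by (simp add: matrix_matrix_mult_def VZ sum_distrib_left sum_distrib_right mult_ac)
        also have "\<dots> = Y Z s t" unfolding Yq sesqui_def by (rule sum.swap)
        finally show ?thesis by simp
      qed
      then have Y: "?Y = V Z ** (c $ r) ** ?V'" by (simp add: vec_eq_iff)
      have "U Z ** ?Y ** ?U' = (U Z ** V Z) ** (c $ r) ** (?V' ** ?U')"
        unfolding Y by (simp only: matrix_mul_assoc)
      also have "\<dots> = c $ r" unfolding V'U' \<open>U Z ** V Z = mat 1\<close> by simp
      finally have "c $ r $ d $ e = (U Z ** ?Y ** ?U') $ d $ e" by simp
      also have "\<dots> = (\<Sum>t\<in>UNIV. \<Sum>s\<in>UNIV. U Z $ d $ s * Y Z s t * cnj (U Z $ e $ t))"
        by (simp add: matrix_matrix_mult_def sum_distrib_right)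
      also have "\<dots> = (\<Sum>s\<in>UNIV. \<Sum>t\<in>UNIV. U Z $ d $ s * Y Z s t * cnj (U Z $ e $ t))"
        by (rule sum.swap)
      finally show ?thesis by simp
    qed
    then have "G Z = c" by (auto simp: G_def vec_eq_iff Z_def)
    then show "c \<in> G ` S" using ZS by blast
  qed
  ultimately show ?thesis by (rule negligible_subset)
qed

section \<open>Holomorphic germs on the sphere\<close>

definition herm :: "complex^'n \<Rightarrow> complex^'n \<Rightarrow> complex" where
  "herm x y = (\<Sum>j\<in>UNIV. x $ j * cnj (y $ j))"

lemma herm_add_left: "herm (x + y) z = herm x z + herm y z"
  and herm_add_right: "herm z (x + y) = herm z x + herm z y"
  and herm_diff_left: "herm (x - y) z = herm x z - herm y z"
  and herm_diff_right: "herm z (x - y) = herm z x - herm z y"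
  and herm_smult_left: "herm (c *s x) z = c * herm x z"
  and herm_smult_right: "herm z (c *s x) = cnj c * herm z x"
  by (simp_all add: herm_def sum.distrib sum_subtractf sum_distrib_left algebra_simps)

lemmas herm_simps = herm_add_left herm_add_right herm_diff_left herm_diff_right herm_smult_left
  herm_smult_right

lemma cnj_herm: "cnj (herm x y) = herm y x"
  by (simp add: herm_def mult.commute)

lemma inner_eq_Re_herm: "x \<bullet> y = Re (herm x y)"
  by (simp add: inner_vec_def inner_complex_def herm_def)

lemma herm_self: "herm x x = of_real ((norm x)\<^sup>2)"
proof -
  have "Im (herm x x) = 0" using cnj_herm[of x x] by (metis Reals_cnj_iff complex_is_Real_iff)
  moreover have "Re (herm x x) = (norm x)\<^sup>2" by (simp add: power2_norm_eq_inner inner_eq_Re_herm)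
  ultimately show ?thesis by (simp add: complex_eq_iff)
qed

lemma herm_unit: "norm x = 1 \<Longrightarrow> herm x x = 1"
  by (simp add: herm_self)

lemma scaleR_eq_smult: "r *\<^sub>R (x :: complex^'n) = complex_of_real r *s x"
  by (simp only: vec_eq_iff vector_scaleR_component vector_smult_component)
     (simp add: scaleR_conv_of_real)

lemma norm_orthonormal_combination:
  assumes "norm a = 1" "norm b = 1" "herm b a = 0"
  shows "(norm (\<alpha> *s a + \<beta> *s b))\<^sup>2 = (cmod \<alpha>)\<^sup>2 + (cmod \<beta>)\<^sup>2"
proof -
  have ab: "herm a b = 0" using assms(3) cnj_herm[of b a] by simp
  have "complex_of_real ((norm (\<alpha> *s a + \<beta> *s b))\<^sup>2) = \<alpha> * cnj \<alpha> + \<beta> * cnj \<beta>"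
    unfolding herm_self[symmetric] herm_simps herm_unit[OF assms(1)] herm_unit[OF assms(2)] ab assms(3)
    by simp
  also have "\<dots> = complex_of_real ((cmod \<alpha>)\<^sup>2 + (cmod \<beta>)\<^sup>2)"
    by (simp only: complex_norm_square of_real_add)
  finally show ?thesis by (simp only: of_real_eq_iff)
qed

lemma exists_unit_orthogonal:
  fixes p :: "complex^'n"
  assumes "CARD('n) \<ge> 2"
  shows "\<exists>e. norm e = 1 \<and> herm e p = 0"
proof -
  obtain j k :: 'n where jk: "j \<noteq> k"
    using assms by (metis card_1_singletonE card_le_Suc0_iff_eq finite not_less_eq_eq numeral_2_eq_2 UNIV_I)
  have sumjk: "herm (a *s axis j 1 + b *s axis k 1) p = a * cnj (p $ j) + b * cnj (p $ k)" for a b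
    by (simp add: herm_simps) (simp add: herm_def axis_def if_distrib if_distribR cong: if_cong)
  have "\<exists>v. v \<noteq> 0 \<and> herm v p = 0"
  proof (cases "p $ j = 0")
    case True
    have "herm (axis j 1) p = 0" using sumjk[of 1 0] True by simp
    then show ?thesis by (metis axis_eq_0_iff zero_neq_one)
  next
    case False
    let ?v = "cnj (p $ k) *s axis j 1 + (- cnj (p $ j)) *s axis k 1 :: complex^'n"
    have "?v $ k \<noteq> 0" using jk False by (simp add: axis_def)
    then have "?v \<noteq> 0" by (metis zero_index)
    moreover have "herm ?v p = 0" unfolding sumjk by simp
    ultimately show ?thesis by blast
  qed
  then obtain v where v: "v \<noteq> 0" "herm v p = 0" by blast
  then have "norm (inverse (norm v) *\<^sub>R v) = 1" by simp
  moreover have "herm (inverse (norm v) *\<^sub>R v) p = 0"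
    unfolding scaleR_eq_smult herm_simps v(2) by simp
  ultimately show ?thesis by blast
qed

definition complex_differentiable :: "(complex^'n \<Rightarrow> complex) \<Rightarrow> complex^'n \<Rightarrow> bool" where
  "complex_differentiable f z \<longleftrightarrow> (\<exists>D. (f has_derivative D) (at z) \<and> (\<forall>c v. D (c *s v) = c * D v))"

lemma complex_differentiable_derivative:
  assumes "complex_differentiable f z"
  shows "(f has_derivative frechet_derivative f (at z)) (at z)"
    and "frechet_derivative f (at z) (c *s v) = c * frechet_derivative f (at z) v"
  using assms frechet_derivative_at unfolding complex_differentiable_def by metis+

lemma complex_differentiable_isCont: "complex_differentiable f z \<Longrightarrow> isCont f z"
  using complex_differentiable_derivative(1) has_derivative_continuous by blast

lemma bounded_linear_smult_left: "bounded_linear (\<lambda>c. c *s (a :: complex^'n))"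
proof (intro linear_conv_bounded_linear[THEN iffD1] linearI)
  show "(r *\<^sub>R c) *s a = r *\<^sub>R (c *s a)" for r c
    by (simp add: vec_eq_iff)
qed (simp add: vec_eq_iff distrib_right)

text \<open>Several complex variables enter only through restrictions to curves in the complex plane spanned by two
  vectors.\<close>

lemma has_field_derivative_on_plane:
  assumes f: "complex_differentiable f (\<alpha> \<xi> *s a + \<beta> \<xi> *s b)"
    and \<alpha>: "(\<alpha> has_field_derivative \<alpha>') (at \<xi>)" and \<beta>: "(\<beta> has_field_derivative \<beta>') (at \<xi>)"
  shows "((\<lambda>\<xi>. f (\<alpha> \<xi> *s a + \<beta> \<xi> *s b)) has_field_derivative
    frechet_derivative f (at (\<alpha> \<xi> *s a + \<beta> \<xi> *s b)) (\<alpha>' *s a + \<beta>' *s b)) (at \<xi>)"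
proof -
  let ?D = "frechet_derivative f (at (\<alpha> \<xi> *s a + \<beta> \<xi> *s b))"
  have "((\<lambda>\<xi>. \<alpha> \<xi> *s a + \<beta> \<xi> *s b) has_derivative (\<lambda>h. (\<alpha>' * h) *s a + (\<beta>' * h) *s b)) (at \<xi>)"
    using \<alpha> \<beta> unfolding has_field_derivative_def
    by (intro has_derivative_add bounded_linear.has_derivative[OF bounded_linear_smult_left])
  from has_derivative_compose[OF this complex_differentiable_derivative(1)[OF f]]
  have "((\<lambda>\<xi>. f (\<alpha> \<xi> *s a + \<beta> \<xi> *s b)) has_derivative (\<lambda>h. ?D ((\<alpha>' * h) *s a + (\<beta>' * h) *s b))) (at \<xi>)" .
  moreover have "?D ((\<alpha>' * h) *s a + (\<beta>' * h) *s b) = ?D (\<alpha>' *s a + \<beta>' *s b) * h" for h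
  proof -
    have "(\<alpha>' * h) *s a + (\<beta>' * h) *s b = h *s (\<alpha>' *s a + \<beta>' *s b)"
      by (simp add: vec_eq_iff algebra_simps)
    then show ?thesis by (simp only: complex_differentiable_derivative(2)[OF f] mult.commute)
  qed
  ultimately show ?thesis by (simp add: has_field_derivative_def)
qed

lemma holomorphic_on_plane:
  assumes "open S" "\<And>\<xi>. \<xi> \<in> S \<Longrightarrow> complex_differentiable f (\<alpha> \<xi> *s a + \<beta> \<xi> *s b)"
    "\<alpha> holomorphic_on S" "\<beta> holomorphic_on S"
  shows "(\<lambda>\<xi>. f (\<alpha> \<xi> *s a + \<beta> \<xi> *s b)) holomorphic_on S"
  unfolding holomorphic_on_open[OF assms(1)]
proof
  fix \<xi> assume \<xi>: "\<xi> \<in> S"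
  obtain \<alpha>' \<beta>' where "(\<alpha> has_field_derivative \<alpha>') (at \<xi>)" "(\<beta> has_field_derivative \<beta>') (at \<xi>)"
    using assms(1,3,4) \<xi> unfolding holomorphic_on_open[OF assms(1)] by blast
  from has_field_derivative_on_plane[OF assms(2)[OF \<xi>] this]
  show "\<exists>f'. ((\<lambda>\<xi>. f (\<alpha> \<xi> *s a + \<beta> \<xi> *s b)) has_field_derivative f') (at \<xi>)" by blast
qed

text \<open>If \<open>herm x y\<close> is real, then the great circle through \<open>x\<close> and \<open>y\<close> is horizontal: its velocity at every point
  is orthogonal to the complex line through that point.\<close>

lemma equal_along_horizontal_arc:
  fixes f :: "complex^'n \<Rightarrow> complex"
  assumes f: "\<And>z. dist z p < \<delta> \<Longrightarrow> complex_differentiable f z"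
    and hor: "\<And>z e. dist z p < \<delta> \<Longrightarrow> norm z = 1 \<Longrightarrow> herm e z = 0 \<Longrightarrow> frechet_derivative f (at z) e = 0"
    and x: "norm x = 1" "dist x p < \<delta> / 3" and y: "norm y = 1" "dist y p < \<delta> / 3"
    and \<delta>: "\<delta> \<le> 1" and real: "herm x y \<in> \<real>"
  shows "f x = f y"
proof (cases "x = y")
  case False
  define c where "c = x \<bullet> y"
  have hxy: "herm x y = of_real c" "herm y x = of_real c"
    using real cnj_herm[of x y] by (auto simp: c_def inner_eq_Re_herm elim!: Reals_cases)
  have dist_xy: "(norm (y - x))\<^sup>2 = 2 - 2 * c"
    using x(1) y(1) by (simp add: c_def power2_norm_eq_inner inner_diff_left inner_diff_right
        inner_commute norm_eq_1)
  have nxy: "norm (y - x) < 2 / 3 * \<delta>"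
    using dist_triangle2[of y x p] x(2) y(2) by (simp add: dist_norm)
  have c: "c < 1"
    using dist_xy False by (smt (verit, best) zero_less_norm_iff right_minus_eq zero_less_power2)
  have "(norm (y - x))\<^sup>2 < 2\<^sup>2" using nxy \<delta> by (intro power_strict_mono) auto
  then have c1: "-1 < c" using dist_xy by simp
  define \<theta> where "\<theta> = arccos c"
  have \<theta>: "cos \<theta> = c" "0 \<le> \<theta>" "\<theta> \<le> pi" using c c1 by (auto simp: \<theta>_def arccos_lbound arccos_ubound)
  have sin: "sin \<theta> \<noteq> 0"
    using \<theta>(1) c c1 sin_cos_squared_add[of \<theta>] by (auto simp: power2_eq_1_iff)
  define b where "b = complex_of_real (1 / sin \<theta>) *s (y - complex_of_real c *s x)"
  have y_eq: "y = complex_of_real (cos \<theta>) *s x + complex_of_real (sin \<theta>) *s b"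
    using sin \<theta>(1) by (simp add: b_def vec_eq_iff)
  have bx: "herm b x = 0" by (simp add: b_def herm_simps hxy herm_unit[OF x(1)])
  then have xb: "herm x b = 0" using cnj_herm[of b x] by simp
  have bb: "herm b b = 1"
  proof -
    have "herm y y = complex_of_real ((cos \<theta>)\<^sup>2) + complex_of_real ((sin \<theta>)\<^sup>2) * herm b b"
      by (subst (1 2) y_eq) (simp add: herm_simps bx xb herm_unit[OF x(1)] power2_eq_square)
    moreover have "complex_of_real ((cos \<theta>)\<^sup>2) + complex_of_real ((sin \<theta>)\<^sup>2) = 1"
      by (simp only: of_real_add[symmetric] sin_cos_squared_add2 of_real_1)
    ultimately have "complex_of_real ((sin \<theta>)\<^sup>2) * herm b b = complex_of_real ((sin \<theta>)\<^sup>2)"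
      using herm_unit[OF y(1)] by (metis add_left_cancel)
    then show ?thesis using sin by simp
  qed
  define \<gamma> where "\<gamma> s = complex_of_real (cos s) *s x + complex_of_real (sin s) *s b" for s
  define \<gamma>' where "\<gamma>' s = complex_of_real (- sin s) *s x + complex_of_real (cos s) *s b" for s
  have \<gamma>_der: "(\<gamma> has_derivative (\<lambda>h. h *\<^sub>R \<gamma>' s)) (at s within S)" for s S
  proof -
    have "((\<lambda>s. cos s *\<^sub>R x + sin s *\<^sub>R b) has_derivative (\<lambda>h. h *\<^sub>R ((- sin s) *\<^sub>R x + cos s *\<^sub>R b))) (at s within S)"
      by (rule derivative_eq_intros refl | simp add: algebra_simps)+
    then show ?thesis by (simp add: \<gamma>_def[abs_def] \<gamma>'_def scaleR_eq_smult[symmetric])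
  qed
  have norm_\<gamma>: "norm (\<gamma> s) = 1" for s
  proof -
    have "herm (\<gamma> s) (\<gamma> s) = complex_of_real (cos s) * complex_of_real (cos s)
        + complex_of_real (sin s) * complex_of_real (sin s)"
      by (simp add: \<gamma>_def herm_simps bx xb bb herm_unit[OF x(1)])
    then have "complex_of_real ((norm (\<gamma> s))\<^sup>2) = complex_of_real ((cos s)\<^sup>2 + (sin s)\<^sup>2)"
      by (simp only: herm_self power2_eq_square of_real_add of_real_mult)
    then have "(norm (\<gamma> s))\<^sup>2 = 1" by (simp only: of_real_eq_iff sin_cos_squared_add2)
    then show ?thesis by (simp add: power2_eq_1_iff) (metis norm_ge_zero not_one_le_zero neg_0_le_iff_le)
  qed
  have hor_\<gamma>: "herm (\<gamma>' s) (\<gamma> s) = 0" for s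
    by (simp add: \<gamma>_def \<gamma>'_def herm_simps bx xb bb herm_unit[OF x(1)] mult.commute)
  have near: "dist (\<gamma> s) p < \<delta>" if s: "s \<in> {0..\<theta>}" for s
  proof -
    have "herm (\<gamma> s) x = complex_of_real (cos s)"
      by (simp add: \<gamma>_def herm_simps bx herm_unit[OF x(1)])
    then have "\<gamma> s \<bullet> x = cos s" by (simp add: inner_eq_Re_herm)
    then have "(norm (\<gamma> s - x))\<^sup>2 = 2 - 2 * cos s"
      using norm_\<gamma>[of s] x(1) by (simp add: power2_norm_eq_inner inner_diff_left inner_diff_right
        inner_commute norm_eq_1)
    also have "\<dots> \<le> 2 - 2 * cos \<theta>" using cos_monotone_0_pi_le[of s \<theta>] s \<theta> by simp
    also have "\<dots> = (norm (y - x))\<^sup>2" using dist_xy \<theta>(1) by simp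
    finally have "norm (\<gamma> s - x) \<le> norm (y - x)" by (rule power2_le_imp_le) simp
    then show ?thesis
      using nxy x(2) dist_triangle[of "\<gamma> s" p x] by (simp add: dist_norm)
  qed
  have "\<exists>k. \<forall>s\<in>{0..\<theta>}. f (\<gamma> s) = k"
  proof (rule has_derivative_zero_constant)
    fix s assume s: "s \<in> {0..\<theta>}"
    have fc: "complex_differentiable f (\<gamma> s)" using f near[OF s] by blast
    interpret D: bounded_linear "frechet_derivative f (at (\<gamma> s))"
      using complex_differentiable_derivative(1)[OF fc] by (rule has_derivative_bounded_linear)
    have "((\<lambda>s. f (\<gamma> s)) has_derivative (\<lambda>h. frechet_derivative f (at (\<gamma> s)) (h *\<^sub>R \<gamma>' s))) (at s within {0..\<theta>})"
      using has_derivative_compose[OF \<gamma>_der complex_differentiable_derivative(1)[OF fc]] .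
    moreover have "frechet_derivative f (at (\<gamma> s)) (\<gamma>' s) = 0"
      using hor[OF near[OF s] norm_\<gamma> hor_\<gamma>] .
    ultimately show "((\<lambda>s. f (\<gamma> s)) has_derivative (\<lambda>h. 0)) (at s within {0..\<theta>})"
      by (simp add: D.scaleR)
  qed simp
  moreover have "\<gamma> 0 = x" "\<gamma> \<theta> = y" by (simp_all add: \<gamma>_def y_eq[symmetric])
  ultimately show ?thesis using \<theta>(2) by (metis atLeastAtMost_iff order_refl)
qed simp

lemma norm_smult_unit:
  assumes "norm p = 1" shows "norm (a *s p) = cmod a"
proof -
  have "complex_of_real ((norm (a *s p))\<^sup>2) = a * cnj a"
    unfolding herm_self[symmetric] by (simp add: herm_simps herm_unit[OF assms])
  also have "\<dots> = complex_of_real ((cmod a)\<^sup>2)" by (simp only: complex_norm_square)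
  finally have "(norm (a *s p))\<^sup>2 = (cmod a)\<^sup>2" by (simp only: of_real_eq_iff)
  then show ?thesis by (simp add: power2_eq_iff_nonneg)
qed

text \<open>Horizontal arcs reach every nearby point of the sphere.  Three of them, from \<open>p\<close> by way of two points
  slightly displaced in a direction \<open>e\<close>, lead to a multiple \<open>\<zeta> p\<close>, because the complex tangent spaces do not
  form an integrable distribution; for a suitable phase \<open>\<zeta>\<close> one more arc leads to \<open>z\<close>.\<close>

lemma constant_on_sphere_if_horizontal_derivatives_vanish:
  fixes f :: "complex^'n \<Rightarrow> complex"
  assumes dim: "CARD('n) \<ge> 2" and p: "norm p = 1" and \<delta>: "0 < \<delta>" "\<delta> \<le> 1"
    and f: "\<And>z. dist z p < \<delta> \<Longrightarrow> complex_differentiable f z"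
    and hor: "\<And>z e. dist z p < \<delta> \<Longrightarrow> norm z = 1 \<Longrightarrow> herm e z = 0 \<Longrightarrow> frechet_derivative f (at z) e = 0"
  shows "\<forall>\<^sub>F z in nhds p. norm z = 1 \<longrightarrow> f z = f p"
proof -
  obtain e where e: "norm e = 1" "herm e p = 0" using exists_unit_orthogonal[OF dim] by blast
  have pe: "herm p e = 0" using e(2) cnj_herm[of e p] by simp
  have arc: "f x = f y" if "norm x = 1" "dist x p < \<delta> / 3" "norm y = 1" "dist y p < \<delta> / 3" "herm x y \<in> \<real>" for x y
    by (rule equal_along_horizontal_arc[of p \<delta>, OF _ _ that(1-4) \<delta>(2) that(5)])
       (erule f, erule (2) hor)
  (* With u = \<zeta> p the chain is p, x, y, u, z.  The choice of c and s makes herm (y \<kappa> z) (x z) real. *)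
  define \<zeta> where "\<zeta> z = herm z p / of_real (cmod (herm z p))" for z
  define c where "c z = complex_of_real (1 / sqrt (1 + \<bar>Im (\<zeta> z)\<bar>))" for z
  define s where "s z = complex_of_real (sqrt (\<bar>Im (\<zeta> z)\<bar> / (1 + \<bar>Im (\<zeta> z)\<bar>)))" for z
  define u where "u z = \<zeta> z *s p" for z
  define x where "x z = c z *s p + s z *s e" for z
  define y where "y \<kappa> z = (\<zeta> z * c z) *s p + (\<kappa> * s z) *s e" for \<kappa> z
  have herm_lim: "((\<lambda>z. herm z p) \<longlongrightarrow> 1) (nhds p)"
  proof -
    have "isCont (\<lambda>z. herm z p) p" unfolding herm_def by (intro continuous_intros)
    from isCont_tendsto_nhds[OF this] show ?thesis by (simp add: herm_unit[OF p])
  qed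
  have \<zeta>_lim: "(\<zeta> \<longlongrightarrow> 1) (nhds p)"
  proof -
    have "(\<zeta> \<longlongrightarrow> 1 / of_real (cmod 1)) (nhds p)"
      unfolding \<zeta>_def by (intro tendsto_intros herm_lim) simp
    then show ?thesis by simp
  qed
  have c_lim: "(c \<longlongrightarrow> 1) (nhds p)"
  proof -
    have "(c \<longlongrightarrow> complex_of_real (1 / sqrt (1 + \<bar>Im 1\<bar>))) (nhds p)"
      unfolding c_def by (intro tendsto_intros \<zeta>_lim) simp
    then show ?thesis by simp
  qed
  have s_lim: "(s \<longlongrightarrow> 0) (nhds p)"
  proof -
    have "(s \<longlongrightarrow> complex_of_real (sqrt (\<bar>Im 1\<bar> / (1 + \<bar>Im 1\<bar>)))) (nhds p)"
      unfolding s_def by (intro tendsto_intros \<zeta>_lim) simp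
    then show ?thesis by simp
  qed
  have comb: "((\<lambda>z. \<alpha> z *s p + \<beta> z *s e) \<longlongrightarrow> p) (nhds p)"
    if "(\<alpha> \<longlongrightarrow> 1) (nhds p)" "(\<beta> \<longlongrightarrow> 0) (nhds p)" for \<alpha> \<beta> :: "complex^'n \<Rightarrow> complex"
  proof -
    have "((\<lambda>z. \<alpha> z *s p + \<beta> z *s e) \<longlongrightarrow> 1 *s p + 0 *s e) (nhds p)"
      by (intro tendsto_add bounded_linear.tendsto[OF bounded_linear_smult_left] that)
    then show ?thesis by simp
  qed
  have u_lim: "(u \<longlongrightarrow> p) (nhds p)"
  proof -
    have "(u \<longlongrightarrow> 1 *s p) (nhds p)"
      unfolding u_def by (intro bounded_linear.tendsto[OF bounded_linear_smult_left] \<zeta>_lim)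
    then show ?thesis by simp
  qed
  have x_lim: "(x \<longlongrightarrow> p) (nhds p)" unfolding x_def by (intro comb c_lim s_lim)
  have y_lim: "(y \<kappa> \<longlongrightarrow> p) (nhds p)" for \<kappa>
    unfolding y_def
    by (rule comb) (use tendsto_mult[OF \<zeta>_lim c_lim] tendsto_mult_right_zero[OF s_lim] in auto)
  have d3: "\<delta> / 3 > 0" using \<delta>(1) by simp
  have "\<forall>\<^sub>F z in nhds p. herm z p \<noteq> 0" using tendsto_imp_eventually_ne[OF herm_lim] by simp
  moreover have "\<forall>\<^sub>F z in nhds p. dist z p < \<delta> / 3"
    unfolding eventually_nhds_metric using \<delta> by (intro exI[of _ "\<delta> / 3"]) auto
  moreover have "\<forall>\<^sub>F z in nhds p. dist (u z) p < \<delta> / 3" "\<forall>\<^sub>F z in nhds p. dist (x z) p < \<delta> / 3"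
    "\<forall>\<^sub>F z in nhds p. dist (y \<i> z) p < \<delta> / 3" "\<forall>\<^sub>F z in nhds p. dist (y (-\<i>) z) p < \<delta> / 3"
    using tendstoD[OF u_lim d3] tendstoD[OF x_lim d3] tendstoD[OF y_lim d3] by blast+
  ultimately show ?thesis
  proof (eventually_elim, intro impI)
    fix z
    assume nz: "herm z p \<noteq> 0" and dz: "dist z p < \<delta> / 3" and du: "dist (u z) p < \<delta> / 3"
      and dx: "dist (x z) p < \<delta> / 3" and dy: "dist (y \<i> z) p < \<delta> / 3" "dist (y (-\<i>) z) p < \<delta> / 3"
      and z1: "norm z = 1"
    have \<zeta>1: "cmod (\<zeta> z) = 1" using nz by (simp add: \<zeta>_def norm_divide)
    have \<zeta>\<zeta>: "\<zeta> z * cnj (\<zeta> z) = 1" using \<zeta>1 by (simp add: complex_norm_square[symmetric])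
    have cs: "cmod (c z) ^ 2 + cmod (s z) ^ 2 = 1"
      by (simp add: c_def s_def power_divide norm_divide real_sqrt_divide add_divide_distrib[symmetric])
    have cc: "c z * c z = of_real (1 / (1 + \<bar>Im (\<zeta> z)\<bar>))"
      "s z * s z = of_real (\<bar>Im (\<zeta> z)\<bar> / (1 + \<bar>Im (\<zeta> z)\<bar>))"
      by (simp_all only: c_def s_def of_real_mult[symmetric])
         (simp_all add: real_sqrt_divide)
    have cr: "cnj (c z) = c z" "cnj (s z) = s z" by (simp_all add: c_def s_def)
    have u1: "norm (u z) = 1"
      using norm_orthonormal_combination[OF p e, of "\<zeta> z" 0] \<zeta>1
      by (simp add: u_def power2_eq_1_iff) (metis norm_ge_zero not_one_le_zero neg_0_le_iff_le)
    have x1: "norm (x z) = 1"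
      using norm_orthonormal_combination[OF p e, of "c z" "s z"] cs
      by (simp add: x_def power2_eq_1_iff) (metis norm_ge_zero not_one_le_zero neg_0_le_iff_le)
    define \<kappa> where "\<kappa> = (if Im (\<zeta> z) \<ge> 0 then -\<i> else \<i>)"
    have y1: "norm (y \<kappa> z) = 1"
    proof -
      have "cmod (\<zeta> z * c z) ^ 2 + cmod (\<kappa> * s z) ^ 2 = 1"
        using cs \<zeta>1 by (auto simp: norm_mult \<kappa>_def)
      then show ?thesis
        using norm_orthonormal_combination[OF p e, of "\<zeta> z * c z" "\<kappa> * s z"]
        by (simp add: y_def power2_eq_1_iff) (metis norm_ge_zero not_one_le_zero neg_0_le_iff_le)
    qed
    have dy': "dist (y \<kappa> z) p < \<delta> / 3" using dy by (simp add: \<kappa>_def)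
    have "herm z (u z) = of_real (cmod (herm z p))"
      using nz by (simp add: u_def herm_simps \<zeta>_def complex_norm_square[symmetric] power2_eq_square mult.commute
          flip: complex_norm_square)
    then have 1: "f z = f (u z)" using arc[OF z1 dz u1 du] by auto
    have "herm (u z) (y \<kappa> z) = \<zeta> z * cnj (\<zeta> z) * c z"
      by (simp add: u_def y_def herm_simps herm_unit[OF p] pe cr)
    then have 2: "f (u z) = f (y \<kappa> z)" using arc[OF u1 du y1 dy'] \<zeta>\<zeta> by (simp add: c_def)
    have "herm (y \<kappa> z) (x z) = \<zeta> z * (c z * c z) + \<kappa> * (s z * s z)"
      by (simp add: x_def y_def herm_simps herm_unit[OF p] herm_unit[OF e(1)] pe e(2) cr)
    moreover have "Im (\<zeta> z * (c z * c z) + \<kappa> * (s z * s z)) = 0"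
      unfolding cc by (simp add: \<kappa>_def)
    ultimately have "herm (y \<kappa> z) (x z) \<in> \<real>" by (simp add: complex_is_Real_iff)
    then have 3: "f (y \<kappa> z) = f (x z)" using arc[OF y1 dy' x1 dx] by simp
    have "herm (x z) p = c z" by (simp add: x_def herm_simps herm_unit[OF p] e(2))
    then have 4: "f (x z) = f p" using arc[OF x1 dx p] \<delta>(1) by (simp add: c_def)
    show "f z = f p" using 1 2 3 4 by simp
  qed
qed

text \<open>The complex line through \<open>z\<close> in the direction of \<open>p\<close> meets the sphere in a circle; on that line the identity
  theorem in one variable applies.\<close>

lemma constant_near_if_constant_on_sphere:
  fixes f :: "complex^'n \<Rightarrow> complex"
  assumes p: "norm p = 1" and \<delta>: "0 < \<delta>" "\<delta> \<le> 1" and f: "\<And>z. dist z p < \<delta> \<Longrightarrow> complex_differentiable f z"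
    and const: "\<And>z. dist z p < \<delta> \<Longrightarrow> norm z = 1 \<Longrightarrow> f z = k"
  shows "\<forall>\<^sub>F z in nhds p. f z = k"
proof -
  have "isCont (\<lambda>z. herm z p) p" unfolding herm_def by (intro continuous_intros)
  from isCont_tendsto_nhds[OF this] have herm_lim: "((\<lambda>z. herm z p) \<longlongrightarrow> 1) (nhds p)"
    by (simp add: herm_unit[OF p])
  have y_lim: "((\<lambda>z. z - herm z p *s p) \<longlongrightarrow> 0) (nhds p)"
  proof -
    have "((\<lambda>z. z - herm z p *s p) \<longlongrightarrow> p - 1 *s p) (nhds p)"
      by (intro tendsto_diff bounded_linear.tendsto[OF bounded_linear_smult_left] herm_lim filterlim_ident)
    then show ?thesis by simp
  qed
  have "((\<lambda>z. sqrt (1 - (norm (z - herm z p *s p))\<^sup>2)) \<longlongrightarrow> sqrt (1 - (norm (0::complex^'n))\<^sup>2)) (nhds p)"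
    by (intro tendsto_intros y_lim)
  then have r_lim: "((\<lambda>z. sqrt (1 - (norm (z - herm z p *s p))\<^sup>2)) \<longlongrightarrow> 1) (nhds p)" by simp
  have d2: "\<delta> / 2 > 0" using \<delta>(1) by simp
  have "\<forall>\<^sub>F z in nhds p. dist (herm z p) 1 < \<delta> / 2" "\<forall>\<^sub>F z in nhds p. dist (z - herm z p *s p) 0 < \<delta> / 2"
    "\<forall>\<^sub>F z in nhds p. dist (sqrt (1 - (norm (z - herm z p *s p))\<^sup>2)) 1 < \<delta> / 2"
    using tendstoD[OF herm_lim d2] tendstoD[OF y_lim d2] tendstoD[OF r_lim d2] by blast+
  then show ?thesis
  proof eventually_elim
    case (elim z)
    define w where "w = z - herm z p *s p"
    define R where "R = sqrt (1 - (norm w)\<^sup>2)"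
    have w: "norm w < \<delta> / 2" and R: "\<bar>R - 1\<bar> < \<delta> / 2" and c0: "dist (herm z p) 1 < \<delta> / 2"
      using elim by (auto simp: w_def R_def dist_real_def)
    have wp: "herm w p = 0" by (simp add: w_def herm_simps herm_unit[OF p])
    have Rpos: "R > 0" using R \<delta>(2) by linarith
    have Rball: "complex_of_real R \<in> ball 1 (\<delta> / 2)"
      using R dist_of_real[of 1 R, where 'a = complex] by (simp add: dist_real_def abs_minus_commute)
    have "(norm w)\<^sup>2 \<le> 1"
      using w \<delta>(2) by (simp add: power_le_one)
    then have R2: "R\<^sup>2 = 1 - (norm w)\<^sup>2" by (simp add: R_def)
    have near: "dist (c *s p + 1 *s w) p < \<delta>" if "c \<in> ball 1 (\<delta> / 2)" for c
    proof -
      have "c *s p + 1 *s w - p = (c - 1) *s p + w" by (simp add: vec_eq_iff algebra_simps)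
      moreover have "norm ((c - 1) *s p) = cmod (c - 1)" by (rule norm_smult_unit[OF p])
      ultimately have "norm (c *s p + 1 *s w - p) \<le> cmod (c - 1) + norm w"
        by (metis norm_triangle_ineq)
      then show ?thesis using that w by (simp add: dist_norm norm_minus_commute)
    qed
    let ?\<phi> = "\<lambda>c. f (c *s p + 1 *s w) - k"
    have hol: "?\<phi> holomorphic_on ball 1 (\<delta> / 2)"
      by (intro holomorphic_intros holomorphic_on_plane f near) auto
    define U where "U = {c \<in> ball 1 (\<delta> / 2). cmod c = R}"
    have zeroU: "?\<phi> c = 0" if "c \<in> U" for c
    proof -
      have "(norm (c *s p + 1 *s w))\<^sup>2 = 1"
      proof -
        have pw: "herm p w = 0" using wp cnj_herm[of w p] by simp
        have "complex_of_real ((norm (c *s p + 1 *s w))\<^sup>2) = c * cnj c + complex_of_real ((norm w)\<^sup>2)"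
          unfolding herm_self[symmetric] by (simp add: herm_simps herm_unit[OF p] wp pw)
        also have "\<dots> = complex_of_real ((cmod c)\<^sup>2 + (norm w)\<^sup>2)"
          by (simp only: complex_norm_square of_real_add)
        finally have "(norm (c *s p + 1 *s w))\<^sup>2 = (cmod c)\<^sup>2 + (norm w)\<^sup>2" by (simp only: of_real_eq_iff)
        then show ?thesis using that R2 by (simp add: U_def)
      qed
      then have "norm (c *s p + 1 *s w) = 1"
        by (metis norm_ge_zero power2_eq_1_iff not_one_le_zero neg_0_le_iff_le)
      then show ?thesis using const[OF near] that by (auto simp: U_def)
    qed
    have lim: "complex_of_real R islimpt U"
    proof -
      have "isCont (\<lambda>t. complex_of_real R * cis t) 0"
        unfolding cis_conv_exp by (intro continuous_intros)
      then have "((\<lambda>t. complex_of_real R * cis t) \<longlongrightarrow> complex_of_real R) (at 0)"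
        by (simp add: isCont_def)
      then have lim: "((\<lambda>t. complex_of_real R * cis t) \<longlongrightarrow> complex_of_real R) (at_right 0)"
        by (rule tendsto_mono[OF at_le[OF subset_UNIV]])
      show ?thesis
        unfolding islimpt_approachable
      proof (intro allI impI)
        fix \<epsilon> :: real assume \<epsilon>: "\<epsilon> > 0"
        have "\<forall>\<^sub>F t in at_right 0. dist (complex_of_real R * cis t) (complex_of_real R) < \<epsilon>"
          using lim \<epsilon> by (rule tendstoD)
        moreover have "\<forall>\<^sub>F t in at_right 0. complex_of_real R * cis t \<in> ball 1 (\<delta> / 2)"
          using lim Rball by (intro topological_tendstoD) auto
        moreover have "\<forall>\<^sub>F t in at_right (0::real). 0 < t \<and> t < pi"
          using eventually_at_right_real[OF pi_gt_zero] by eventually_elim simp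
        ultimately have "\<forall>\<^sub>F t in at_right (0::real). \<exists>x'\<in>U. x' \<noteq> complex_of_real R \<and> dist x' (complex_of_real R) < \<epsilon>"
        proof eventually_elim
          case (elim t)
          have "sin t > 0" using elim by (intro sin_gt_zero) auto
          then have "Im (complex_of_real R * cis t) \<noteq> 0" using Rpos by simp
          then have "complex_of_real R * cis t \<noteq> complex_of_real R" by (metis Im_complex_of_real)
          moreover have "complex_of_real R * cis t \<in> U"
            using elim Rpos by (simp add: U_def norm_mult)
          ultimately show ?case using elim by blast
        qed
        then show "\<exists>x'\<in>U. x' \<noteq> complex_of_real R \<and> dist x' (complex_of_real R) < \<epsilon>"
          by (simp add: eventually_const trivial_limit_at_right_real)
      qed
    qed
    have "?\<phi> (herm z p) = 0"
    proof (rule analytic_continuation[OF hol _ _ _ _ lim zeroU])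
      show "complex_of_real R \<in> ball 1 (\<delta> / 2)" by (rule Rball)
      show "herm z p \<in> ball 1 (\<delta> / 2)" using c0 by (simp add: dist_commute)
    qed (auto simp: U_def)
    moreover have "herm z p *s p + 1 *s w = z" by (simp add: w_def)
    ultimately show ?case by simp
  qed
qed

lemma nonconstant_imp_horizontal_derivative:
  fixes f :: "complex^'n \<Rightarrow> complex"
  assumes dim: "CARD('n) \<ge> 2" and p: "norm p = 1" and \<delta>: "0 < \<delta>"
    and f: "\<forall>\<^sub>F z in nhds p. complex_differentiable f z" and nonconst: "\<not> (\<forall>\<^sub>F z in nhds p. f z = f p)"
  shows "\<exists>z e. dist z p < \<delta> \<and> norm z = 1 \<and> norm e = 1 \<and> herm e z = 0 \<and> frechet_derivative f (at z) e \<noteq> 0"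
proof (rule ccontr)
  assume contra: "\<not> ?thesis"
  obtain d0 where d0: "d0 > 0" "\<And>z. dist z p < d0 \<Longrightarrow> complex_differentiable f z"
    using f unfolding eventually_nhds_metric by blast
  define d where "d = min (min d0 \<delta>) 1"
  have d: "0 < d" "d \<le> 1" "d \<le> d0" "d \<le> \<delta>" using d0(1) \<delta> by (auto simp: d_def)
  have hol: "complex_differentiable f z" if "dist z p < d" for z using d0(2) that d by auto
  have hor: "frechet_derivative f (at z) e = 0" if z: "dist z p < d" "norm z = 1" "herm e z = 0" for z e
  proof (cases "e = 0")
    case True
    then show ?thesis using complex_differentiable_derivative(2)[OF hol[OF z(1)], of 0 e] by simp
  next
    case False
    let ?e = "inverse (norm e) *\<^sub>R e"
    have e1: "norm ?e = 1" using False by simp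
    have e2: "herm ?e z = 0" unfolding scaleR_eq_smult herm_simps z(3) by simp
    have zd: "dist z p < \<delta>" using z(1) d(4) by linarith
    have "frechet_derivative f (at z) ?e = 0"
    proof (rule ccontr)
      assume nz: "frechet_derivative f (at z) ?e \<noteq> 0"
      have "\<exists>z e. dist z p < \<delta> \<and> norm z = 1 \<and> norm e = 1 \<and> herm e z = 0 \<and> frechet_derivative f (at z) e \<noteq> 0"
        by (intro exI[of _ z] exI[of _ ?e] conjI zd z(2) e1 e2 nz)
      with contra show False by contradiction
    qed
    then have "of_real (inverse (norm e)) * frechet_derivative f (at z) e = 0"
      unfolding scaleR_eq_smult complex_differentiable_derivative(2)[OF hol[OF z(1)]] .
    then show ?thesis using False by simp
  qed
  have "\<forall>\<^sub>F z in nhds p. norm z = 1 \<longrightarrow> f z = f p"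
    by (rule constant_on_sphere_if_horizontal_derivatives_vanish[OF dim p d(1,2)])
       (erule hol, erule (2) hor)
  then obtain d1 where d1: "d1 > 0" "\<And>z. dist z p < d1 \<Longrightarrow> norm z = 1 \<Longrightarrow> f z = f p"
    unfolding eventually_nhds_metric by blast
  have "\<forall>\<^sub>F z in nhds p. f z = f p"
  proof (rule constant_near_if_constant_on_sphere[OF p, of "min d d1"])
    show "0 < min d d1" "min d d1 \<le> 1" using d d1(1) by auto
    show "complex_differentiable f z" if "dist z p < min d d1" for z using that by (intro hol) simp
    show "f z = f p" if "dist z p < min d d1" "norm z = 1" for z using that by (intro d1(2)) simp_all
  qed
  then show False using nonconst by blast
qed

section \<open>Polarization in a chart of the sphere\<close>

text \<open>Holomorphic in the first and antiholomorphic in the second argument, expressed by substitution of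
  holomorphic curves, which is the only use that is made of it.\<close>

definition sesquiholomorphic :: "(complex^'m \<Rightarrow> complex^'m \<Rightarrow> complex) \<Rightarrow> bool" where
  "sesquiholomorphic R \<longleftrightarrow> (\<forall>S X Y. open S \<longrightarrow> (\<forall>\<mu>. (\<lambda>\<xi>. X \<xi> $ \<mu>) holomorphic_on S) \<longrightarrow>
     (\<forall>\<mu>. (\<lambda>\<xi>. cnj (Y \<xi> $ \<mu>)) holomorphic_on S) \<longrightarrow> (\<lambda>\<xi>. R (X \<xi>) (Y \<xi>)) holomorphic_on S)"

text \<open>The Cayley transform of the Heisenberg hypersurface \<open>Im w = \<bar>A\<bar>\<^sup>2\<close>, whose origin goes to \<open>p\<close>.  For \<open>b = 1\<close> it
  is composed with an automorphism that fixes the origin and tilts the transverse direction; if a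
  function has a nonzero derivative at \<open>p\<close> in the direction \<open>e\<close>, then in one of the two charts it also has a
  nonzero transverse derivative.\<close>

definition chart_denominator :: "complex \<Rightarrow> complex \<Rightarrow> complex \<Rightarrow> complex" where
  "chart_denominator b A w = 1 - 2 * \<i> * b * A - \<i> * b * w"

definition chart :: "complex \<Rightarrow> complex^'n \<Rightarrow> complex^'n \<Rightarrow> complex \<Rightarrow> complex \<Rightarrow> complex^'n" where
  "chart b p e A w =
     ((chart_denominator b A w + \<i> * w) / (chart_denominator b A w - \<i> * w)) *s p +
     (2 * (A + b * w) / (chart_denominator b A w - \<i> * w)) *s e"

lemma chart_0 [simp]: "chart b p e 0 0 = p"
  by (simp add: chart_def chart_denominator_def)

lemma norm_chart:
  assumes pe: "norm p = 1" "norm e = 1" "herm e p = 0" and b: "b = 0 \<or> b = 1"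
    and w: "Im w = (cmod A)\<^sup>2" and nz: "chart_denominator b A w - \<i> * w \<noteq> 0"
  shows "norm (chart b p e A w) = 1"
proof -
  let ?D = "chart_denominator b A w"
  have "w = Complex (Re w) ((Re A)\<^sup>2 + (Im A)\<^sup>2)" using w by (simp add: complex_eq_iff cmod_power2)
  then obtain u where u: "w = Complex u ((Re A)\<^sup>2 + (Im A)\<^sup>2)" by blast
  obtain x y where A: "A = Complex x y" by (cases A)
  have "(cmod (?D + \<i> * w))\<^sup>2 + (cmod (2 * (A + b * w)))\<^sup>2 = (cmod (?D - \<i> * w))\<^sup>2"
    unfolding cmod_power2 using b
    by (elim disjE) (simp_all add: chart_denominator_def u A power2_eq_square algebra_simps)
  then have "(cmod ((?D + \<i> * w) / (?D - \<i> * w)))\<^sup>2 + (cmod (2 * (A + b * w) / (?D - \<i> * w)))\<^sup>2 = 1"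
    using nz by (simp only: norm_divide power_divide add_divide_distrib[symmetric]) simp
  then have "(norm (chart b p e A w))\<^sup>2 = 1"
    unfolding chart_def norm_orthonormal_combination[OF pe] .
  then show ?thesis by (metis norm_ge_zero power2_eq_1_iff not_one_le_zero neg_0_le_iff_le)
qed

lemma chart_near:
  assumes "\<delta> > 0"
  shows "\<exists>r>0. \<forall>A w. cmod A < r \<longrightarrow> cmod w < r \<longrightarrow>
    chart_denominator b A w - \<i> * w \<noteq> 0 \<and> dist (chart b p e A w) p < \<delta>"
proof -
  let ?d = "\<lambda>z. chart_denominator b (fst z) (snd z) - \<i> * snd z"
  have d: "isCont ?d 0" unfolding chart_denominator_def by (intro continuous_intros)
  have d0: "?d 0 \<noteq> 0" by (simp add: chart_denominator_def)
  have n1: "isCont (\<lambda>z. chart_denominator b (fst z) (snd z) + \<i> * snd z) 0"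
    unfolding chart_denominator_def by (intro continuous_intros)
  have n2: "isCont (\<lambda>z. 2 * (fst z + b * snd z)) 0" by (intro continuous_intros)
  have "isCont (\<lambda>z. chart b p e (fst z) (snd z)) 0"
    unfolding chart_def
    by (intro continuous_add bounded_linear.continuous[OF bounded_linear_smult_left]
        isCont_divide n1 n2 d d0)
  from isCont_tendsto_nhds[OF this] have lim: "((\<lambda>z. chart b p e (fst z) (snd z)) \<longlongrightarrow> p) (nhds 0)"
    by simp
  have "\<forall>\<^sub>F z in nhds 0. dist (chart b p e (fst z) (snd z)) p < \<delta>" "\<forall>\<^sub>F z in nhds 0. ?d z \<noteq> 0"
    using tendstoD[OF lim assms] tendsto_imp_eventually_ne[OF isCont_tendsto_nhds[OF d] d0] by blast+
  then have "\<forall>\<^sub>F z in nhds 0. dist (chart b p e (fst z) (snd z)) p < \<delta> \<and> ?d z \<noteq> 0"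
    by eventually_elim simp
  then obtain r where r: "r > 0" "\<And>z. dist z 0 < r \<Longrightarrow> dist (chart b p e (fst z) (snd z)) p < \<delta> \<and> ?d z \<noteq> 0"
    unfolding eventually_nhds_metric by blast
  have "dist (A, w) 0 < r" if "cmod A < r / 2" "cmod w < r / 2" for A w :: complex
    using that norm_Pair_le[of A w] by (simp add: zero_prod_def[symmetric])
  then show ?thesis using r by (intro exI[of _ "r / 2"]) fastforce
qed

lemma holomorphic_on_chart:
  assumes S: "open S" and f: "\<And>z. dist z p < \<delta> \<Longrightarrow> complex_differentiable f z"
    and near: "\<And>A w. cmod A < r \<Longrightarrow> cmod w < r \<Longrightarrow>
      chart_denominator b A w - \<i> * w \<noteq> 0 \<and> dist (chart b p e A w) p < \<delta>"
    and \<alpha>: "\<alpha> holomorphic_on S" "\<And>\<xi>. \<xi> \<in> S \<Longrightarrow> cmod (\<alpha> \<xi>) < r"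
    and \<beta>: "\<beta> holomorphic_on S" "\<And>\<xi>. \<xi> \<in> S \<Longrightarrow> cmod (\<beta> \<xi>) < r"
  shows "(\<lambda>\<xi>. f (chart b p e (\<alpha> \<xi>) (\<beta> \<xi>))) holomorphic_on S"
  unfolding chart_def
proof (rule holomorphic_on_plane[OF S])
  show "complex_differentiable f (((chart_denominator b (\<alpha> \<xi>) (\<beta> \<xi>) + \<i> * \<beta> \<xi>) /
      (chart_denominator b (\<alpha> \<xi>) (\<beta> \<xi>) - \<i> * \<beta> \<xi>)) *s p +
     (2 * (\<alpha> \<xi> + b * \<beta> \<xi>) / (chart_denominator b (\<alpha> \<xi>) (\<beta> \<xi>) - \<i> * \<beta> \<xi>)) *s e)" if "\<xi> \<in> S" for \<xi>
    using f near[OF \<alpha>(2)[OF that] \<beta>(2)[OF that]] by (simp add: chart_def)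
  have nz: "chart_denominator b (\<alpha> \<xi>) (\<beta> \<xi>) - \<i> * \<beta> \<xi> \<noteq> 0" if "\<xi> \<in> S" for \<xi>
    using near[OF \<alpha>(2)[OF that] \<beta>(2)[OF that]] by simp
  have den: "(\<lambda>\<xi>. chart_denominator b (\<alpha> \<xi>) (\<beta> \<xi>)) holomorphic_on S"
    unfolding chart_denominator_def by (intro holomorphic_intros \<alpha> \<beta>)
  show "(\<lambda>\<xi>. (chart_denominator b (\<alpha> \<xi>) (\<beta> \<xi>) + \<i> * \<beta> \<xi>) /
      (chart_denominator b (\<alpha> \<xi>) (\<beta> \<xi>) - \<i> * \<beta> \<xi>)) holomorphic_on S"
    by (intro holomorphic_intros den \<beta> nz)
  show "(\<lambda>\<xi>. 2 * (\<alpha> \<xi> + b * \<beta> \<xi>) / (chart_denominator b (\<alpha> \<xi>) (\<beta> \<xi>) - \<i> * \<beta> \<xi>)) holomorphic_on S"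
    by (intro holomorphic_intros den \<alpha> \<beta> nz)
qed

lemma holomorphic_zero_on_reals:
  assumes g: "g holomorphic_on ball 0 r" and real: "\<And>x. \<bar>x\<bar> < r \<Longrightarrow> g (complex_of_real x) = 0"
    and z: "cmod z < r"
  shows "g z = 0"
proof (rule analytic_continuation[OF g, where U = "complex_of_real ` {-r<..<r}"])
  have r: "r > 0" using z by (meson le_less_trans norm_ge_zero)
  show "0 islimpt complex_of_real ` {- r<..<r}"
    unfolding islimpt_approachable
  proof (intro allI impI)
    fix \<epsilon> :: real assume "\<epsilon> > 0"
    define x where "x = min \<epsilon> r / 2"
    have "0 < x" "x < r" "x < \<epsilon>" using r \<open>\<epsilon> > 0\<close> by (auto simp: x_def)
    then have "complex_of_real x \<in> complex_of_real ` {- r<..<r}"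
      "complex_of_real x \<noteq> 0" "dist (complex_of_real x) 0 < \<epsilon>"
      by auto
    then show "\<exists>x'\<in>complex_of_real ` {- r<..<r}. x' \<noteq> 0 \<and> dist x' 0 < \<epsilon>" by blast
  qed
  show "complex_of_real ` {- r<..<r} \<subseteq> ball 0 r" "0 \<in> ball (0::complex) r" "z \<in> ball 0 r"
    using r z by auto
  show "g z = 0" if "z \<in> complex_of_real ` {- r<..<r}" for z using that real by auto
qed auto

text \<open>With \<open>s = (A + cnj A') / 2\<close>, \<open>t = (A - cnj A') / (2 \<i>)\<close> and \<open>u = w - \<i> A cnj A'\<close>, the polarized hypersurface
  is parametrized by three complex variables, and their real values correspond to the hypersurface itself.
  The identity theorem is applied to one variable at a time.\<close>

lemma polarized_equation_in_chart:
  fixes H :: "complex^'n \<Rightarrow> complex^'m"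
  assumes R: "sesquiholomorphic R" and pe: "norm p = 1" "norm e = 1" "herm e p = 0"
    and b: "b = 0 \<or> b = 1" and \<delta>: "\<delta> > 0"
    and H: "\<And>z \<mu>. dist z p < \<delta> \<Longrightarrow> complex_differentiable (\<lambda>z. H z $ \<mu>) z"
    and zero: "\<And>z. dist z p < \<delta> \<Longrightarrow> norm z = 1 \<Longrightarrow> R (H z) (H z) = 0"
  shows "\<exists>r>0. \<forall>A w A' w'. cmod A < r \<longrightarrow> cmod w < r \<longrightarrow> cmod A' < r \<longrightarrow> cmod w' < r \<longrightarrow>
    w - cnj w' = 2 * \<i> * A * cnj A' \<longrightarrow> R (H (chart b p e A w)) (H (chart b p e A' w')) = 0"
proof -
  obtain r0 where r0: "r0 > 0" and near: "\<And>A w. cmod A < r0 \<Longrightarrow> cmod w < r0 \<Longrightarrow>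
      chart_denominator b A w - \<i> * w \<noteq> 0 \<and> dist (chart b p e A w) p < \<delta>"
    using chart_near[OF \<delta>] by blast
  define r1 where "r1 = min 1 (r0 / 4)"
  have r1: "0 < r1" "r1 \<le> 1" "4 * r1 \<le> r0" using r0 by (auto simp: r1_def)
  define K where "K s t u = R (H (chart b p e (s + \<i> * t) (u + \<i> * (s\<^sup>2 + t\<^sup>2))))
      (H (chart b p e (cnj (s - \<i> * t)) (cnj (u - \<i> * (s\<^sup>2 + t\<^sup>2)))))" for s t u
  have small: "cmod (s + \<i> * t) < r0" "cmod (s - \<i> * t) < r0"
      "cmod (u + \<i> * (s\<^sup>2 + t\<^sup>2)) < r0" "cmod (u - \<i> * (s\<^sup>2 + t\<^sup>2)) < r0"
    if "cmod s < r1" "cmod t < r1" "cmod u < r1" for s t u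
  proof -
    have sq: "cmod (x\<^sup>2) < r1" if "cmod x < r1" for x
    proof -
      have "cmod (x\<^sup>2) \<le> cmod x * 1"
        unfolding power2_eq_square norm_mult using that r1(2) by (intro mult_left_mono) auto
      then show ?thesis using that by simp
    qed
    have "cmod (\<i> * t) < r1" using that by (simp add: norm_mult)
    moreover have "cmod (\<i> * (s\<^sup>2 + t\<^sup>2)) < 2 * r1"
      using norm_triangle_ineq[of "s\<^sup>2" "t\<^sup>2"] sq[OF that(1)] sq[OF that(2)] by (simp add: norm_mult)
    ultimately show "cmod (s + \<i> * t) < r0" "cmod (s - \<i> * t) < r0"
      "cmod (u + \<i> * (s\<^sup>2 + t\<^sup>2)) < r0" "cmod (u - \<i> * (s\<^sup>2 + t\<^sup>2)) < r0"
      using that r1 norm_triangle_ineq[of s "\<i> * t"] norm_triangle_ineq4[of s "\<i> * t"]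
        norm_triangle_ineq[of u "\<i> * (s\<^sup>2 + t\<^sup>2)"] norm_triangle_ineq4[of u "\<i> * (s\<^sup>2 + t\<^sup>2)"]
      by linarith+
  qed
  have hol: "(\<lambda>\<xi>. K (\<sigma> \<xi>) (\<tau> \<xi>) (\<upsilon> \<xi>)) holomorphic_on ball 0 r1"
    if h: "\<sigma> holomorphic_on ball 0 r1" "\<tau> holomorphic_on ball 0 r1" "\<upsilon> holomorphic_on ball 0 r1"
      and bd: "\<And>\<xi>. \<xi> \<in> ball 0 r1 \<Longrightarrow> cmod (\<sigma> \<xi>) < r1" "\<And>\<xi>. \<xi> \<in> ball 0 r1 \<Longrightarrow> cmod (\<tau> \<xi>) < r1"
        "\<And>\<xi>. \<xi> \<in> ball 0 r1 \<Longrightarrow> cmod (\<upsilon> \<xi>) < r1" for \<sigma> \<tau> \<upsilon>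
  proof -
    have 1: "(\<lambda>\<xi>. H (chart b p e (\<sigma> \<xi> + \<i> * \<tau> \<xi>) (\<upsilon> \<xi> + \<i> * ((\<sigma> \<xi>)\<^sup>2 + (\<tau> \<xi>)\<^sup>2))) $ \<mu>)
        holomorphic_on ball 0 r1" for \<mu>
      by (rule holomorphic_on_chart[where f = "\<lambda>z. H z $ \<mu>" and r = r0 and \<delta> = \<delta>])
         (auto intro!: holomorphic_intros h small bd H dest: near)
    have 2: "(\<lambda>\<xi>. cnj (H (chart b p e (cnj (\<sigma> \<xi> - \<i> * \<tau> \<xi>)) (cnj (\<upsilon> \<xi> - \<i> * ((\<sigma> \<xi>)\<^sup>2 + (\<tau> \<xi>)\<^sup>2)))) $ \<mu>))
        holomorphic_on ball 0 r1" for \<mu>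
    proof -
      let ?\<alpha> = "\<lambda>\<xi>. \<sigma> \<xi> - \<i> * \<tau> \<xi>" and ?\<beta> = "\<lambda>\<xi>. \<upsilon> \<xi> - \<i> * ((\<sigma> \<xi>)\<^sup>2 + (\<tau> \<xi>)\<^sup>2)"
      let ?g = "\<lambda>\<eta>. H (chart b p e ((cnj \<circ> ?\<alpha> \<circ> cnj) \<eta>) ((cnj \<circ> ?\<beta> \<circ> cnj) \<eta>)) $ \<mu>"
      have cb: "cnj ` ball 0 r1 = ball 0 r1"
      proof -
        have "x \<in> cnj ` ball 0 r1" if "cmod x < r1" for x
          using that by (intro image_eqI[of _ _ "cnj x"]) auto
        then show ?thesis by auto
      qed
      have "?\<alpha> holomorphic_on cnj ` ball 0 r1" "?\<beta> holomorphic_on cnj ` ball 0 r1"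
        unfolding cb by (intro holomorphic_intros h)+
      then have c: "cnj \<circ> ?\<alpha> \<circ> cnj holomorphic_on ball 0 r1" "cnj \<circ> ?\<beta> \<circ> cnj holomorphic_on ball 0 r1"
        by (simp_all only: holomorphic_on_compose_cnj_cnj open_ball)
      have "?g holomorphic_on ball 0 r1"
      proof (rule holomorphic_on_chart[where f = "\<lambda>z. H z $ \<mu>" and r = r0 and \<delta> = \<delta>
            and \<alpha> = "cnj \<circ> ?\<alpha> \<circ> cnj" and \<beta> = "cnj \<circ> ?\<beta> \<circ> cnj"])
        fix \<xi> :: complex assume "\<xi> \<in> ball 0 r1"
        then have "cnj \<xi> \<in> ball 0 r1" by simp
        then show "cmod ((cnj \<circ> ?\<alpha> \<circ> cnj) \<xi>) < r0" "cmod ((cnj \<circ> ?\<beta> \<circ> cnj) \<xi>) < r0"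
          unfolding comp_def complex_mod_cnj
          using small[OF bd(1)[OF \<open>cnj \<xi> \<in> _\<close>] bd(2)[OF \<open>cnj \<xi> \<in> _\<close>] bd(3)[OF \<open>cnj \<xi> \<in> _\<close>]]
          by blast+
      next
        show "cnj \<circ> ?\<alpha> \<circ> cnj holomorphic_on ball 0 r1" "cnj \<circ> ?\<beta> \<circ> cnj holomorphic_on ball 0 r1"
          by (rule c)+
        show "complex_differentiable (\<lambda>z. H z $ \<mu>) z" if "dist z p < \<delta>" for z using that by (rule H)
        show "chart_denominator b A w - \<i> * w \<noteq> 0 \<and> dist (chart b p e A w) p < \<delta>"
          if "cmod A < r0" "cmod w < r0" for A w using that by (rule near)
      qed simp
      then have "?g holomorphic_on cnj ` ball 0 r1" unfolding cb .
      then have "cnj \<circ> ?g \<circ> cnj holomorphic_on ball 0 r1"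
        by (simp only: holomorphic_on_compose_cnj_cnj open_ball)
      then show ?thesis by (simp add: comp_def)
    qed
    have 3: "(\<forall>\<mu>. (\<lambda>\<xi>. X \<xi> $ \<mu>) holomorphic_on ball 0 r1) \<Longrightarrow>
      (\<forall>\<mu>. (\<lambda>\<xi>. cnj (Y \<xi> $ \<mu>)) holomorphic_on ball 0 r1) \<Longrightarrow> (\<lambda>\<xi>. R (X \<xi>) (Y \<xi>)) holomorphic_on ball 0 r1" for X Y
      using R unfolding sesquiholomorphic_def by (metis open_ball)
    show ?thesis unfolding K_def by (rule 3) (use 1 2 in blast)+
  qed
  have real3: "K (of_real s) (of_real t) (of_real u) = 0" if "\<bar>s\<bar> < r1" "\<bar>t\<bar> < r1" "\<bar>u\<bar> < r1" for s t u :: real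
  proof -
    let ?A = "of_real s + \<i> * of_real t" and ?w = "of_real u + \<i> * ((of_real s)\<^sup>2 + (of_real t)\<^sup>2)"
    have eq: "cnj (of_real s - \<i> * of_real t) = ?A"
      "cnj (of_real u - \<i> * ((of_real s)\<^sup>2 + (of_real t)\<^sup>2)) = ?w" by simp_all
    have s: "cmod ?A < r0" "cmod ?w < r0" using small[of "of_real s" "of_real t" "of_real u"] that by auto
    have "Im ?w = (cmod ?A)\<^sup>2" by (simp add: cmod_power2 flip: of_real_power)
    then have "norm (chart b p e ?A ?w) = 1" using norm_chart[OF pe b] near[OF s] by blast
    then show ?thesis unfolding K_def eq using zero near[OF s] by blast
  qed
  have real2: "K (of_real s) (of_real t) u = 0" if "\<bar>s\<bar> < r1" "\<bar>t\<bar> < r1" "cmod u < r1" for s t :: real and u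
  proof (rule holomorphic_zero_on_reals[where g = "\<lambda>u. K (of_real s) (of_real t) u", OF _ _ that(3)])
    show "(\<lambda>u. K (of_real s) (of_real t) u) holomorphic_on ball 0 r1"
      using that by (intro hol holomorphic_intros) auto
  qed (use real3 that in blast)
  have real1: "K (of_real s) t u = 0" if "\<bar>s\<bar> < r1" "cmod t < r1" "cmod u < r1" for s :: real and t u
  proof (rule holomorphic_zero_on_reals[where g = "\<lambda>t. K (of_real s) t u", OF _ _ that(2)])
    show "(\<lambda>t. K (of_real s) t u) holomorphic_on ball 0 r1"
      using that by (intro hol holomorphic_intros) auto
  qed (use real2 that in blast)
  have K0: "K s t u = 0" if "cmod s < r1" "cmod t < r1" "cmod u < r1" for s t u
  proof (rule holomorphic_zero_on_reals[where g = "\<lambda>s. K s t u", OF _ _ that(1)])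
    show "(\<lambda>s. K s t u) holomorphic_on ball 0 r1"
      using that by (intro hol holomorphic_intros) auto
  qed (use real1 that in blast)
  show ?thesis
  proof (intro exI[of _ "r1 / 2"] conjI allI impI)
    show "0 < r1 / 2" using r1 by simp
    fix A w A' w'
    assume A: "cmod A < r1 / 2" and w: "cmod w < r1 / 2" and A': "cmod A' < r1 / 2" and w': "cmod w' < r1 / 2"
      and eq: "w - cnj w' = 2 * \<i> * A * cnj A'"
    define s t u where "s = (A + cnj A') / 2" and "t = (A - cnj A') / (2 * \<i>)" and "u = w - \<i> * A * cnj A'"
    have st: "s + \<i> * t = A" "s - \<i> * t = cnj A'" "s\<^sup>2 + t\<^sup>2 = A * cnj A'"
      by (simp_all add: s_def t_def field_simps power2_eq_square)
    have u: "u + \<i> * (A * cnj A') = w" "u - \<i> * (A * cnj A') = cnj w'"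
      using eq by (simp_all add: u_def algebra_simps)
    have "cmod s < r1" "cmod t < r1"
      using A A' r1(1) norm_triangle_ineq[of A "cnj A'"] norm_triangle_ineq4[of A "cnj A'"]
      by (simp_all add: s_def t_def norm_divide norm_mult)
    moreover have "cmod u < r1"
    proof -
      have "cmod A * cmod A' \<le> (r1 / 2) * 1"
        using A A' r1 by (intro mult_mono) auto
      then show ?thesis
        using w norm_triangle_ineq4[of w "\<i> * A * cnj A'"] by (simp add: u_def norm_mult)
    qed
    ultimately have "K s t u = 0" by (rule K0)
    then show "R (H (chart b p e A w)) (H (chart b p e A' w')) = 0"
      unfolding K_def st u by simp
  qed
qed

section \<open>Nodes with many incidences\<close>

text \<open>By the Cauchy inequality the derivative of \<open>F A\<close> stays close to that of \<open>F 0\<close> at the origin, so that \<open>F A\<close> is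
  injective on a disc that does not depend on \<open>A\<close>.\<close>

lemma injective_in_second_variable:
  fixes F :: "complex \<Rightarrow> complex \<Rightarrow> complex"
  assumes r: "r > 0" and hol: "\<And>A. cmod A < r \<Longrightarrow> F A holomorphic_on ball 0 r"
    and cont: "continuous_on (ball 0 r \<times> ball 0 r) (\<lambda>z. F (fst z) (snd z))"
    and nz: "deriv (F 0) 0 \<noteq> 0"
  shows "\<exists>d>0. \<forall>A w w'. cmod A < d \<longrightarrow> cmod w < d \<longrightarrow> cmod w' < d \<longrightarrow> F A w = F A w' \<longrightarrow> w = w'"
proof -
  define \<phi> where "\<phi> = deriv (F 0) 0"
  define Q where "Q = cball (0::complex) (r / 2) \<times> cball (0::complex) (r / 2)"
  have Q: "compact Q" "Q \<subseteq> ball 0 r \<times> ball 0 r" using r by (auto simp: Q_def intro: compact_Times)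
  have uc: "uniformly_continuous_on Q (\<lambda>z. F (fst z) (snd z))"
    by (rule compact_uniformly_continuous[OF continuous_on_subset[OF cont Q(2)] Q(1)])
  have "cmod \<phi> * r / 8 > 0" using nz r by (simp add: \<phi>_def)
  from uc[unfolded uniformly_continuous_on_def, THEN spec, THEN mp, OF this]
  obtain d where d: "d > 0" and uc: "\<forall>z\<in>Q. \<forall>z'\<in>Q. dist z' z < d \<longrightarrow>
      dist (F (fst z') (snd z')) (F (fst z) (snd z)) < cmod \<phi> * r / 8"
    by (elim exE conjE)
  define d' where "d' = min (d / 2) (r / 4)"
  have d': "d' > 0" "d' \<le> d / 2" "d' \<le> r / 4" using d r by (auto simp: d'_def)
  have der: "cmod (deriv (F A) w - \<phi>) \<le> cmod \<phi> / 2" if A: "cmod A < d'" and w: "cmod w < d'" for A w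
  proof -
    let ?g = "\<lambda>\<zeta>. F A (w + \<zeta>) - F 0 \<zeta>"
    have Ar: "cmod A < r" using A d'(3) r by simp
    have wr: "cmod (w + \<zeta>) \<le> r / 2" if "cmod \<zeta> \<le> r / 4" for \<zeta>
      using that w d'(3) norm_triangle_ineq[of w \<zeta>] by simp
    have sub: "(+) w ` ball 0 (r / 2) \<subseteq> ball 0 r"
    proof (rule image_subsetI)
      fix y :: complex assume "y \<in> ball 0 (r / 2)"
      then show "w + y \<in> ball 0 r" using norm_triangle_ineq[of w y] w d'(3) r by simp
    qed
    have h1: "(\<lambda>\<zeta>. F A (w + \<zeta>)) holomorphic_on ball 0 (r / 2)"
    proof -
      have "(\<lambda>\<zeta>. w + \<zeta>) holomorphic_on ball 0 (r / 2)" by (intro holomorphic_intros)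
      from holomorphic_on_compose_gen[OF this hol[OF Ar] sub] show ?thesis by (simp add: comp_def)
    qed
    have h2: "F 0 holomorphic_on ball 0 (r / 2)"
      using hol[of 0] r by (auto intro: holomorphic_on_subset)
    have g: "?g holomorphic_on ball 0 (r / 2)" by (intro holomorphic_intros h1 h2)
    have "cmod ((deriv ^^ 1) ?g 0) \<le> fact 1 * (cmod \<phi> * r / 8) / (r / 4) ^ 1"
    proof (rule Cauchy_inequality)
      show "?g holomorphic_on ball 0 (r / 4)" using r by (intro holomorphic_on_subset[OF g]) auto
      show "continuous_on (cball 0 (r / 4)) ?g"
        using r by (intro holomorphic_on_imp_continuous_on holomorphic_on_subset[OF g]) auto
      show "0 < r / 4" using r by simp
      fix \<zeta> :: complex assume "cmod (0 - \<zeta>) = r / 4"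
      then have \<zeta>: "cmod \<zeta> = r / 4" by simp
      have "(A, w + \<zeta>) \<in> Q" "(0, \<zeta>) \<in> Q"
        using wr[of \<zeta>] \<zeta> A d'(3) r by (auto simp: Q_def)
      moreover have "dist (A, w + \<zeta>) (0, \<zeta>) < d"
      proof -
        have "dist (A, w + \<zeta>) (0, \<zeta>) = norm (A, w)" by (simp add: dist_norm)
        also have "\<dots> \<le> cmod A + cmod w" by (rule norm_Pair_le)
        finally show ?thesis using A w d'(2) by simp
      qed
      ultimately show "cmod (?g \<zeta>) \<le> cmod \<phi> * r / 8"
        using bspec[OF bspec[OF uc, of "(0, \<zeta>)"], of "(A, w + \<zeta>)"] by (simp add: dist_norm)
    qed
    moreover have "deriv ?g 0 = deriv (F A) w - \<phi>"
    proof -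
      have wb: "w \<in> ball 0 r" using w d'(3) r by simp
      have 1: "(F A has_field_derivative deriv (F A) w) (at w)"
        using hol[OF Ar] wb by (intro holomorphic_derivI[of _ "ball 0 r"]) auto
      have 2: "(F 0 has_field_derivative \<phi>) (at 0)"
        unfolding \<phi>_def using hol[of 0] r by (intro holomorphic_derivI[of _ "ball 0 r"]) auto
      have "((\<lambda>\<zeta>. F A (w + \<zeta>)) has_field_derivative deriv (F A) w * 1) (at 0)"
        by (rule DERIV_chain2[where g = "\<lambda>\<zeta>. w + \<zeta>"]) (use 1 in \<open>auto intro!: derivative_eq_intros\<close>)
      then have "(?g has_field_derivative deriv (F A) w * 1 - \<phi>) (at 0)"
        by (intro DERIV_diff 2)
      then show ?thesis by (simp add: DERIV_imp_deriv)
    qed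
    ultimately show ?thesis using r by simp
  qed
  have "w = w'" if "cmod A < d'" "cmod w < d'" "cmod w' < d'" "F A w = F A w'" for A w w'
  proof -
    have Ar: "cmod A < r" using that d'(3) r by simp
    have "cmod ((F A w - \<phi> * w) - (F A w' - \<phi> * w')) \<le> cmod \<phi> / 2 * cmod (w - w')"
    proof (rule field_differentiable_bound[of "ball 0 d'" "\<lambda>w. F A w - \<phi> * w" "\<lambda>w. deriv (F A) w - \<phi>"])
      fix z :: complex assume z: "z \<in> ball 0 d'"
      have "(F A has_field_derivative deriv (F A) z) (at z)"
        using hol[OF Ar] z d'(3) r by (intro holomorphic_derivI[of _ "ball 0 r"]) auto
      then show "((\<lambda>w. F A w - \<phi> * w) has_field_derivative deriv (F A) z - \<phi>) (at z within ball 0 d')"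
        by (auto intro!: derivative_eq_intros intro: has_field_derivative_at_within)
      show "cmod (deriv (F A) z - \<phi>) \<le> cmod \<phi> / 2" using der that(1) z by simp
    qed (use that in auto)
    moreover have "(F A w - \<phi> * w) - (F A w' - \<phi> * w') = \<phi> * (w' - w)"
      using that(4) by (simp add: algebra_simps)
    ultimately have "cmod \<phi> * cmod (w - w') \<le> cmod \<phi> / 2 * cmod (w - w')"
      by (simp add: norm_mult norm_minus_commute)
    moreover have "cmod \<phi> > 0" using nz by (simp add: \<phi>_def)
    moreover have "cmod \<phi> / 2 * cmod (w - w') = cmod \<phi> * (cmod (w - w') / 2)" by simp
    ultimately have "cmod (w - w') \<le> cmod (w - w') / 2"
      using mult_le_cancel_left_pos by metis
    then show ?thesis by simp
  qed
  then show ?thesis using d'(1) by blast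
qed

lemma eventually_nonzero_if_derivative_nonzero:
  fixes g :: "complex \<Rightarrow> complex"
  assumes "(g has_field_derivative c) (at 0)" "c \<noteq> 0" "g 0 = 0"
  shows "\<forall>\<^sub>F \<sigma> in at 0. g \<sigma> \<noteq> 0"
proof -
  have "((\<lambda>h. g h / h) \<longlongrightarrow> c) (at 0)" using assms(1,3) by (simp add: DERIV_def)
  then have "\<forall>\<^sub>F h in at 0. g h / h \<noteq> 0" using assms(2) by (rule tendsto_imp_eventually_ne)
  then show ?thesis by eventually_elim auto
qed

text \<open>The images of the points \<open>(\<sigma> i, 2 \<i> \<sigma>\<^sup>2 y)\<close> of a chart are the nodes: two of these points satisfy the
  polarized equation when \<open>y + y' = i i'\<close>.  For small \<open>\<sigma>\<close> a coordinate of \<open>H\<close> separates different \<open>i\<close> by its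
  horizontal derivative, and different \<open>y\<close> with the same \<open>i\<close> by injectivity in the second variable.\<close>

lemma nonconstant_map_nodes:
  fixes H :: "complex^'n \<Rightarrow> complex^'m" and idx :: "'p::finite \<Rightarrow> int \<times> int"
  assumes dim: "CARD('n) \<ge> 2" and p: "norm p = 1"
    and H: "\<forall>\<^sub>F z in nhds p. \<forall>\<mu>. complex_differentiable (\<lambda>z. H z $ \<mu>) z"
    and nonconst: "\<not> (\<forall>\<^sub>F z in nhds p. H z = H p)"
    and R: "sesquiholomorphic R" and zero: "\<forall>\<^sub>F z in nhds p. norm z = 1 \<longrightarrow> R (H z) (H z) = 0"
    and N: "\<forall>\<^sub>F x in nhds (H p). N x" and idx: "inj idx"
  shows "\<exists>W :: 'p \<Rightarrow> complex^'m. (\<exists>r. inj (\<lambda>s. W s $ r)) \<and> (\<forall>s. N (W s)) \<and>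
    (\<forall>s t. snd (idx s) + snd (idx t) = fst (idx s) * fst (idx t) \<longrightarrow> R (W s) (W t) = 0)"
proof -
  have "\<exists>\<mu>. \<not> (\<forall>\<^sub>F z in nhds p. H z $ \<mu> = H p $ \<mu>)"
  proof (rule ccontr)
    assume "\<not> ?thesis"
    then have "\<forall>\<^sub>F z in nhds p. \<forall>\<mu>. H z $ \<mu> = H p $ \<mu>" by (simp add: eventually_all_finite)
    then show False using nonconst by (simp add: vec_eq_iff)
  qed
  then obtain \<mu> where \<mu>: "\<not> (\<forall>\<^sub>F z in nhds p. H z $ \<mu> = H p $ \<mu>)" by blast
  define f where "f z = H z $ \<mu>" for z
  have "isCont (\<lambda>z. H z $ \<nu>) p" for \<nu> using eventually_nhds_x_imp_x[OF H] complex_differentiable_isCont by blast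
  from isCont_tendsto_nhds[OF this] have "(H \<longlongrightarrow> H p) (nhds p)" by (rule vec_tendstoI)
  then have "\<forall>\<^sub>F z in nhds p. N (H z)" by (rule eventually_compose_filterlim[OF N])
  with H zero have "\<forall>\<^sub>F z in nhds p. (\<forall>\<mu>. complex_differentiable (\<lambda>z. H z $ \<mu>) z) \<and> (norm z = 1 \<longrightarrow> R (H z) (H z) = 0) \<and> N (H z)"
    by eventually_elim simp
  then obtain d0 where d0: "d0 > 0" and all0: "\<And>z. dist z p < d0 \<Longrightarrow>
      (\<forall>\<mu>. complex_differentiable (\<lambda>z. H z $ \<mu>) z) \<and> (norm z = 1 \<longrightarrow> R (H z) (H z) = 0) \<and> N (H z)"
    unfolding eventually_nhds_metric by blast
  have "\<forall>\<^sub>F z in nhds p. complex_differentiable f z" using H unfolding f_def by eventually_elim blast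
  moreover have "\<not> (\<forall>\<^sub>F z in nhds p. f z = f p)" using \<mu> by (simp add: f_def)
  ultimately obtain p1 e where p1: "dist p1 p < d0 / 2" "norm p1 = 1" and e: "norm e = 1" "herm e p1 = 0"
    and De: "frechet_derivative f (at p1) e \<noteq> 0"
    using nonconstant_imp_horizontal_derivative[OF dim p, of "d0 / 2" f] d0 by auto
  have all1: "(\<forall>\<mu>. complex_differentiable (\<lambda>z. H z $ \<mu>) z) \<and> (norm z = 1 \<longrightarrow> R (H z) (H z) = 0) \<and> N (H z)"
    if "dist z p1 < d0 / 2" for z
    using all0[of z] dist_triangle[of z p p1] that p1(1) by simp
  have d2: "d0 / 2 > 0" using d0 by simp
  have fhol: "complex_differentiable f z" if "dist z p1 < d0 / 2" for z using all1[OF that] unfolding f_def by blast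
  have fp: "complex_differentiable f p1" using fhol[of p1] d0 by simp
  let ?D = "frechet_derivative f (at p1)"
  interpret D: bounded_linear ?D using complex_differentiable_derivative(1)[OF fp] by (rule has_derivative_bounded_linear)
  (* If the derivative in the direction of p1 vanishes, the tilted chart adds the direction e. *)
  define b :: complex where "b = (if ?D p1 \<noteq> 0 then 0 else 1)"
  have b: "b = 0 \<or> b = 1" by (simp add: b_def)
  have Dw: "?D ((2 * \<i>) *s p1 + (2 * b) *s e) \<noteq> 0"
    using De by (simp add: D.add complex_differentiable_derivative(2)[OF fp] b_def)
  obtain r0 where r0: "r0 > 0" and near: "\<And>A w. cmod A < r0 \<Longrightarrow> cmod w < r0 \<Longrightarrow>
      chart_denominator b A w - \<i> * w \<noteq> 0 \<and> dist (chart b p1 e A w) p1 < d0 / 2"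
    using chart_near[OF d2, of b p1 e] by blast
  obtain r1 where r1: "r1 > 0" and polar: "\<And>A w A' w'. cmod A < r1 \<Longrightarrow> cmod w < r1 \<Longrightarrow> cmod A' < r1 \<Longrightarrow>
      cmod w' < r1 \<Longrightarrow> w - cnj w' = 2 * \<i> * A * cnj A' \<Longrightarrow>
      R (H (chart b p1 e A w)) (H (chart b p1 e A' w')) = 0"
    using polarized_equation_in_chart[OF R p1(2) e b d2, of H] all1 by blast
  define F where "F A w = f (chart b p1 e A w)" for A w
  have "\<exists>d>0. \<forall>A w w'. cmod A < d \<longrightarrow> cmod w < d \<longrightarrow> cmod w' < d \<longrightarrow> F A w = F A w' \<longrightarrow> w = w'"
  proof (rule injective_in_second_variable[OF r0])
    fix A assume "cmod A < r0"
    then show "F A holomorphic_on ball 0 r0"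
      unfolding F_def[abs_def]
      by (intro holomorphic_on_chart[where f = f and b = b and p = p1 and e = e and r = r0
            and \<delta> = "d0 / 2" and \<alpha> = "\<lambda>_. A" and \<beta> = "\<lambda>w. w"])
         (auto intro!: holomorphic_intros fhol dest: near)
  next
    show "continuous_on (ball 0 r0 \<times> ball 0 r0) (\<lambda>z. F (fst z) (snd z))"
    proof (intro continuous_at_imp_continuous_on ballI)
      fix z :: "complex \<times> complex" assume "z \<in> ball 0 r0 \<times> ball 0 r0"
      then have n: "chart_denominator b (fst z) (snd z) - \<i> * snd z \<noteq> 0"
        "dist (chart b p1 e (fst z) (snd z)) p1 < d0 / 2" using near[of "fst z" "snd z"] by auto
      have c1: "isCont (\<lambda>z. chart_denominator b (fst z) (snd z) + \<i> * snd z) z"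
        "isCont (\<lambda>z. chart_denominator b (fst z) (snd z) - \<i> * snd z) z"
        unfolding chart_denominator_def by (intro continuous_intros)+
      have c2: "isCont (\<lambda>z. 2 * (fst z + b * snd z)) z" by (intro continuous_intros)
      have "isCont (\<lambda>z. chart b p1 e (fst z) (snd z)) z"
        unfolding chart_def
        by (intro continuous_add bounded_linear.continuous[OF bounded_linear_smult_left]
            isCont_divide c1 c2 n(1))
      then show "isCont (\<lambda>z. F (fst z) (snd z)) z"
        unfolding F_def by (rule isCont_o2[where g = f]) (rule complex_differentiable_isCont[OF fhol[OF n(2)]])
    qed
  next
    let ?\<alpha> = "\<lambda>w. (chart_denominator b 0 w + \<i> * w) / (chart_denominator b 0 w - \<i> * w)"
    let ?\<beta> = "\<lambda>w. 2 * (0 + b * w) / (chart_denominator b 0 w - \<i> * w)"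
    have \<alpha>: "(?\<alpha> has_field_derivative 2 * \<i>) (at 0)" and \<beta>: "(?\<beta> has_field_derivative 2 * b) (at 0)"
      unfolding chart_denominator_def by (rule derivative_eq_intros refl | simp)+
    have at0: "?\<alpha> 0 *s p1 + ?\<beta> 0 *s e = p1" by (simp add: chart_denominator_def)
    have "((\<lambda>w. f (?\<alpha> w *s p1 + ?\<beta> w *s e)) has_field_derivative ?D ((2 * \<i>) *s p1 + (2 * b) *s e)) (at 0)"
      using has_field_derivative_on_plane[OF _ \<alpha> \<beta>, of f p1 e] fp unfolding at0 .
    then have "(F 0 has_field_derivative ?D ((2 * \<i>) *s p1 + (2 * b) *s e)) (at 0)"
      unfolding F_def[abs_def] chart_def .
    then show "deriv (F 0) 0 \<noteq> 0" using Dw DERIV_imp_deriv by metis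
  qed
  then obtain r2 where r2: "r2 > 0" and inj2: "\<And>A w w'. cmod A < r2 \<Longrightarrow> cmod w < r2 \<Longrightarrow> cmod w' < r2 \<Longrightarrow>
      F A w = F A w' \<Longrightarrow> w = w'" by blast
  define A where "A \<sigma> s = \<sigma> * of_int (fst (idx s))" for \<sigma> :: complex and s
  define w where "w \<sigma> s = 2 * \<i> * \<sigma>\<^sup>2 * of_int (snd (idx s))" for \<sigma> :: complex and s
  have derF: "((\<lambda>\<sigma>. F (A \<sigma> s) (w \<sigma> s)) has_field_derivative 2 * of_int (fst (idx s)) * ?D e) (at 0)" for s
  proof -
    let ?d = "\<lambda>\<sigma>. chart_denominator b (A \<sigma> s) (w \<sigma> s)"
    let ?\<alpha> = "\<lambda>\<sigma>. (?d \<sigma> + \<i> * w \<sigma> s) / (?d \<sigma> - \<i> * w \<sigma> s)"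
    let ?\<beta> = "\<lambda>\<sigma>. 2 * (A \<sigma> s + b * w \<sigma> s) / (?d \<sigma> - \<i> * w \<sigma> s)"
    have \<alpha>: "(?\<alpha> has_field_derivative 0) (at 0)" and \<beta>: "(?\<beta> has_field_derivative 2 * of_int (fst (idx s))) (at 0)"
      unfolding chart_denominator_def A_def w_def by (rule derivative_eq_intros refl | simp)+
    have at0: "?\<alpha> 0 *s p1 + ?\<beta> 0 *s e = p1" by (simp add: chart_denominator_def A_def w_def)
    have "((\<lambda>\<sigma>. f (?\<alpha> \<sigma> *s p1 + ?\<beta> \<sigma> *s e)) has_field_derivative
        ?D (0 *s p1 + (2 * of_int (fst (idx s))) *s e)) (at 0)"
      using has_field_derivative_on_plane[OF _ \<alpha> \<beta>, of f p1 e] fp unfolding at0 .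
    then show ?thesis
      unfolding F_def[abs_def] chart_def by (simp add: complex_differentiable_derivative(2)[OF fp])
  qed
  have sep: "\<forall>\<^sub>F \<sigma> in at 0. F (A \<sigma> s) (w \<sigma> s) \<noteq> F (A \<sigma> t) (w \<sigma> t)" if "fst (idx s) \<noteq> fst (idx t)" for s t
  proof -
    have "((\<lambda>\<sigma>. F (A \<sigma> s) (w \<sigma> s) - F (A \<sigma> t) (w \<sigma> t)) has_field_derivative
        2 * of_int (fst (idx s)) * ?D e - 2 * of_int (fst (idx t)) * ?D e) (at 0)"
      by (intro DERIV_diff derF)
    then have "\<forall>\<^sub>F \<sigma> in at 0. F (A \<sigma> s) (w \<sigma> s) - F (A \<sigma> t) (w \<sigma> t) \<noteq> 0"
      by (rule eventually_nonzero_if_derivative_nonzero) (use that De in \<open>auto simp: A_def w_def\<close>)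
    then show ?thesis by eventually_elim simp
  qed
  have sep': "\<forall>\<^sub>F \<sigma> in at 0. fst (idx s) \<noteq> fst (idx t) \<longrightarrow> F (A \<sigma> s) (w \<sigma> s) \<noteq> F (A \<sigma> t) (w \<sigma> t)" for s t
    by (cases "fst (idx s) = fst (idx t)") (use sep in auto)
  define \<rho> where "\<rho> = min r0 (min r1 r2)"
  have \<rho>: "\<rho> > 0" using r0 r1 r2 by (simp add: \<rho>_def)
  have small: "\<forall>\<^sub>F \<sigma> in at 0. cmod (A \<sigma> s) < \<rho> \<and> cmod (w \<sigma> s) < \<rho>" for s
  proof -
    have "isCont (\<lambda>\<sigma>. A \<sigma> s) 0" "isCont (\<lambda>\<sigma>. w \<sigma> s) 0"
      unfolding A_def w_def by (intro continuous_intros)+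
    then have "((\<lambda>\<sigma>. A \<sigma> s) \<longlongrightarrow> 0) (at 0)" "((\<lambda>\<sigma>. w \<sigma> s) \<longlongrightarrow> 0) (at 0)"
      by (simp_all add: isCont_def A_def w_def)
    from this[THEN tendstoD, OF \<rho>] show ?thesis by eventually_elim simp
  qed
  have "\<forall>\<^sub>F \<sigma> in at 0. \<forall>s. (cmod (A \<sigma> s) < \<rho> \<and> cmod (w \<sigma> s) < \<rho>) \<and>
      (\<forall>t. fst (idx s) \<noteq> fst (idx t) \<longrightarrow> F (A \<sigma> s) (w \<sigma> s) \<noteq> F (A \<sigma> t) (w \<sigma> t))"
    by (intro small sep' eventually_all_finite eventually_conj)
  moreover have "filterlim complex_of_real (at 0) (at_right 0)"
    unfolding filterlim_at
    by (auto intro!: tendsto_eq_intros simp: eventually_at_filter)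
  ultimately have "\<forall>\<^sub>F x in at_right (0::real). \<forall>s. (cmod (A (of_real x) s) < \<rho> \<and> cmod (w (of_real x) s) < \<rho>) \<and>
      (\<forall>t. fst (idx s) \<noteq> fst (idx t) \<longrightarrow> F (A (of_real x) s) (w (of_real x) s) \<noteq> F (A (of_real x) t) (w (of_real x) t))"
    by (rule eventually_compose_filterlim)
  moreover have "\<forall>\<^sub>F x in at_right (0::real). x > 0" by (rule eventually_at_right_less)
  ultimately have "\<forall>\<^sub>F x in at_right (0::real). x > 0 \<and> (\<forall>s. (cmod (A (of_real x) s) < \<rho> \<and> cmod (w (of_real x) s) < \<rho>) \<and>
      (\<forall>t. fst (idx s) \<noteq> fst (idx t) \<longrightarrow> F (A (of_real x) s) (w (of_real x) s) \<noteq> F (A (of_real x) t) (w (of_real x) t)))"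
    by eventually_elim simp
  from eventually_happens'[OF trivial_limit_at_right_real this]
  obtain x :: real where x: "x > 0"
    and bd: "\<And>s. cmod (A (of_real x) s) < \<rho>" "\<And>s. cmod (w (of_real x) s) < \<rho>"
    and dist1: "\<And>s t. fst (idx s) \<noteq> fst (idx t) \<Longrightarrow>
      F (A (of_real x) s) (w (of_real x) s) \<noteq> F (A (of_real x) t) (w (of_real x) t)" by blast
  define W where "W s = H (chart b p1 e (A (of_real x) s) (w (of_real x) s))" for s
  have "inj (\<lambda>s. W s $ \<mu>)"
  proof (rule injI)
    fix s t assume "W s $ \<mu> = W t $ \<mu>"
    then have eq: "F (A (of_real x) s) (w (of_real x) s) = F (A (of_real x) t) (w (of_real x) t)"
      by (simp add: W_def F_def f_def)
    then have fst: "fst (idx s) = fst (idx t)" using dist1 by blast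
    then have At: "A (of_real x) t = A (of_real x) s" by (simp add: A_def)
    have "w (of_real x) s = w (of_real x) t"
      using inj2[of "A (of_real x) s" "w (of_real x) s" "w (of_real x) t"] bd eq
      unfolding At by (simp add: \<rho>_def)
    then have "snd (idx s) = snd (idx t)" using x by (simp add: w_def)
    then show "s = t" using fst idx by (metis injD prod.expand)
  qed
  moreover have "N (W s)" for s
    unfolding W_def using all1 near bd[of s] by (simp add: \<rho>_def)
  moreover have "R (W s) (W t) = 0" if "snd (idx s) + snd (idx t) = fst (idx s) * fst (idx t)" for s t
    unfolding W_def
  proof (rule polar)
    have "complex_of_int (snd (idx s)) + of_int (snd (idx t)) = of_int (fst (idx s)) * of_int (fst (idx t))"
      using that by (metis of_int_add of_int_mult)
    then have "2 * \<i> * (of_real x)\<^sup>2 * (complex_of_int (snd (idx s)) + of_int (snd (idx t)))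
      = 2 * \<i> * (of_real x)\<^sup>2 * (of_int (fst (idx s)) * of_int (fst (idx t)))" by simp
    then show "w (of_real x) s - cnj (w (of_real x) t) = 2 * \<i> * A (of_real x) s * cnj (A (of_real x) t)"
      by (simp add: w_def A_def power2_eq_square algebra_simps)
  qed (use bd in \<open>simp_all add: \<rho>_def\<close>)
  ultimately show ?thesis by blast
qed

section \<open>The target hypersurface\<close>

text \<open>The injection \<open>\<iota>\<close> numbers the first \<open>n\<close> coordinates of the target and \<open>m0\<close> is the additional one.  The
  polynomial \<open>R\<close> is a parameter: the maps \<open>emb t\<close> exist for all choices of it, and a generic choice excludes
  other maps.\<close>

locale target_hypersurface =
  fixes \<iota> :: "'n::finite \<Rightarrow> 'm::finite" and m0 :: 'm and l p :: "complex^'n"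
    and R :: "complex^'m \<Rightarrow> complex"
  assumes inj_\<iota>: "inj \<iota>" and range_\<iota>: "range \<iota> = UNIV - {m0}"
    and p: "norm p = 1" and l: "l \<noteq> 0" and lp: "(\<Sum>j\<in>UNIV. l $ j * p $ j) = 0"
    and R: "cpoly R" and R_real: "\<And>x. Im (R x) = 0"
begin

definition lam :: "complex^'m \<Rightarrow> complex" where
  "lam x = (\<Sum>j\<in>UNIV. l $ j * x $ \<iota> j)"

definition del :: "complex^'m \<Rightarrow> complex" where
  "del x = (x $ m0 * cnj (lam x) - cnj (x $ m0) * lam x) / (2 * \<i>)"

definition quo :: "complex^'m \<Rightarrow> complex" where
  "quo x = lam x + cnj (lam x) + lam x * cnj (lam x) * R x"

definition rho :: "complex^'m \<Rightarrow> complex" where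
  "rho x = (\<Sum>j\<in>UNIV. x $ \<iota> j * cnj (x $ \<iota> j)) - 1 + del x * quo x"

definition emb :: "complex \<Rightarrow> complex^'n \<Rightarrow> complex^'m" where
  "emb t u = (\<chi> i. if i = m0 then t * (\<Sum>j\<in>UNIV. l $ j * u $ j) else u $ inv \<iota> i)"

abbreviation P :: "complex^'m" where "P \<equiv> emb 0 p"

definition Drho :: "complex^'m \<Rightarrow> complex^'m \<Rightarrow> real" where
  "Drho x v = Re (frechet_derivative rho (at x) v)"

text \<open>The transversality condition keeps the level set regular; it holds at \<open>P\<close>, and shrinking the hypersurface
  does not change the germs at \<open>P\<close>.\<close>

definition M' :: "(complex^'m) set" where
  "M' = {x. Re (rho x) = 0 \<and> Drho x P > 0}"

lemma \<iota>_neq [simp]: "\<iota> j \<noteq> m0" "m0 \<noteq> \<iota> j"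
  using range_\<iota> by auto

lemma emb_nth [simp]: "emb t u $ m0 = t * (\<Sum>j\<in>UNIV. l $ j * u $ j)" "emb t u $ \<iota> j = u $ j"
  by (simp_all add: emb_def inv_f_f[OF inj_\<iota>])

lemma target_index_cases: obtains "i = m0" | j where "i = \<iota> j"
  using range_\<iota> by (cases "i = m0") auto

lemma vec_eqI_target: "x $ m0 = y $ m0 \<Longrightarrow> (\<And>j. x $ \<iota> j = y $ \<iota> j) \<Longrightarrow> x = (y :: complex^'m)"
  unfolding vec_eq_iff by (metis target_index_cases)

lemma sum_target: "(\<Sum>i\<in>UNIV. f i) = f m0 + (\<Sum>j\<in>UNIV. f (\<iota> j))" for f :: "'m \<Rightarrow> 'b::comm_monoid_add"
proof -
  have "(\<Sum>i\<in>UNIV. f i) = f m0 + (\<Sum>i\<in>range \<iota>. f i)" unfolding range_\<iota> by (simp add: sum.remove)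
  then show ?thesis by (simp add: sum.reindex[OF inj_\<iota>])
qed

lemma cpoly_lam: "cpoly lam" and cpoly_del: "cpoly del" and cpoly_quo: "cpoly quo" and cpoly_rho: "cpoly rho"
proof -
  show lam: "cpoly lam" unfolding lam_def[abs_def] by (intro cpoly_sum cpoly_mult cpoly_const cpoly_nth)
  show del: "cpoly del" unfolding del_def[abs_def]
    by (intro cpoly_divide_const cpoly_diff cpoly_mult cpoly_nth cpoly_cnj_nth cpoly_cnj[OF lam] lam)
  show quo: "cpoly quo" unfolding quo_def[abs_def]
    by (intro cpoly_add cpoly_mult lam cpoly_cnj[OF lam] R)
  show "cpoly rho" unfolding rho_def[abs_def]
    by (intro cpoly_add cpoly_diff cpoly_mult cpoly_sum cpoly_nth cpoly_cnj_nth cpoly_const del quo)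
qed

lemma rho_real: "Im (rho x) = 0"
proof -
  have "Im (del x) = 0" by (simp add: del_def Im_divide)
  moreover have "Im (quo x) = 0" using R_real by (simp add: quo_def)
  ultimately show ?thesis by (simp add: rho_def Im_sum)
qed

lemma has_derivative_Re_rho: "((\<lambda>x. Re (rho x)) has_derivative Drho x) (at x)"
  using cpoly_differentiable[OF cpoly_rho] unfolding frechet_derivative_works Drho_def[abs_def]
  by (rule bounded_linear.has_derivative[OF bounded_linear_Re])

lemma isCont_Drho: "isCont (\<lambda>x. Drho x v) x"
  unfolding Drho_def
  by (intro continuous_Re cpoly_continuous cpoly_derivative cpoly_rho)

lemma hypersurface_M': "real_analytic_hypersurface M'"
  unfolding M'_def
  by (intro regular_level_set_hypersurface has_derivative_Re_rho isCont_Drho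
      real_analytic_at_bounded_linear_comp[OF bounded_linear_Re] cpoly_real_analytic_at cpoly_rho)

lemma lam_emb: "lam (emb t u) = (\<Sum>j\<in>UNIV. l $ j * u $ j)"
  by (simp add: lam_def)

lemma Drho_P: "Drho P w = 2 * Re (\<Sum>j\<in>UNIV. w $ \<iota> j * cnj (p $ j))"
proof -
  have "lam P = 0" by (simp add: lam_emb lp)
  then have z: "del P = 0" "quo P = 0" by (simp_all add: del_def quo_def)
  have "((\<lambda>x. del x * quo x) has_derivative (\<lambda>w. del P * frechet_derivative quo (at P) w
      + frechet_derivative del (at P) w * quo P)) (at P)"
    using cpoly_differentiable[OF cpoly_del] cpoly_differentiable[OF cpoly_quo]
    unfolding frechet_derivative_works by (rule has_derivative_mult)
  then have 1: "((\<lambda>x. del x * quo x) has_derivative (\<lambda>w. 0)) (at P)" by (simp add: z)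
  have nth: "((\<lambda>x. x $ i) has_derivative (\<lambda>x. x $ i)) (at P)" for i :: 'm
    by (intro bounded_linear_imp_has_derivative bounded_linear_vec_nth)
  have cnth: "((\<lambda>x. cnj (x $ i)) has_derivative (\<lambda>x. cnj (x $ i))) (at P)" for i :: 'm
    by (intro bounded_linear_imp_has_derivative
        bounded_linear_compose[OF bounded_linear_cnj bounded_linear_vec_nth])
  have "(rho has_derivative (\<lambda>w. (\<Sum>j\<in>UNIV. P $ \<iota> j * cnj (w $ \<iota> j) + w $ \<iota> j * cnj (P $ \<iota> j)) - 0 + 0)) (at P)"
    unfolding rho_def[abs_def]
    by (intro has_derivative_add has_derivative_diff has_derivative_const 1 has_derivative_sum
        has_derivative_mult nth cnth)
  note fd = frechet_derivative_at[OF this, symmetric]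
  have "Drho P w = Re (\<Sum>j\<in>UNIV. p $ j * cnj (w $ \<iota> j) + w $ \<iota> j * cnj (p $ j))"
    unfolding Drho_def fd by simp
  also have "\<dots> = 2 * Re (\<Sum>j\<in>UNIV. w $ \<iota> j * cnj (p $ j))"
    by (simp add: sum.distrib algebra_simps)
  finally show ?thesis .
qed

lemma Drho_P_emb: "Drho P (emb t u) = 2 * Re (herm u p)"
  by (simp add: Drho_P herm_def)

lemma Drho_P_P: "Drho P P = 2"
  by (simp add: Drho_P_emb herm_unit[OF p])

lemma bounded_linear_emb: "bounded_linear (emb t)"
proof (intro linear_conv_bounded_linear[THEN iffD1] linearI)
  show "emb t (x + y) = emb t x + emb t y" for x y
    by (rule vec_eqI_target) (simp_all add: sum.distrib algebra_simps)
  show "emb t (r *\<^sub>R x) = r *\<^sub>R emb t x" for r x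
    by (rule vec_eqI_target) (simp_all add: scaleR_sum_right[symmetric])
qed

lemma emb_smult: "emb t (c *s x) = c *s emb t x"
  by (rule vec_eqI_target) (simp_all add: sum_distrib_left mult_ac)

lemma rho_emb:
  assumes "t \<in> \<real>" "norm u = 1" shows "rho (emb t u) = 0"
proof -
  have "(\<Sum>j\<in>UNIV. u $ j * cnj (u $ j)) = 1" using herm_unit[OF assms(2)] by (simp add: herm_def)
  moreover have "del (emb t u) = 0"
    using assms(1) by (auto simp: del_def lam_emb elim!: Reals_cases)
  ultimately show ?thesis by (simp add: rho_def)
qed

section \<open>The maps through the cone of points\<close>

text \<open>Up to the constant \<open>coef t m0\<close>, this is the derivative of \<open>rho\<close> in the additional variable along \<open>emb t\<close>.  The
  other derivatives are linear combinations of it and of the gradient of the sphere.\<close>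

definition Theta :: "complex \<Rightarrow> complex^'n \<Rightarrow> complex" where
  "Theta t u = cnj (\<Sum>j\<in>UNIV. l $ j * u $ j) * quo (emb t u)"

definition coef :: "complex \<Rightarrow> 'm \<Rightarrow> complex" where
  "coef t i = (if i = m0 then 1 / (2 * \<i>) else - t * l $ inv \<iota> i / (2 * \<i>))"

definition gradient :: "complex \<Rightarrow> 'm \<Rightarrow> complex^'n \<Rightarrow> complex" where
  "gradient t i u = (if i = m0 then 0 else cnj (u $ inv \<iota> i)) + coef t i * Theta t u"

lemma wirtinger_lam: "wirtinger m0 lam x = 0" "wirtinger (\<iota> k) lam x = l $ k"
proof -
  have "wirtinger i lam x = (\<Sum>j\<in>UNIV. l $ j * (if i = \<iota> j then 1 else 0))" for i
    unfolding lam_def[abs_def]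
    by (subst wirtinger_sum) (simp_all add: wirtinger_mult cpoly_differentiable cpoly_const cpoly_nth cpoly_mult)
  then show "wirtinger m0 lam x = 0" "wirtinger (\<iota> k) lam x = l $ k"
    using inj_\<iota> by (simp_all add: inj_eq if_distrib cong: if_cong)
qed

lemma wirtinger_cnj_lam: "wirtinger i (\<lambda>x. cnj (lam x)) x = 0"
proof -
  have "(\<lambda>x. cnj (lam x)) = (\<lambda>x. \<Sum>j\<in>UNIV. cnj (l $ j) * cnj (x $ \<iota> j))" by (simp add: lam_def)
  then show ?thesis
    by (simp add: wirtinger_sum wirtinger_mult cpoly_differentiable cpoly_const cpoly_cnj_nth cpoly_mult)
qed

lemma wirtinger_rho_emb:
  assumes t: "t \<in> \<real>"
  shows "wirtinger i rho (emb t u) = gradient t i u"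
proof -
  note d = cpoly_differentiable
  note c = cpoly_lam cpoly_del cpoly_quo cpoly_const cpoly_nth cpoly_cnj_nth cpoly_cnj[OF cpoly_lam]
  let ?x = "emb t u"
  have del0: "del ?x = 0" using t by (auto simp: del_def lam_emb elim!: Reals_cases)
  have w_del: "wirtinger i del ?x = ((wirtinger i (\<lambda>x. x $ m0) ?x * cnj (lam ?x))
      - cnj (?x $ m0) * wirtinger i lam ?x) / (2 * \<i>)" for i
  proof -
    have "del = (\<lambda>x. (x $ m0 * cnj (lam x) - cnj (x $ m0) * lam x) * inverse (2 * \<i>))"
      by (rule ext) (simp only: del_def divide_inverse)
    then have "wirtinger i del ?x
        = wirtinger i (\<lambda>x. (x $ m0 * cnj (lam x) - cnj (x $ m0) * lam x) * inverse (2 * \<i>)) ?x"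
      by (rule arg_cong)
    also have "\<dots> = wirtinger i (\<lambda>x. x $ m0 * cnj (lam x) - cnj (x $ m0) * lam x) ?x * inverse (2 * \<i>)
        + (?x $ m0 * cnj (lam ?x) - cnj (?x $ m0) * lam ?x) * wirtinger i (\<lambda>x. inverse (2 * \<i>)) ?x"
      by (rule wirtinger_mult) (rule d, (rule cpoly_diff cpoly_mult c)+)+
    also have "wirtinger i (\<lambda>x. inverse (2 * \<i>)) ?x = 0" by (rule wirtinger_const)
    also have "wirtinger i (\<lambda>x. x $ m0 * cnj (lam x) - cnj (x $ m0) * lam x) ?x
        = wirtinger i (\<lambda>x. x $ m0 * cnj (lam x)) ?x - wirtinger i (\<lambda>x. cnj (x $ m0) * lam x) ?x"
      by (rule wirtinger_diff) (rule d, rule cpoly_mult, (rule c)+)+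
    also have "wirtinger i (\<lambda>x. x $ m0 * cnj (lam x)) ?x
        = wirtinger i (\<lambda>x. x $ m0) ?x * cnj (lam ?x) + ?x $ m0 * wirtinger i (\<lambda>x. cnj (lam x)) ?x"
      by (rule wirtinger_mult) (rule d, rule c)+
    also have "wirtinger i (\<lambda>x. cnj (x $ m0) * lam x) ?x
        = wirtinger i (\<lambda>x. cnj (x $ m0)) ?x * lam ?x + cnj (?x $ m0) * wirtinger i lam ?x"
      by (rule wirtinger_mult) (rule d, rule c)+
    finally have "wirtinger i del ?x = (wirtinger i (\<lambda>x. x $ m0) ?x * cnj (lam ?x)
        - cnj (?x $ m0) * wirtinger i lam ?x) * inverse (2 * \<i>)"
      by (simp only: wirtinger_cnj_lam wirtinger_cnj_nth) simp
    then show ?thesis by (simp only: divide_inverse)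
  qed
  have w_sum: "wirtinger i (\<lambda>x. \<Sum>j\<in>UNIV. x $ \<iota> j * cnj (x $ \<iota> j)) ?x
      = (\<Sum>j\<in>UNIV. (if i = \<iota> j then 1 else 0) * cnj (u $ j))" for i
    by (subst wirtinger_sum) (simp_all add: wirtinger_mult d c cpoly_mult)
  have w_rho: "wirtinger i rho ?x = wirtinger i (\<lambda>x. \<Sum>j\<in>UNIV. x $ \<iota> j * cnj (x $ \<iota> j)) ?x
      + wirtinger i del ?x * quo ?x" for i
  proof -
    have "wirtinger i rho ?x = wirtinger i (\<lambda>x. (\<Sum>j\<in>UNIV. x $ \<iota> j * cnj (x $ \<iota> j)) - 1) ?x
        + wirtinger i (\<lambda>x. del x * quo x) ?x"
      unfolding rho_def[abs_def]
      by (rule wirtinger_add) (intro d cpoly_diff cpoly_sum cpoly_mult c)+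
    also have "wirtinger i (\<lambda>x. (\<Sum>j\<in>UNIV. x $ \<iota> j * cnj (x $ \<iota> j)) - 1) ?x
        = wirtinger i (\<lambda>x. \<Sum>j\<in>UNIV. x $ \<iota> j * cnj (x $ \<iota> j)) ?x - wirtinger i (\<lambda>x. 1) ?x"
      by (rule wirtinger_diff) (intro d cpoly_sum cpoly_mult c)+
    also have "wirtinger i (\<lambda>x. del x * quo x) ?x = wirtinger i del ?x * quo ?x"
      by (subst wirtinger_mult) (simp_all add: d c del0)
    finally show ?thesis by simp
  qed
  show ?thesis
  proof (cases i rule: target_index_cases)
    case 1
    then show ?thesis
      by (simp add: w_rho w_sum w_del wirtinger_lam gradient_def coef_def Theta_def lam_emb)
  next
    case (2 k)
    have "(\<Sum>j\<in>UNIV. (if \<iota> k = \<iota> j then 1 else 0) * cnj (u $ j)) = cnj (u $ k)"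
    proof -
      have "(\<Sum>j\<in>UNIV. (if \<iota> k = \<iota> j then 1 else 0) * cnj (u $ j)) = (\<Sum>j\<in>UNIV. if k = j then cnj (u $ j) else 0)"
        using inj_\<iota> by (intro sum.cong) (auto simp: inj_eq)
      then show ?thesis by simp
    qed
    moreover have "cnj t = t" using t by (simp add: Reals_cnj_iff)
    ultimately show ?thesis
      using 2 by (simp add: w_rho w_sum w_del wirtinger_lam gradient_def coef_def Theta_def lam_emb inv_f_f[OF inj_\<iota>])
  qed
qed

lemma cpoly_emb: "cpoly (\<lambda>u. emb t u $ i)"
proof (cases i rule: target_index_cases)
  case 1
  then show ?thesis by (simp add: cpoly_mult cpoly_const cpoly_sum cpoly_nth)
next
  case 2
  then show ?thesis by (simp add: cpoly_nth)
qed

lemma cpoly_Theta: "cpoly (Theta t)"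
  unfolding Theta_def[abs_def]
  by (intro cpoly_mult cpoly_cnj cpoly_sum cpoly_const cpoly_nth cpoly_compose[OF cpoly_quo cpoly_emb])

lemma cpoly_gradient_base: "cpoly (\<lambda>u. if i = m0 then 0 else cnj (u $ inv \<iota> i))"
  by (cases "i = m0") (simp_all add: cpoly_const cpoly_cnj_nth)

lemma cpoly_gradient: "cpoly (gradient t i)"
  unfolding gradient_def[abs_def]
  by (intro cpoly_add cpoly_mult cpoly_const cpoly_Theta cpoly_gradient_base)

text \<open>Linear CR fields; they span the (0,1) tangent space of the sphere at every point.\<close>

definition rot :: "complex^'n \<Rightarrow> complex^'n \<Rightarrow> complex^'n \<Rightarrow> complex^'n" where
  "rot x y u = (\<Sum>j\<in>UNIV. y $ j * u $ j) *s x - (\<Sum>j\<in>UNIV. x $ j * u $ j) *s y"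

lemma rot_tangent: "(\<Sum>k\<in>UNIV. rot x y u $ k * u $ k) = 0"
proof -
  have "(\<Sum>k\<in>UNIV. rot x y u $ k * u $ k) = (\<Sum>j\<in>UNIV. y $ j * u $ j) * (\<Sum>k\<in>UNIV. x $ k * u $ k)
      - (\<Sum>j\<in>UNIV. x $ j * u $ j) * (\<Sum>k\<in>UNIV. y $ k * u $ k)"
    unfolding sum_distrib_left sum_subtractf[symmetric] by (simp add: rot_def algebra_simps)
  then show ?thesis by simp
qed

lemma cpoly_rot: "cpoly (\<lambda>u. rot x y u $ k)"
  unfolding rot_def
  by (simp only: vector_minus_component vector_smult_component)
     (intro cpoly_diff cpoly_mult cpoly_sum cpoly_const cpoly_nth)

lemma bounded_linear_rot: "bounded_linear (rot x y)"
proof -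
  have "bounded_linear (\<lambda>u. \<Sum>j\<in>UNIV. y $ j * u $ j)" for y :: "complex^'n"
    by (intro bounded_linear_sum bounded_linear_compose[OF bounded_linear_mult_right bounded_linear_vec_nth])
  then show ?thesis unfolding rot_def[abs_def]
    by (intro bounded_linear_sub bounded_linear_compose[OF bounded_linear_smult_left])
qed

lemma apply_field_rot_nth: "apply_field b (\<lambda>u. rot x y u $ k) z = 0"
proof -
  have lin: "apply_field b (\<lambda>u. \<Sum>j\<in>UNIV. y $ j * u $ j) z = 0" for y
    by (subst apply_field_sum)
       (simp_all add: apply_field_mult cpoly_differentiable cpoly_const cpoly_nth cpoly_mult)
  have diff: "(\<lambda>u. \<Sum>j\<in>UNIV. y $ j * u $ j) differentiable (at z)" for y
    by (intro cpoly_differentiable cpoly_sum cpoly_mult cpoly_const cpoly_nth)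
  have "apply_field b (\<lambda>u. rot x y u $ k) z
      = apply_field b (\<lambda>u. x $ k * (\<Sum>j\<in>UNIV. y $ j * u $ j) + (- y $ k) * (\<Sum>j\<in>UNIV. x $ j * u $ j)) z"
    by (simp add: rot_def mult.commute)
  also have "\<dots> = apply_field b (\<lambda>u. x $ k * (\<Sum>j\<in>UNIV. y $ j * u $ j)) z
      + apply_field b (\<lambda>u. (- y $ k) * (\<Sum>j\<in>UNIV. x $ j * u $ j)) z"
    by (rule apply_field_add) (intro differentiable_mult differentiable_const diff)+
  also have "\<dots> = 0" by (simp only: apply_field_cmult[OF diff] lin) simp
  finally show ?thesis .
qed

text \<open>A CR field treats \<open>u\<close> as a constant and differentiates only its conjugate.  Where \<open>\<lambda>\<close> vanishes, as it does at
  \<open>p\<close>, all terms of \<open>Theta\<close> but the square of \<open>cnj \<lambda>\<close> drop out, and this CR field, whose value at \<open>p\<close> is \<open>l\<close>,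
  changes \<open>cnj \<lambda>\<close> to first order.\<close>

lemma second_derivative_Theta:
  "apply_field (rot l (\<chi> j. cnj (p $ j))) (apply_field (rot l (\<chi> j. cnj (p $ j))) (Theta t)) p \<noteq> 0"
proof -
  let ?c = "rot l (\<chi> j. cnj (p $ j))"
  let ?L = "apply_field ?c"
  define a where "a u = (\<Sum>j\<in>UNIV. l $ j * u $ j)" for u :: "complex^'n"
  define b where "b u = (\<Sum>j\<in>UNIV. cnj (l $ j) * cnj (u $ j))" for u :: "complex^'n"
  define G where "G u = b u * b u * R (emb t u)" for u
  have ca: "cpoly a" and cb: "cpoly b" unfolding a_def[abs_def] b_def[abs_def]
    by (intro cpoly_sum cpoly_mult cpoly_const cpoly_nth cpoly_cnj_nth)+
  have cG: "cpoly G" unfolding G_def[abs_def] by (intro cpoly_mult cb cpoly_compose[OF R cpoly_emb])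
  have cL: "cpoly (?L f)" if "cpoly f" for f by (rule cpoly_apply_field[OF that cpoly_rot])
  note d = cpoly_differentiable
  note c = cpoly_const cpoly_nth cpoly_cnj_nth ca cb cG
  have La: "?L a = (\<lambda>_. 0)"
  proof
    show "?L a u = 0" for u unfolding a_def[abs_def]
      by (subst apply_field_sum) (simp_all add: apply_field_mult d c cpoly_mult)
  qed
  define \<beta> where "\<beta> u = (\<Sum>j\<in>UNIV. cnj (l $ j) * ?c u $ j)" for u
  have Lb: "?L b = \<beta>"
  proof
    show "?L b u = \<beta> u" for u unfolding b_def[abs_def] \<beta>_def
      by (subst apply_field_sum) (simp_all add: apply_field_mult d c cpoly_mult)
  qed
  have L\<beta>: "?L \<beta> = (\<lambda>_. 0)"
  proof
    show "?L \<beta> u = 0" for u unfolding \<beta>_def[abs_def]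
      by (subst apply_field_sum)
         (simp_all add: apply_field_mult d c cpoly_mult cpoly_rot apply_field_rot_nth)
  qed
  have c\<beta>: "cpoly \<beta>" unfolding \<beta>_def[abs_def] by (intro cpoly_sum cpoly_mult cpoly_const cpoly_rot)
  have Theta: "Theta t = (\<lambda>u. a u * b u + (b u * b u + a u * G u))"
    by (simp add: fun_eq_iff Theta_def quo_def lam_emb a_def b_def G_def algebra_simps)
  have L1: "?L (Theta t) = (\<lambda>u. a u * \<beta> u + (\<beta> u * b u + (b u * \<beta> u + a u * ?L G u)))"
    unfolding Theta
    by (rule ext) (simp add: apply_field_add apply_field_mult d c cpoly_mult cpoly_add La Lb)
  have "?L (?L (Theta t)) p = \<beta> p * \<beta> p + \<beta> p * \<beta> p + a p * ?L (?L G) p"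
    unfolding L1
    by (simp add: apply_field_add apply_field_mult d c cpoly_mult cpoly_add La Lb L\<beta> c\<beta> cL)
  moreover have "a p = 0" using lp by (simp add: a_def)
  moreover have "\<beta> p = (\<Sum>j\<in>UNIV. cnj (l $ j) * l $ j)"
  proof -
    have pp: "(\<Sum>j\<in>UNIV. cnj (p $ j) * p $ j) = 1"
      using herm_unit[OF p] by (simp add: herm_def mult.commute)
    have "\<beta> p = (\<Sum>j\<in>UNIV. cnj (l $ j) * l $ j)"
      unfolding \<beta>_def rot_def using lp pp by simp
    then show ?thesis .
  qed
  moreover have "(\<Sum>j\<in>UNIV. cnj (l $ j) * l $ j) = of_real ((norm l)\<^sup>2)"
    using herm_self[of l] by (simp add: herm_def mult.commute)
  ultimately show ?thesis using l by simp
qed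

text \<open>A complex reflection along \<open>p - z\<close>, scaled so that \<open>p\<close> goes to \<open>z\<close>.  The map \<open>V\<close> is the adjoint and the
  inverse of \<open>U\<close>.\<close>

lemma unitary_transitive:
  assumes z: "norm z = 1"
  shows "\<exists>U V :: complex^'n \<Rightarrow> complex^'n. bounded_linear U \<and> bounded_linear V \<and>
    (\<forall>c x. U (c *s x) = c *s U x) \<and> (\<forall>x y. herm (U x) y = herm x (V y)) \<and>
    (\<forall>x. U (V x) = x) \<and> (\<forall>x. V (U x) = x) \<and> U p = z"
proof (cases "z = p")
  case True
  then show ?thesis by (intro exI[of _ "\<lambda>x. x"]) auto
next
  case False
  define d where "d = p - z"
  have dd: "herm p d + cnj (herm p d) = herm d d"
    using cnj_herm[of p z] by (simp add: d_def herm_simps herm_unit[OF p] herm_unit[OF z])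
  have "herm d d \<noteq> 0" using False by (simp add: herm_self d_def)
  then have nz: "herm p d \<noteq> 0" using dd by auto
  define k where "k = inverse (herm p d)"
  have k: "k + cnj k = k * cnj k * herm d d"
    using nz by (simp add: k_def dd[symmetric] field_simps)
  define refl where "refl c x = x - (herm x d * c) *s d" for c x
  have lin: "bounded_linear (refl c)" for c
  proof (intro linear_conv_bounded_linear[THEN iffD1] linearI)
    show "refl c (x + y) = refl c x + refl c y" for x y
      by (simp add: refl_def herm_simps vec_eq_iff algebra_simps)
    show "refl c (r *\<^sub>R x) = r *\<^sub>R refl c x" for r x
      by (simp add: refl_def scaleR_eq_smult herm_simps vec_eq_iff algebra_simps)
  qed
  have sm: "refl c (a *s x) = a *s refl c x" for c a x
    by (simp add: refl_def herm_simps vec_eq_iff algebra_simps)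
  have comp: "refl c (refl c' x) = x - (herm x d * (c + c' - c * c' * herm d d)) *s d" for c c' x
    by (simp add: refl_def herm_simps vec_eq_iff algebra_simps)
  have "herm (refl k x) y = herm x (refl (cnj k) y)" for x y
    by (simp add: refl_def herm_simps cnj_herm mult_ac)
  moreover have "refl k (refl (cnj k) x) = x" for x unfolding comp using k by simp
  moreover have "refl (cnj k) (refl k x) = x" for x unfolding comp using k by (simp add: add.commute mult_ac)
  moreover have "refl k p = z" using nz by (simp add: refl_def k_def) (simp add: d_def)
  ultimately show ?thesis
    using lin sm by (intro exI[of _ "refl k"] exI[of _ "refl (cnj k)"]) blast
qed

lemma annihilator_exists:
  assumes "vec.span S \<noteq> (UNIV :: (complex^'k) set)"
  shows "\<exists>\<xi>. \<xi> \<noteq> 0 \<and> (\<forall>x\<in>S. (\<Sum>i\<in>UNIV. \<xi> $ i * x $ i) = 0)"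
proof -
  let ?T = "vec.span S"
  have "subspace ?T"
    unfolding subspace_def by (auto simp: vec.span_zero vec.span_add scaleR_eq_smult vec.span_scale)
  then have spanT: "span ?T = ?T" by (simp only: span_eq_iff)
  have "dim ?T \<noteq> DIM(complex^'k)" using assms dim_eq_full[of ?T] unfolding spanT by blast
  then have "dim ?T < DIM(complex^'k)" using dim_subset_UNIV[of ?T] by (rule le_neq_implies_less[rotated])
  then obtain y where y: "y \<noteq> 0" and orth: "\<And>x. x \<in> span ?T \<Longrightarrow> orthogonal y x"
    by (rule orthogonal_to_subspace_exists) blast
  have h: "herm x y = 0" if "x \<in> S" for x
  proof -
    have "x \<in> ?T" using that by (rule vec.span_base)
    then have "x \<in> span ?T" "\<i> *s x \<in> span ?T" by (auto intro: span_base vec.span_scale)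
    then have "y \<bullet> x = 0" "y \<bullet> (\<i> *s x) = 0" using orth unfolding orthogonal_def by blast+
    then have "x \<bullet> y = 0" "(\<i> *s x) \<bullet> y = 0" by (simp_all add: inner_commute)
    then show ?thesis by (simp add: inner_eq_Re_herm herm_simps complex_eq_iff)
  qed
  have "(\<chi> i. cnj (y $ i)) \<noteq> 0" using y by (auto simp: vec_eq_iff)
  moreover have "(\<Sum>i\<in>UNIV. (\<chi> i. cnj (y $ i)) $ i * x $ i) = 0" if "x \<in> S" for x
    using h[OF that] by (simp add: herm_def mult.commute)
  ultimately show ?thesis by blast
qed

lemma apply_field_transport:
  fixes U :: "complex^'n \<Rightarrow> complex^'n"
  assumes G: "G differentiable (at (U x))" and U: "bounded_linear U" "\<And>c x. U (c *s x) = c *s U x"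
    and a: "U (\<chi> j. cnj (a' x $ j)) = (\<chi> j. cnj (a (U x) $ j))"
  shows "apply_field a' (\<lambda>x. G (U x)) x = apply_field a G (U x)"
proof -
  have G': "(G has_derivative frechet_derivative G (at (U x))) (at (U x))"
    using G by (simp add: frechet_derivative_works)
  have 1: "((\<lambda>x. G (U x)) has_derivative (\<lambda>h. frechet_derivative G (at (U x)) (U h))) (at x)"
    by (rule has_derivative_compose[OF bounded_linear_imp_has_derivative[OF U(1)] G'])
  have "(\<chi> j. \<i> * cnj (a' x $ j)) = \<i> *s (\<chi> j. cnj (a' x $ j))" by (simp add: vec_eq_iff)
  then have "U (\<chi> j. \<i> * cnj (a' x $ j)) = (\<chi> j. \<i> * cnj (a (U x) $ j))"
    by (simp add: U(2) a) (simp add: vec_eq_iff)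
  then show ?thesis unfolding apply_field_eq[OF 1] apply_field_eq[OF G'] a by simp
qed

text \<open>The map is \<open>emb t\<close> after a unitary map \<open>U\<close> with \<open>U p = z\<close>.  A vector \<open>\<xi>\<close> that annihilates all iterated
  derivatives of the gradient of order at most two vanishes: two linear CR fields kill the sphere part of
  the gradient, so the second derivative of \<open>Theta\<close> shows that \<open>\<xi>\<close> annihilates \<open>coef t\<close>, and then the
  gradient of the sphere and its first derivatives, which span \<open>\<complex>\<^sup>n\<close>, leave \<open>\<xi> = 0\<close>.\<close>

lemma nearby_points_in_mapping_locus:
  assumes t: "t \<in> \<real>"
  shows "\<forall>\<^sub>F z in nhds p. norm z = 1 \<longrightarrow> (\<forall>k\<ge>2. emb t z \<in> mapping_locus k (sphere 0 1) p M')"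
proof -
  let ?c = "rot l (\<chi> j. cnj (p $ j))"
  have cont_D: "isCont (\<lambda>u. Drho (emb t u) P) u" for u
    by (rule isCont_o2[OF bounded_linear.isCont[OF bounded_linear_emb, OF continuous_ident] isCont_Drho])
  have embp: "emb t p = P" by (rule vec_eqI_target) (simp_all add: lp)
  have "\<forall>\<^sub>F z in nhds p. Drho (emb t z) P > 0"
    using isCont_tendsto_nhds[OF cont_D[of p]] by (rule order_tendstoD(1)) (simp add: embp Drho_P_P)
  moreover have "\<forall>\<^sub>F z in nhds p. apply_field ?c (apply_field ?c (Theta t)) z \<noteq> 0"
  proof (rule tendsto_imp_eventually_ne[OF _ second_derivative_Theta])
    have "cpoly (apply_field ?c (apply_field ?c (Theta t)))"
      by (intro cpoly_apply_field cpoly_Theta cpoly_rot)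
    then show "(apply_field ?c (apply_field ?c (Theta t)) \<longlongrightarrow>
        apply_field ?c (apply_field ?c (Theta t)) p) (nhds p)" by (rule cpoly_tendsto)
  qed
  ultimately show ?thesis
  proof (eventually_elim, intro impI allI)
    fix z :: "complex^'n" and k :: nat
    assume D0: "Drho (emb t z) P > 0" and nz: "apply_field ?c (apply_field ?c (Theta t)) z \<noteq> 0"
      and z: "norm z = 1" and k: "2 \<le> k"
    obtain U V :: "complex^'n \<Rightarrow> complex^'n" where U: "bounded_linear U" "bounded_linear V"
      "\<And>c x. U (c *s x) = c *s U x" "\<And>x y. herm (U x) y = herm x (V y)"
      "\<And>x. U (V x) = x" "\<And>x. V (U x) = x" "U p = z"
      using unitary_transitive[OF z] by blast
    have normU: "norm (U x) = norm x" for x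
    proof -
      have "complex_of_real ((norm (U x))\<^sup>2) = complex_of_real ((norm x)\<^sup>2)"
        unfolding herm_self[symmetric] by (simp add: U(4,6))
      then show ?thesis by (simp only: of_real_eq_iff) (simp add: power2_eq_iff_nonneg)
    qed
    define H where "H \<zeta> = emb t (U \<zeta>)" for \<zeta>
    have H_lin: "bounded_linear H"
      unfolding H_def by (rule bounded_linear_compose[OF bounded_linear_emb U(1)])
    have Hp: "H p = emb t z" by (simp add: H_def U(7))
    have "holomorphic_map_at H p"
      unfolding holomorphic_map_at_def
      using bounded_linear_imp_has_derivative[OF H_lin]
      by (intro always_eventually allI exI[of _ H]) (simp add: H_def U(3) emb_smult)
    moreover have locus: "\<forall>\<^sub>F \<zeta> in nhds p. \<zeta> \<in> sphere 0 1 \<longrightarrow> H \<zeta> \<in> M'"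
    proof -
      have "isCont (\<lambda>\<zeta>. Drho (H \<zeta>) P) p"
        by (rule isCont_o2[OF bounded_linear.isCont[OF H_lin, OF continuous_ident] isCont_Drho])
      from order_tendstoD(1)[OF isCont_tendsto_nhds[OF this], of 0]
      have "\<forall>\<^sub>F \<zeta> in nhds p. Drho (H \<zeta>) P > 0" using D0 by (simp add: Hp)
      then show ?thesis
        by eventually_elim (simp add: M'_def H_def rho_emb[OF t] normU)
    qed
    moreover have "finitely_nondegenerate_at k (sphere 0 1) M' H p"
    proof -
      let ?S = "{(\<chi> i. foldr apply_field Ls (\<lambda>z. wirtinger i \<rho> (H z)) p) | Ls \<rho>.
          set Ls \<subseteq> CR_fields (sphere 0 1) p \<and> length Ls \<le> k \<and> \<rho> \<in> vanishing_ideal M' (H p)}"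
      have ideal: "rho \<in> vanishing_ideal M' (H p)"
        unfolding vanishing_ideal_def M'_def
        using cpoly_real_analytic_at[OF cpoly_rho] rho_real by (auto simp: complex_eq_iff)
      define fld where "fld a \<zeta> = (\<chi> j. cnj (V (\<chi> j. cnj (a (U \<zeta>) $ j)) $ j))" for a \<zeta>
      have fld_CR: "fld (rot x y) \<in> CR_fields (sphere 0 1) p" for x y
      proof (rule linear_field_in_CR_fields)
        have "bounded_linear (\<lambda>u. (\<chi> j. cnj (u $ j)) :: complex^'n)"
          by (intro linear_conv_bounded_linear[THEN iffD1] linearI) (simp_all add: vec_eq_iff)
        note conj = bounded_linear_compose[OF this]
        show "bounded_linear (fld (rot x y))"
          unfolding fld_def
          by (rule conj[OF bounded_linear_compose[OF U(2)
                conj[OF bounded_linear_compose[OF bounded_linear_rot U(1)]]]])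
        fix \<zeta>
        have "(\<Sum>j\<in>UNIV. fld (rot x y) \<zeta> $ j * \<zeta> $ j) = herm \<zeta> (V (\<chi> j. cnj (rot x y (U \<zeta>) $ j)))"
          by (simp add: fld_def herm_def mult.commute)
        also have "\<dots> = herm (U \<zeta>) (\<chi> j. cnj (rot x y (U \<zeta>) $ j))" by (simp add: U(4))
        also have "\<dots> = (\<Sum>j\<in>UNIV. rot x y (U \<zeta>) $ j * U \<zeta> $ j)" by (simp add: herm_def mult.commute)
        finally show "(\<Sum>j\<in>UNIV. fld (rot x y) \<zeta> $ j * \<zeta> $ j) = 0" by (simp add: rot_tangent)
      qed
      have grad: "(\<lambda>\<zeta>. wirtinger i rho (H \<zeta>)) = (\<lambda>\<zeta>. gradient t i (U \<zeta>))" for i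
        by (simp add: H_def wirtinger_rho_emb[OF t])
      have tr: "apply_field (fld a) (\<lambda>\<zeta>. G (U \<zeta>)) = (\<lambda>\<zeta>. apply_field a G (U \<zeta>))" if "cpoly G" for a G
      proof
        show "apply_field (fld a) (\<lambda>\<zeta>. G (U \<zeta>)) \<zeta> = apply_field a G (U \<zeta>)" for \<zeta>
          by (rule apply_field_transport[OF cpoly_differentiable[OF that] U(1,3)])
             (simp add: fld_def U(5))
      qed
      have "vec.span ?S = UNIV"
      proof (rule ccontr)
        assume "vec.span ?S \<noteq> UNIV"
        from annihilator_exists[OF this]
        obtain \<xi> where \<xi>: "\<xi> \<noteq> 0" and ann: "\<forall>x\<in>?S. (\<Sum>i\<in>UNIV. \<xi> $ i * x $ i) = 0"
          by (elim exE conjE)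
        have annL: "(\<Sum>i\<in>UNIV. \<xi> $ i * foldr apply_field Ls (\<lambda>\<zeta>. gradient t i (U \<zeta>)) p) = 0"
          if "set Ls \<subseteq> CR_fields (sphere 0 1) p" "length Ls \<le> k" for Ls
        proof -
          have "(\<chi> i. foldr apply_field Ls (\<lambda>\<zeta>. wirtinger i rho (H \<zeta>)) p) \<in> ?S"
            using that ideal by blast
          from bspec[OF ann this] show ?thesis by (simp add: grad)
        qed
        define \<kappa> where "\<kappa> = (\<Sum>i\<in>UNIV. \<xi> $ i * coef t i)"
        have lincomb: "(\<Sum>i\<in>UNIV. \<xi> $ i * ((if i = m0 then 0 else c (inv \<iota> i)) + coef t i * T))
            = (\<Sum>j\<in>UNIV. \<xi> $ \<iota> j * c j) + \<kappa> * T" for T c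
        proof -
          have "(\<Sum>i\<in>UNIV. \<xi> $ i * ((if i = m0 then 0 else c (inv \<iota> i)) + coef t i * T))
            = (\<Sum>i\<in>UNIV. \<xi> $ i * (if i = m0 then 0 else c (inv \<iota> i))) + \<kappa> * T"
            by (simp only: \<kappa>_def distrib_left sum.distrib sum_distrib_right mult.assoc)
          also have "(\<Sum>i\<in>UNIV. \<xi> $ i * (if i = m0 then 0 else c (inv \<iota> i))) = (\<Sum>j\<in>UNIV. \<xi> $ \<iota> j * c j)"
            unfolding sum_target by (simp add: inv_f_f[OF inj_\<iota>])
          finally show ?thesis .
        qed
        have app1: "apply_field a (gradient t i) u =
            (if i = m0 then 0 else a u $ inv \<iota> i) + coef t i * apply_field a (Theta t) u" for a i u
        proof -
          have "apply_field a (gradient t i) u = apply_field a (\<lambda>u. if i = m0 then 0 else cnj (u $ inv \<iota> i)) u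
              + apply_field a (\<lambda>u. coef t i * Theta t u) u"
            unfolding gradient_def[abs_def]
            by (rule apply_field_add)
               (intro cpoly_differentiable cpoly_gradient_base cpoly_mult cpoly_const cpoly_Theta)+
          then show ?thesis
            by (cases "i = m0") (simp_all add: apply_field_cmult cpoly_differentiable cpoly_Theta)
        qed
        have app2: "apply_field a (apply_field (rot x y) (gradient t i)) u
            = (if i = m0 then 0 else 0) + coef t i * apply_field a (apply_field (rot x y) (Theta t)) u" for a x y i u
        proof -
          have cr: "cpoly (\<lambda>u. if i = m0 then 0 else rot x y u $ inv \<iota> i)"
            by (cases "i = m0") (simp_all add: cpoly_const cpoly_rot)
          have cT: "cpoly (apply_field (rot x y) (Theta t))"
            by (rule cpoly_apply_field[OF cpoly_Theta cpoly_rot])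
          have "apply_field a (apply_field (rot x y) (gradient t i)) u
            = apply_field a (\<lambda>u. if i = m0 then 0 else rot x y u $ inv \<iota> i) u
              + apply_field a (\<lambda>u. coef t i * apply_field (rot x y) (Theta t) u) u"
            unfolding app1[abs_def]
            by (rule apply_field_add) (intro cpoly_differentiable cr cT cpoly_mult cpoly_const)+
          then show ?thesis
            by (cases "i = m0") (simp_all add: apply_field_cmult cpoly_differentiable cT apply_field_rot_nth)
        qed
        have S0: "(\<Sum>j\<in>UNIV. \<xi> $ \<iota> j * cnj (z $ j)) + \<kappa> * Theta t z = 0"
          using annL[of "[]"] lincomb[where T = "Theta t z" and c = "\<lambda>j. cnj (z $ j)"] by (simp add: U(7) gradient_def cong: if_cong)
        have S1: "(\<Sum>j\<in>UNIV. \<xi> $ \<iota> j * rot x y z $ j) + \<kappa> * apply_field (rot x y) (Theta t) z = 0" for x y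
          using annL[of "[fld (rot x y)]"] k fld_CR
            lincomb[where T = "apply_field (rot x y) (Theta t) z" and c = "\<lambda>j. rot x y z $ j"]
          by (simp add: tr cpoly_gradient U(7) app1 cong: if_cong)
        have S2: "\<kappa> * apply_field (rot x y) (apply_field (rot x y) (Theta t)) z = 0" for x y
          using annL[of "[fld (rot x y), fld (rot x y)]"] k fld_CR
            lincomb[where T = "apply_field (rot x y) (apply_field (rot x y) (Theta t)) z" and c = "\<lambda>j. 0"]
          by (simp add: tr cpoly_gradient cpoly_apply_field cpoly_rot U(7) app2 cong: if_cong)
        (* Only the second derivatives of Theta survive here, one of which is nonzero near p. *)
        have \<kappa>0: "\<kappa> = 0" using S2[of l "\<chi> j. cnj (p $ j)"] nz by simp
        have "\<xi> $ \<iota> i = 0" for i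
        proof -
          have zz: "(\<Sum>j\<in>UNIV. cnj (z $ j) * z $ j) = 1"
            using herm_unit[OF z] by (simp add: herm_def mult.commute)
          have "(\<Sum>j\<in>UNIV. \<xi> $ \<iota> j * rot (axis i 1) (\<chi> j. cnj (z $ j)) z $ j)
              = \<xi> $ \<iota> i - z $ i * (\<Sum>j\<in>UNIV. \<xi> $ \<iota> j * cnj (z $ j))"
          proof -
            have delta: "(\<Sum>j\<in>UNIV. (if j = i then 1 else 0) * c j) = c i" for c :: "'n \<Rightarrow> complex"
            proof -
              have "(\<Sum>j\<in>UNIV. (if j = i then 1 else 0) * c j) = (\<Sum>j\<in>UNIV. if j = i then c j else 0)"
                by (intro sum.cong) auto
              then show ?thesis by simp
            qed
            have "rot (axis i 1) (\<chi> j. cnj (z $ j)) z $ j = (if j = i then 1 else 0) - z $ i * cnj (z $ j)" for j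
              using zz by (simp add: rot_def axis_def delta)
            then have "(\<Sum>j\<in>UNIV. \<xi> $ \<iota> j * rot (axis i 1) (\<chi> j. cnj (z $ j)) z $ j)
                = (\<Sum>j\<in>UNIV. (if j = i then 1 else 0) * \<xi> $ \<iota> j - z $ i * (\<xi> $ \<iota> j * cnj (z $ j)))"
              by (simp only: right_diff_distrib mult.commute mult.left_commute)
            then show ?thesis by (simp only: sum_subtractf delta sum_distrib_left)
          qed
          then show ?thesis using S1[of "axis i 1" "\<chi> j. cnj (z $ j)"] S0 \<kappa>0 by simp
        qed
        then have "\<xi> $ m0 = 0" "\<And>j. \<xi> $ \<iota> j = 0"
          using \<kappa>0 by (simp_all add: \<kappa>_def sum_target coef_def)
        then have "\<xi> = 0" by (intro vec_eqI_target) simp_all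
        then show False using \<xi> by contradiction
      qed
      then show ?thesis
        unfolding finitely_nondegenerate_at_def by (simp only: vec_dim_card)
    qed
    moreover have "emb t z \<in> M'" using D0 z by (simp add: M'_def rho_emb[OF t])
    ultimately show "emb t z \<in> mapping_locus k (sphere 0 1) p M'"
      unfolding mapping_locus_def using Hp by blast
  qed
qed

end

section \<open>Points that no map reaches\<close>

lemma foldr_apply_field_locally_constant:
  assumes "\<forall>\<^sub>F z in nhds p. G z = c"
  shows "\<forall>\<^sub>F z in nhds p. foldr apply_field Ls G z = (if Ls = [] then c else 0)"
proof (induction Ls)
  case Nil
  then show ?case using assms by simp
next
  case (Cons a Ls)
  let ?c = "if Ls = [] then c else 0"
  have "\<forall>\<^sub>F z in nhds p. \<forall>\<^sub>F w in nhds z. foldr apply_field Ls G w = ?c"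
    using Cons by (simp add: eventually_eventually)
  then show ?case
  proof eventually_elim
    case (elim z)
    have "((\<lambda>_. ?c) has_derivative (\<lambda>_. 0)) (at z)" by (rule has_derivative_const)
    moreover have "\<forall>\<^sub>F w in at z. ?c = foldr apply_field Ls G w"
      using elim unfolding eventually_at_filter by (auto elim: eventually_mono)
    ultimately have "(foldr apply_field Ls G has_derivative (\<lambda>_. 0)) (at z)"
      by (rule has_derivative_transform_eventually) (use eventually_nhds_x_imp_x[OF elim] in auto)
    then show ?case by (simp add: apply_field_eq)
  qed
qed

lemma holomorphic_map_at_imp_complex_differentiable:
  assumes "holomorphic_map_at H p"
  shows "\<forall>\<^sub>F z in nhds p. \<forall>\<mu>. complex_differentiable (\<lambda>z. H z $ \<mu>) z"
  using assms unfolding holomorphic_map_at_def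
proof eventually_elim
  case (elim z)
  then obtain D where D: "(H has_derivative D) (at z)" "\<And>c v. D (c *s v) = c *s D v" by blast
  have "((\<lambda>z. H z $ \<mu>) has_derivative (\<lambda>v. D v $ \<mu>)) (at z)" for \<mu>
    by (rule bounded_linear.has_derivative[OF bounded_linear_vec_nth D(1)])
  moreover have "D (c *s v) $ \<mu> = c * D v $ \<mu>" for c v \<mu> by (simp add: D(2))
  ultimately show ?case unfolding complex_differentiable_def by (intro allI exI conjI) assumption+
qed

context target_hypersurface
begin

text \<open>Every function that vanishes on \<open>M'\<close> has a differential proportional to that of \<open>rho\<close>, and the iterated
  derivatives of a constant vanish; so the vectors span at most a line.\<close>

lemma constant_map_degenerate:
  assumes const: "\<forall>\<^sub>F z in nhds p. H z = H p" and q: "H p \<in> M'" and card: "CARD('m) \<ge> 2"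
  shows "\<not> finitely_nondegenerate_at k M M' H p"
proof -
  let ?q = "H p"
  define g where "g = (\<chi> i. wirtinger i rho ?q)"
  have rq: "Re (rho ?q) = 0" and Dq: "Drho ?q P > 0" using q by (auto simp: M'_def)
  have cont: "continuous_on UNIV (\<lambda>x. Re (rho x))"
    by (intro continuous_at_imp_continuous_on ballI continuous_Re cpoly_continuous cpoly_rho)
  have proportional: "\<exists>\<kappa>. \<forall>i. wirtinger i f ?q = \<kappa> * wirtinger i rho ?q" if f: "f \<in> vanishing_ideal M' ?q" for f
  proof -
    have "\<forall>\<^sub>F x in nhds ?q. f differentiable (at x)"
      using f real_analytic_at_imp_eventually_differentiable unfolding vanishing_ideal_def by blast
    from eventually_nhds_x_imp_x[OF this]
    have F: "(f has_derivative frechet_derivative f (at ?q)) (at ?q)"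
      by (simp add: frechet_derivative_works)
    have "\<forall>\<^sub>F x in nhds ?q. Drho x P > 0"
      using isCont_tendsto_nhds[OF isCont_Drho] Dq by (rule order_tendstoD(1))
    moreover have "\<forall>\<^sub>F x in nhds ?q. x \<in> M' \<longrightarrow> f x = 0"
      using f unfolding vanishing_ideal_def by blast
    ultimately have "\<forall>\<^sub>F x in nhds ?q. Re (rho x) = 0 \<longrightarrow> f x = 0"
      by eventually_elim (simp add: M'_def)
    from derivative_proportional_on_level_set[OF has_derivative_Re_rho cont rq Dq F this]
    have Fw: "frechet_derivative f (at ?q) w = Drho ?q w *\<^sub>R (frechet_derivative f (at ?q) P /\<^sub>R Drho ?q P)" for w .
    have rho': "((\<lambda>x. complex_of_real (Re (rho x))) has_derivative (\<lambda>w. of_real (Drho ?q w))) (at ?q)"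
      by (rule bounded_linear.has_derivative[OF bounded_linear_of_real has_derivative_Re_rho])
    have "(\<lambda>x. complex_of_real (Re (rho x))) = rho" using rho_real by (auto simp: complex_eq_iff)
    with rho' have rho'': "(rho has_derivative (\<lambda>w. of_real (Drho ?q w))) (at ?q)" by simp
    let ?\<kappa> = "frechet_derivative f (at ?q) P /\<^sub>R Drho ?q P"
    have "wirtinger i f ?q = ?\<kappa> * wirtinger i rho ?q" for i
      unfolding wirtinger_eq[OF F] wirtinger_eq[OF rho''] Fw[of "axis i 1"] Fw[of "axis i \<i>"]
      by (simp add: scaleR_conv_of_real algebra_simps diff_divide_distrib)
    then show ?thesis by blast
  qed
  let ?S = "{(\<chi> i. foldr apply_field Ls (\<lambda>z. wirtinger i \<rho> (H z)) p) | Ls \<rho>.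
          set Ls \<subseteq> CR_fields M p \<and> length Ls \<le> k \<and> \<rho> \<in> vanishing_ideal M' (H p)}"
  have "?S \<subseteq> vec.span {g}"
  proof
    fix x assume "x \<in> ?S"
    then obtain Ls f where x: "x = (\<chi> i. foldr apply_field Ls (\<lambda>z. wirtinger i f (H z)) p)"
      and f: "f \<in> vanishing_ideal M' ?q" by blast
    have "\<forall>\<^sub>F z in nhds p. wirtinger i f (H z) = wirtinger i f ?q" for i
      using const by eventually_elim simp
    from eventually_nhds_x_imp_x[OF foldr_apply_field_locally_constant[OF this]]
    have fold: "foldr apply_field Ls (\<lambda>z. wirtinger i f (H z)) p = (if Ls = [] then wirtinger i f ?q else 0)" for i .
    obtain \<kappa> where "\<And>i. wirtinger i f ?q = \<kappa> * wirtinger i rho ?q" using proportional[OF f] by blast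
    then have "x = (if Ls = [] then \<kappa> else 0) *s g"
      unfolding x fold by (simp add: vec_eq_iff g_def)
    then show "x \<in> vec.span {g}" by (simp add: vec.span_scale vec.span_base)
  qed
  then have "vec.span ?S \<subseteq> vec.span {g}" by (rule vec.span_minimal[OF _ vec.subspace_span])
  then have "vec.dim (vec.span ?S) \<le> card {g}" by (rule vec.dim_le_card) simp
  then show ?thesis unfolding finitely_nondegenerate_at_def using card by auto
qed

text \<open>The polarization of \<open>del\<close>.  The polarization of \<open>rho\<close> is \<open>num + den * R\<close>, and \<open>num\<close> and \<open>den\<close> do not involve
  \<open>R\<close>; where \<open>den\<close> does not vanish the equation determines the polarized \<open>R\<close>.\<close>

definition del2 :: "complex^'m \<Rightarrow> complex^'m \<Rightarrow> complex" where
  "del2 x y = (x $ m0 * cnj (lam y) - cnj (y $ m0) * lam x) / (2 * \<i>)"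

definition num :: "complex^'m \<Rightarrow> complex^'m \<Rightarrow> complex" where
  "num x y = (\<Sum>j\<in>UNIV. x $ \<iota> j * cnj (y $ \<iota> j)) - 1 + del2 x y * (lam x + cnj (lam y))"

definition den :: "complex^'m \<Rightarrow> complex^'m \<Rightarrow> complex" where
  "den x y = del2 x y * (lam x * cnj (lam y))"

lemma differentiable_num_den:
  "(\<lambda>z. num (fst z) (snd z)) differentiable (at z)" "(\<lambda>z. den (fst z) (snd z)) differentiable (at z)"
proof -
  have bl: "bounded_linear (\<lambda>z::(complex^'m) \<times> (complex^'m). fst z $ i)"
    "bounded_linear (\<lambda>z::(complex^'m) \<times> (complex^'m). snd z $ i)" for i
    by (intro bounded_linear_compose[OF bounded_linear_vec_nth] bounded_linear_fst bounded_linear_snd)+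
  have x: "(\<lambda>z::(complex^'m) \<times> (complex^'m). fst z $ i) differentiable (at z)"
    "(\<lambda>z::(complex^'m) \<times> (complex^'m). snd z $ i) differentiable (at z)" for i
    using bl[THEN bounded_linear.linear, THEN linear_imp_differentiable] .
  have lam: "(\<lambda>z::(complex^'m) \<times> (complex^'m). lam (fst z)) differentiable (at z)"
    "(\<lambda>z::(complex^'m) \<times> (complex^'m). lam (snd z)) differentiable (at z)"
    unfolding lam_def by (intro differentiable_sum ballI differentiable_mult differentiable_const x; simp)+
  have del2: "(\<lambda>z. del2 (fst z) (snd z)) differentiable (at z)"
    unfolding del2_def divide_inverse
    by (intro differentiable_diff differentiable_mult differentiable_const differentiable_cnj x lam)
  show "(\<lambda>z. num (fst z) (snd z)) differentiable (at z)"
    unfolding num_def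
    by (intro differentiable_diff differentiable_add differentiable_mult differentiable_const
        differentiable_cnj differentiable_sum ballI x lam del2) simp
  show "(\<lambda>z. den (fst z) (snd z)) differentiable (at z)"
    unfolding den_def by (intro differentiable_mult differentiable_cnj lam del2)
qed

end

lemma sesquiholomorphic_const: "sesquiholomorphic (\<lambda>x y. c)"
  and sesquiholomorphic_nth: "sesquiholomorphic (\<lambda>x y. x $ i)"
  and sesquiholomorphic_cnj_nth: "sesquiholomorphic (\<lambda>x y. cnj (y $ i))"
  unfolding sesquiholomorphic_def by auto

lemma sesquiholomorphic_add: "sesquiholomorphic f \<Longrightarrow> sesquiholomorphic g \<Longrightarrow> sesquiholomorphic (\<lambda>x y. f x y + g x y)"
  and sesquiholomorphic_diff: "sesquiholomorphic f \<Longrightarrow> sesquiholomorphic g \<Longrightarrow> sesquiholomorphic (\<lambda>x y. f x y - g x y)"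
  and sesquiholomorphic_mult: "sesquiholomorphic f \<Longrightarrow> sesquiholomorphic g \<Longrightarrow> sesquiholomorphic (\<lambda>x y. f x y * g x y)"
  unfolding sesquiholomorphic_def by (auto intro!: holomorphic_intros)

lemma sesquiholomorphic_power: "sesquiholomorphic f \<Longrightarrow> sesquiholomorphic (\<lambda>x y. f x y ^ k)"
  by (induction k) (simp_all add: sesquiholomorphic_const sesquiholomorphic_mult)

lemma sesquiholomorphic_sum:
  "(\<And>i. i \<in> A \<Longrightarrow> sesquiholomorphic (f i)) \<Longrightarrow> sesquiholomorphic (\<lambda>x y. \<Sum>i\<in>A. f i x y)"
proof (induction A rule: infinite_finite_induct)
  case (insert a A)
  then have "sesquiholomorphic (\<lambda>x y. f a x y + (\<Sum>i\<in>A. f i x y))"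
    by (intro sesquiholomorphic_add) simp_all
  then show ?case using insert by simp
qed (simp_all add: sesquiholomorphic_const)

lemmas sesquiholomorphic_rules = sesquiholomorphic_const sesquiholomorphic_nth sesquiholomorphic_cnj_nth
  sesquiholomorphic_add sesquiholomorphic_diff sesquiholomorphic_mult sesquiholomorphic_power
  sesquiholomorphic_sum

lemma sesquiholomorphic_hermitian_poly: "sesquiholomorphic (hermitian_poly k c)"
proof -
  have "sesquiholomorphic (\<lambda>x y. \<Sum>r\<in>UNIV. (\<Sum>d\<in>UNIV. \<Sum>e\<in>UNIV. c $ r $ d $ e * (x $ r) ^ k d * (cnj (y $ r)) ^ k e)
      + (\<Sum>d\<in>UNIV. \<Sum>e\<in>UNIV. cnj (c $ r $ d $ e) * (cnj (y $ r)) ^ k d * (x $ r) ^ k e))"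
    by (intro sesquiholomorphic_rules)
  then show ?thesis by (simp add: hermitian_poly_def[abs_def] sesqui_def)
qed

lemma cpoly_hermitian_poly: "cpoly (\<lambda>x. hermitian_poly k c x x)"
  unfolding hermitian_poly_def sesqui_def
  by (intro cpoly_sum cpoly_add cpoly_mult cpoly_power cpoly_cnj cpoly_const cpoly_nth cpoly_cnj_nth)

lemma hermitian_poly_real: "Im (hermitian_poly k c x x) = 0"
  by (simp add: hermitian_poly_def Im_sum)

text \<open>A nonconstant map would produce nodes near \<open>q\<close>, where \<open>den\<close> does not vanish, at which the values of the
  polarized \<open>R\<close> are prescribed at all pairs in \<open>E\<close>; the coefficients \<open>c\<close> exclude such nodes.\<close>

lemma (in target_hypersurface) not_in_mapping_locus:
  fixes c :: "complex^'p::finite^'p^'m"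
  assumes dim: "CARD('n) \<ge> 2" and card: "CARD('m) \<ge> 2"
    and Rc: "R = (\<lambda>x. hermitian_poly k c x x)"
    and idx: "inj (idx :: 'p \<Rightarrow> int \<times> int)"
    and E: "\<And>s t. (s, t) \<in> E \<Longrightarrow> snd (idx s) + snd (idx t) = fst (idx s) * fst (idx t)"
    and c: "\<And>r. \<not> (\<exists>W :: 'p \<Rightarrow> complex^'m. inj (\<lambda>s. W s $ r) \<and>
      (\<forall>(s, t)\<in>E. den (W s) (W t) \<noteq> 0 \<and>
         num (W s) (W t) + den (W s) (W t) * hermitian_poly k c (W s) (W t) = 0))"
    and q: "del q \<noteq> 0"
  shows "q \<notin> mapping_locus n (sphere 0 1) p M'"
proof
  assume "q \<in> mapping_locus n (sphere 0 1) p M'"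
  then obtain H where qM: "q \<in> M'" and hol: "holomorphic_map_at H p" and Hp: "H p = q"
    and M: "\<forall>\<^sub>F z in nhds p. z \<in> sphere 0 1 \<longrightarrow> H z \<in> M'"
    and nondeg: "finitely_nondegenerate_at n (sphere 0 1) M' H p"
    unfolding mapping_locus_def by blast
  show False
  proof (cases "\<forall>\<^sub>F z in nhds p. H z = H p")
    case True
    have "\<not> finitely_nondegenerate_at n (sphere 0 1) M' H p"
      by (rule constant_map_degenerate[OF True _ card]) (simp add: Hp qM)
    then show False using nondeg by contradiction
  next
    case False
    let ?R = "\<lambda>x y. num x y + den x y * hermitian_poly k c x y"
    have sesq: "sesquiholomorphic ?R"
    proof -
      have lam: "sesquiholomorphic (\<lambda>x y. lam x)" unfolding lam_def by (intro sesquiholomorphic_rules)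
      have clam: "sesquiholomorphic (\<lambda>x y. cnj (lam y))"
      proof -
        have "sesquiholomorphic (\<lambda>x y. \<Sum>j\<in>UNIV. cnj (l $ j) * cnj (y $ \<iota> j))"
          by (intro sesquiholomorphic_rules)
        then show ?thesis by (simp add: lam_def)
      qed
      have del2: "sesquiholomorphic del2"
        unfolding del2_def[abs_def] divide_inverse
        by (intro sesquiholomorphic_diff sesquiholomorphic_mult sesquiholomorphic_const
            sesquiholomorphic_nth sesquiholomorphic_cnj_nth lam clam)
      have "sesquiholomorphic num" "sesquiholomorphic den"
        unfolding num_def[abs_def] den_def[abs_def]
        by (intro sesquiholomorphic_add sesquiholomorphic_diff sesquiholomorphic_mult
            sesquiholomorphic_const sesquiholomorphic_sum sesquiholomorphic_nth
            sesquiholomorphic_cnj_nth lam clam del2)+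
      then show ?thesis
        by (intro sesquiholomorphic_add sesquiholomorphic_mult sesquiholomorphic_hermitian_poly)
    qed
    have zero: "\<forall>\<^sub>F z in nhds p. norm z = 1 \<longrightarrow> ?R (H z) (H z) = 0"
      using M
    proof eventually_elim
      case (elim z)
      show ?case
      proof
        assume "norm z = 1"
        then have "H z \<in> M'" using elim by simp
        then have "rho (H z) = 0" using rho_real[of "H z"] by (simp add: M'_def complex_eq_iff)
        moreover have "rho x = ?R x x" for x
        proof -
          have "del x = del2 x x" by (simp add: del_def del2_def)
          moreover have "R x = hermitian_poly k c x x" by (simp add: Rc)
          ultimately show ?thesis
            by (simp only: rho_def num_def den_def quo_def distrib_left mult.assoc add.assoc)
        qed
        ultimately show "?R (H z) (H z) = 0" by simp
      qed
    qed
    have "\<exists>N. (\<forall>\<^sub>F x in nhds (H p). N x) \<and> (\<forall>x y. N x \<longrightarrow> N y \<longrightarrow> den x y \<noteq> 0)"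
    proof -
      have "lam q \<noteq> 0" using q by (auto simp: del_def)
      then have "den q q \<noteq> 0" using q by (simp add: den_def del2_def del_def)
      moreover have "isCont (\<lambda>z. den (fst z) (snd z)) (q, q)"
        using differentiable_num_den(2) by (rule differentiable_imp_continuous_within)
      ultimately have "\<forall>\<^sub>F z in nhds (q, q). den (fst z) (snd z) \<noteq> 0"
        using tendsto_imp_eventually_ne[OF isCont_tendsto_nhds] by fastforce
      then obtain Q1 Q2 where "eventually Q1 (nhds q)" "eventually Q2 (nhds q)"
        "\<And>x y. Q1 x \<Longrightarrow> Q2 y \<Longrightarrow> den x y \<noteq> 0"
        unfolding nhds_prod eventually_prod_filter by auto
      then show ?thesis unfolding Hp
        by (intro exI[of _ "\<lambda>x. Q1 x \<and> Q2 x"]) (auto intro: eventually_conj)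
    qed
    then obtain N where N: "\<forall>\<^sub>F x in nhds (H p). N x" "\<And>x y. N x \<Longrightarrow> N y \<Longrightarrow> den x y \<noteq> 0"
      by blast
    note nonconstant_map_nodes[OF dim p holomorphic_map_at_imp_complex_differentiable[OF hol] False sesq zero N(1) idx]
    then obtain W :: "'p \<Rightarrow> complex^'m" and r where W: "inj (\<lambda>s. W s $ r)" "\<And>s. N (W s)"
       "\<And>s t. snd (idx s) + snd (idx t) = fst (idx s) * fst (idx t) \<Longrightarrow> ?R (W s) (W t) = 0" by blast
    have "\<forall>(s, t)\<in>E. den (W s) (W t) \<noteq> 0 \<and> ?R (W s) (W t) = 0"
      using W(2,3) N(2) E by blast
    with W(1) c show False by blast
  qed
qed

section \<open>Counting incidences\<close>

text \<open>Points \<open>(i, y)\<close> with \<open>0 \<le> i < K\<close> and \<open>0 \<le> y < 2 K\<^sup>2\<close> are joined to points \<open>(i', - 1 - y')\<close> of the same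
  range when \<open>y - 1 - y' = i i'\<close>; the shift by \<open>-1\<close> keeps the two sets of points disjoint.  For \<open>y \<ge> K\<^sup>2\<close> every \<open>i'\<close> occurs, so that \<open>4 K\<^sup>3\<close> points have at least \<open>K\<^sup>4\<close>
  incidences.\<close>

lemma many_incidences:
  "\<exists>(idx :: bool \<times> 'k::finite \<times> bool \<times> 'k \<times> 'k \<Rightarrow> int \<times> int) E.
     inj idx \<and> (\<forall>s t. (s, t) \<in> E \<longrightarrow> (t, s) \<notin> E) \<and>
     (\<forall>s t. (s, t) \<in> E \<longrightarrow> snd (idx s) + snd (idx t) = fst (idx s) * fst (idx t)) \<and>
     card E \<ge> CARD('k) ^ 4"
proof -
  define K where "K = CARD('k)"
  have K: "K > 0" by (simp add: K_def)
  obtain f :: "'k \<Rightarrow> nat" where f: "bij_betw f UNIV {0..<K}"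
    using ex_bij_betw_finite_nat[of "UNIV :: 'k set"] by (auto simp: K_def)
  obtain g :: "bool \<times> 'k \<times> 'k \<Rightarrow> nat" where g: "bij_betw g UNIV {0..<2 * K ^ 2}"
    using ex_bij_betw_finite_nat[of "UNIV :: (bool \<times> 'k \<times> 'k) set"]
    by (auto simp: K_def power2_eq_square card_prod)
  define idx :: "bool \<times> 'k \<times> bool \<times> 'k \<times> 'k \<Rightarrow> int \<times> int" where
    "idx s = (case s of (\<beta>, i, y) \<Rightarrow> (int (f i), if \<beta> then int (g y) else - 1 - int (g y)))" for s
  define E where "E = {((True, i, y), (False, i', y')) | i y i' y'. int (g y) - 1 - int (g y') = int (f i) * int (f i')}"
  have E_iff: "((True, i, y), (False, i', y')) \<in> E \<longleftrightarrow> int (g y) - 1 - int (g y') = int (f i) * int (f i')" for i y i' y'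
    unfolding E_def by blast
  have fi: "inj f" and gi: "inj g" using f g by (auto simp: bij_betw_def)
  have "inj idx"
    by (rule injI) (auto simp: idx_def inj_eq[OF fi] inj_eq[OF gi] split: prod.splits if_splits)
  moreover have "\<forall>s t. (s, t) \<in> E \<longrightarrow> (t, s) \<notin> E" by (auto simp: E_def)
  moreover have "\<forall>s t. (s, t) \<in> E \<longrightarrow> snd (idx s) + snd (idx t) = fst (idx s) * fst (idx t)"
    by (auto simp: E_def idx_def)
  moreover have "card E \<ge> CARD('k) ^ 4"
  proof -
    let ?A = "(UNIV :: 'k set) \<times> {y. g y \<ge> K ^ 2} \<times> (UNIV :: 'k set)"
    define h where "h a = (case a of (i, y, i') \<Rightarrow> ((True, i, y), (False, i', inv g (g y - 1 - f i * f i'))))" for a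
    have "card {y. g y \<ge> K ^ 2} = card (g ` {y. g y \<ge> K ^ 2})"
      using gi by (intro card_image[symmetric]) (auto intro: inj_on_subset)
    also have "g ` {y. g y \<ge> K ^ 2} = {K ^ 2..<2 * K ^ 2}"
    proof
      have "g y < 2 * K ^ 2" for y using g by (auto simp: bij_betw_def)
      then show "g ` {y. g y \<ge> K ^ 2} \<subseteq> {K ^ 2..<2 * K ^ 2}" by auto
      show "{K ^ 2..<2 * K ^ 2} \<subseteq> g ` {y. g y \<ge> K ^ 2}"
      proof
        fix n assume n: "n \<in> {K ^ 2..<2 * K ^ 2}"
        then have "n \<in> range g" using g by (auto simp: bij_betw_def)
        then show "n \<in> g ` {y. g y \<ge> K ^ 2}" using n by auto
      qed
    qed
    finally have "card ?A = K * (K ^ 2 * K)" by (simp add: card_cartesian_product K_def)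
    also have "\<dots> = K ^ 4" by (simp add: power2_eq_square power4_eq_xxxx)
    finally have cardA: "card ?A = K ^ 4" .
    have "inj_on h ?A" by (auto simp: inj_on_def h_def)
    moreover have "h ` ?A \<subseteq> E"
    proof
      fix e assume "e \<in> h ` ?A"
      then obtain i y i' where y: "g y \<ge> K ^ 2" and e: "e = h (i, y, i')" by auto
      have "f i < K" "f i' < K" using f by (auto simp: bij_betw_def)
      then have "f i * f i' \<le> (K - 1) * (K - 1)" by (intro mult_mono) auto
      also have "\<dots> < K ^ 2"
        using K by (simp add: power2_eq_square mult_strict_mono)
      finally have lt: "f i * f i' < K ^ 2" .
      have gy: "g y < 2 * K ^ 2" using g by (auto simp: bij_betw_def)
      then have "g y - 1 - f i * f i' \<in> {0..<2 * K ^ 2}" by auto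
      then have "g y - 1 - f i * f i' \<in> range g" using g by (simp add: bij_betw_def)
      then have "g (inv g (g y - 1 - f i * f i')) = g y - 1 - f i * f i'" by (rule f_inv_into_f)
      moreover have "int (g y - 1 - f i * f i') = int (g y) - 1 - int (f i) * int (f i')"
        using lt y by (simp add: of_nat_diff)
      ultimately show "e \<in> E" by (simp only: e h_def prod.case E_iff)
    qed
    ultimately have "card ?A \<le> card E" by (intro card_inj_on_le) auto
    then show ?thesis using cardA by (simp add: K_def)
  qed
  ultimately show ?thesis by blast
qed

section \<open>The mapping locus is singular\<close>

context target_hypersurface
begin

lemma emb_p: "emb t p = P"
  by (rule vec_eqI_target) (simp_all add: lp)

text \<open>Already the tangent spaces of the graphs for \<open>t = 0\<close> and \<open>t = 1\<close> span the tangent space of \<open>M'\<close> at \<open>P\<close>: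
  the difference \<open>emb 1 y - emb 0 y\<close> points in the direction of the additional coordinate.\<close>

lemma derivative_on_cone:
  fixes f :: "complex^'m \<Rightarrow> real"
  assumes F: "(f has_derivative F) (at P)" and zero: "\<forall>\<^sub>F x in nhds P. x \<in> S \<longrightarrow> f x = 0"
    and S: "\<And>t. t \<in> \<real> \<Longrightarrow> \<forall>\<^sub>F z in nhds p. norm z = 1 \<longrightarrow> emb t z \<in> S"
  shows "F = (\<lambda>w. F P / 2 * Drho P w)"
proof
  fix w
  interpret F: bounded_linear F using F by (rule has_derivative_bounded_linear)
  have tangential: "F (emb t y) = 0" if t: "t \<in> \<real>" and y: "p \<bullet> y = 0" for t y
  proof (rule sphere_tangential_derivative_zero[OF _ p _ y])
    have F': "(f has_derivative F) (at (emb t p))" using F by (simp only: emb_p[of t])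
    have "(emb t has_derivative emb t) (at p)"
      by (rule bounded_linear_imp_has_derivative[OF bounded_linear_emb])
    from has_derivative_compose[OF this F']
    show "((\<lambda>z. f (emb t z)) has_derivative (\<lambda>y. F (emb t y))) (at p)" .
    have "(emb t \<longlongrightarrow> P) (nhds p)"
      using isCont_tendsto_nhds[OF bounded_linear.isCont[OF bounded_linear_emb[of t], OF continuous_ident], of p]
      by (simp only: emb_p[of t])
    from eventually_compose_filterlim[OF zero this] S[OF t]
    show "\<forall>\<^sub>F z in nhds p. norm z = 1 \<longrightarrow> f (emb t z) = 0"
      by eventually_elim simp
  qed
  define u y where "u = (\<chi> j. w $ \<iota> j)" and "y = u - Re (herm u p) *\<^sub>R p"
  have py: "p \<bullet> y = 0"
    using p by (simp add: y_def inner_diff_right inner_commute[of p] inner_eq_Re_herm[symmetric]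
        power2_norm_eq_inner[symmetric] dot_square_norm)
  define L where "L = (\<Sum>j\<in>UNIV. l $ j * cnj (l $ j))"
  have "L = herm l l" by (simp add: L_def herm_def)
  then have L: "L \<noteq> 0" using l by (simp add: herm_self)
  define y' where "y' = (w $ m0 / L) *s (\<chi> j. cnj (l $ j))"
  have ly': "(\<Sum>j\<in>UNIV. l $ j * y' $ j) = w $ m0"
    using L by (simp add: y'_def L_def sum_divide_distrib[symmetric] sum_distrib_left[symmetric]
        mult.left_commute[of "l $ _"])
  have "herm y' p = (w $ m0 / L) * cnj (\<Sum>j\<in>UNIV. l $ j * p $ j)"
    by (simp add: herm_def y'_def sum_distrib_left mult.assoc)
  then have "y' \<bullet> p = 0" by (simp add: lp inner_eq_Re_herm)
  then have py': "p \<bullet> y' = 0" by (simp add: inner_commute)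
  have "w = Re (herm u p) *\<^sub>R P + emb 0 y + (emb 1 y' - emb 0 y')"
    by (rule vec_eqI_target) (simp_all add: ly' y_def u_def)
  then have "F w = F (Re (herm u p) *\<^sub>R P + emb 0 y + (emb 1 y' - emb 0 y'))" by simp
  also have "\<dots> = Re (herm u p) * F P"
    using tangential[of 0 y] tangential[of 0 y'] tangential[of 1 y'] py py'
    by (simp add: F.add F.diff F.scaleR)
  also have "Re (herm u p) = Drho P w / 2"
    by (simp add: Drho_P herm_def u_def)
  finally show "F w = F P / 2 * Drho P w" by simp
qed

text \<open>The vector \<open>v\<close> is tangent to \<open>M'\<close> at \<open>P\<close>, and along it the additional coordinate is purely imaginary while
  \<open>lam\<close> is real.  So \<open>del\<close> does not vanish at \<open>P + s (v + \<tau> P)\<close> for \<open>s > 0\<close>, and these points meet \<open>M'\<close> for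
  small \<open>\<tau>\<close>.\<close>

lemma points_off_the_cone:
  assumes "\<forall>\<^sub>F x in nhds P. A x"
  shows "\<exists>x. A x \<and> Re (rho x) = 0 \<and> del x \<noteq> 0"
proof -
  define L where "L = (norm l)\<^sup>2"
  have L: "L > 0" "(\<Sum>j\<in>UNIV. l $ j * cnj (l $ j)) = complex_of_real L"
    using l herm_self[of l] by (simp_all add: L_def herm_def)
  define v :: "complex^'m" where "v = (\<chi> i. if i = m0 then \<i> * of_real L else cnj (l $ inv \<iota> i))"
  have v: "v $ m0 = \<i> * of_real L" "v $ \<iota> j = cnj (l $ j)" for j
    by (simp_all add: v_def inv_f_f[OF inj_\<iota>])
  have lamv: "lam v = of_real L" by (simp add: lam_def v L(2))
  have lamP: "lam P = 0" by (simp add: lam_emb lp)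
  have "(\<Sum>j\<in>UNIV. v $ \<iota> j * cnj (p $ j)) = cnj (\<Sum>j\<in>UNIV. l $ j * p $ j)" by (simp add: v)
  then have Dv: "Drho P v = 0" by (simp add: Drho_P lp)
  have cont: "continuous_on UNIV (\<lambda>x. Re (rho x))"
    by (intro continuous_at_imp_continuous_on ballI continuous_Re cpoly_continuous cpoly_rho)
  have rP: "Re (rho P) = 0" using rho_emb[of 0 p] p by simp
  have DPP: "Drho P P > 0" by (simp add: Drho_P_P)
  have nP: "norm v + norm P + 1 > 0" by (intro add_nonneg_pos add_nonneg_nonneg) auto
  have "\<forall>\<^sub>F s in at_right (0::real). s > 0" by (rule eventually_at_right_less)
  moreover note level_set_crossing[OF has_derivative_Re_rho cont rP DPP Dv zero_less_one]
  moreover note eventually_along_ray[OF assms nP]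
  ultimately have "\<forall>\<^sub>F s in at_right (0::real). \<exists>x. A x \<and> Re (rho x) = 0 \<and> del x \<noteq> 0"
  proof eventually_elim
    case (elim s)
    then obtain \<tau> where \<tau>: "\<bar>\<tau>\<bar> \<le> 1" and zero: "Re (rho (P + s *\<^sub>R (v + \<tau> *\<^sub>R P))) = 0" by blast
    let ?x = "P + s *\<^sub>R (v + \<tau> *\<^sub>R P)"
    have "norm (v + \<tau> *\<^sub>R P) \<le> norm v + \<bar>\<tau>\<bar> * norm P" by (metis norm_scaleR norm_triangle_ineq)
    also have "\<dots> \<le> norm v + norm P + 1"
      using mult_right_mono[OF \<tau>, of "norm P"] by simp
    finally have "A ?x" using elim by blast
    moreover have "del ?x \<noteq> 0"
    proof -
      have xm: "?x $ m0 = \<i> * of_real (s * L)"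
        by (simp add: v lp) (simp add: scaleR_conv_of_real)
      have "lam ?x = lam P + of_real s * (lam v + of_real \<tau> * lam P)"
        unfolding lam_def vector_add_component vector_scaleR_component
        by (simp add: scaleR_conv_of_real distrib_left sum.distrib sum_distrib_left mult.left_commute)
      then have lx: "lam ?x = of_real (s * L)" by (simp add: lamP lamv)
      have "del ?x = of_real (s * L) ^ 2" unfolding del_def xm lx by (simp add: power2_eq_square field_simps)
      then show ?thesis using elim L(1) by simp
    qed
    ultimately show ?case using zero by blast
  qed
  then show ?thesis by simp
qed

text \<open>A submanifold through \<open>P\<close> would be a neighbourhood of \<open>P\<close> in \<open>M'\<close>, against the points off the cone.\<close>

lemma mapping_locus_singular:
  assumes unreached: "\<And>x. del x \<noteq> 0 \<Longrightarrow> x \<notin> mapping_locus k (sphere 0 1) p M'" and k: "k \<ge> 2"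
  shows "\<not> real_analytic_submanifold_of (mapping_locus k (sphere 0 1) p M') M'"
proof
  let ?S = "mapping_locus k (sphere 0 1) p M'"
  assume "real_analytic_submanifold_of ?S M'"
  moreover have cone: "\<forall>\<^sub>F z in nhds p. norm z = 1 \<longrightarrow> emb t z \<in> ?S" if "t \<in> \<real>" for t
    using nearby_points_in_mapping_locus[OF that] by eventually_elim (use k in blast)
  have PS: "P \<in> ?S" using eventually_nhds_x_imp_x[OF cone[of 0]] p by simp
  ultimately obtain d where codim: "real_analytic_codim_at d ?S P"
    unfolding real_analytic_submanifold_of_def by blast
  have "\<forall>\<^sub>F x in nhds P. Re (rho x) = 0 \<longrightarrow> x \<in> ?S"
  proof (rule submanifold_with_full_tangent_space_is_open[OF has_derivative_Re_rho _ isCont_Drho _ PS codim])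
    show "Drho P P > 0" by (simp add: Drho_P_P)
    show "Re (rho x) = 0" if "x \<in> ?S" for x using that by (simp add: mapping_locus_def M'_def)
    show "\<exists>\<kappa>::real. F = (\<lambda>v. \<kappa> * Drho P v)"
      if "(f has_derivative F) (at P)" "\<forall>\<^sub>F x in nhds P. x \<in> ?S \<longrightarrow> f x = 0" for f F
      using derivative_on_cone[OF that cone] by blast
  qed
  from points_off_the_cone[OF this] unreached show False by blast
qed

end

theorem theorem2:
  fixes p :: "complex^'n"
  assumes "CARD('n) \<ge> 2"
    and "CARD('m::finite) = CARD('n) + 1"
    and "p \<in> sphere 0 1"
  shows "\<exists>M' :: (complex^'m) set. real_analytic_hypersurface M' \<and>
    (\<forall>l\<ge>2. \<not> real_analytic_submanifold_of (mapping_locus l (sphere 0 1) p M') M')"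
proof -
  fix m0 :: 'm
  have "card (UNIV - {m0}) = CARD('n)" using assms(2) by simp
  then obtain \<iota> :: "'n \<Rightarrow> 'm" where "bij_betw \<iota> UNIV (UNIV - {m0})"
    using finite_same_card_bij[of "UNIV :: 'n set" "UNIV - {m0}"] by auto
  then have \<iota>: "inj \<iota>" "range \<iota> = UNIV - {m0}" by (auto simp: bij_betw_def)
  have p: "norm p = 1" using assms(3) by simp
  obtain e where e: "norm e = 1" "herm e p = 0" using exists_unit_orthogonal[OF assms(1)] by blast
  define l where "l = (\<chi> j. cnj (e $ j))"
  have l0: "l \<noteq> 0"
  proof
    assume "l = 0"
    then have "e = 0" by (auto simp: l_def vec_eq_iff)
    then show False using e by simp
  qed
  have "(\<Sum>j\<in>UNIV. l $ j * p $ j) = cnj (herm e p)" by (simp add: l_def herm_def)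
  then have lp: "(\<Sum>j\<in>UNIV. l $ j * p $ j) = 0" by (simp add: e)
  obtain idx :: "bool \<times> (bool \<times> bool \<times> bool \<times> 'm) \<times> bool \<times> (bool \<times> bool \<times> bool \<times> 'm) \<times> (bool \<times> bool \<times> bool \<times> 'm)
      \<Rightarrow> int \<times> int" and E
    where idx: "inj idx" and asym: "\<And>s t. (s, t) \<in> E \<Longrightarrow> (t, s) \<notin> E"
      and incident: "\<And>s t. (s, t) \<in> E \<Longrightarrow> snd (idx s) + snd (idx t) = fst (idx s) * fst (idx t)"
      and cardE: "card E \<ge> CARD(bool \<times> bool \<times> bool \<times> 'm) ^ 4"
    using many_incidences[where ?'k = "bool \<times> bool \<times> bool \<times> 'm"] by blast
  let ?N = "CARD(bool \<times> (bool \<times> bool \<times> bool \<times> 'm) \<times> bool \<times> (bool \<times> bool \<times> bool \<times> 'm) \<times> (bool \<times> bool \<times> bool \<times> 'm))"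
  (* With K = 8 m there are N = 4 K^3 nodes, hence N m = K^4 / 2. *)
  have "?N * CARD('m) < CARD(bool \<times> bool \<times> bool \<times> 'm) ^ 4"
    by (simp add: card_prod power4_eq_xxxx)
  then have cardE: "card E > ?N * CARD('m)" using cardE by linarith
  obtain k :: "_ \<Rightarrow> nat" where k: "bij_betw k (UNIV :: (bool \<times> (bool \<times> bool \<times> bool \<times> 'm) \<times> bool
      \<times> (bool \<times> bool \<times> bool \<times> 'm) \<times> (bool \<times> bool \<times> bool \<times> 'm)) set) {..<?N}"
    using ex_bij_betw_finite_nat[OF finite] unfolding atLeast0LessThan by blast
  (* The functions num and den are the same for every R; R = 0 serves to name them before c is chosen. *)
  interpret T0: target_hypersurface \<iota> m0 l p "\<lambda>_. 0"
    by unfold_locales (use \<iota> p l0 lp in \<open>auto intro: cpoly_const\<close>)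
  define bad where "bad r = {c. \<exists>W. inj (\<lambda>s. W s $ r) \<and>
    (\<forall>(s, t)\<in>E. T0.den (W s) (W t) \<noteq> 0 \<and>
       T0.num (W s) (W t) + T0.den (W s) (W t) * hermitian_poly k c (W s) (W t) = 0)}" for r
  have "negligible (bad r)" for r unfolding bad_def
    by (rule negligible_interpolating_coefficients[OF k asym cardE T0.differentiable_num_den])
  then have "negligible (\<Union>r. bad r)" by (intro negligible_Union) auto
  then have "(\<Union>r. bad r) \<noteq> UNIV" using non_negligible_UNIV by metis
  then obtain c where "\<And>r. c \<notin> bad r" by blast
  then have c: "\<not> (\<exists>W. inj (\<lambda>s. W s $ r) \<and> (\<forall>(s, t)\<in>E. T0.den (W s) (W t) \<noteq> 0 \<and>
       T0.num (W s) (W t) + T0.den (W s) (W t) * hermitian_poly k c (W s) (W t) = 0))" for r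
    unfolding bad_def by (simp only: mem_Collect_eq not_False_eq_True)
  let ?R = "\<lambda>x. hermitian_poly k c x x"
  interpret target_hypersurface \<iota> m0 l p ?R
    by unfold_locales (use \<iota> p l0 lp in \<open>auto intro: cpoly_hermitian_poly hermitian_poly_real\<close>)
  have m2: "CARD('m) \<ge> 2" using assms(1,2) by simp
  have "x \<notin> mapping_locus n (sphere 0 1) p M'" if "del x \<noteq> 0" for x n
    by (rule not_in_mapping_locus[OF assms(1) m2 refl idx incident c that])
  then show ?thesis
    using hypersurface_M' mapping_locus_singular by blast
qed

end
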